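(* Let $b$ be a prime, let $\alpha,s\in\mathbb{N}$ with $\alpha\ge 2$, let $1\le q,r\le\infty$ with Hölder conjugates $q',r'$ (so $1/q+1/q'=1/r+1/r'=1$), and let $\boldsymbol{\gamma}=(\gamma_u)_{u\subset\mathbb{N}}$ be a set of weights. Let $m\ge\alpha$, and for each $n\in\{m-\alpha+1,\ldots,m\}$ let $P_{b^n}=P(p_n,\boldsymbol{q}_n)\subset[0,1)^s$ be a polynomial lattice point set over $\mathbb{F}_b$ with $b^n$ points ($\deg p_n=n$, $\boldsymbol{q}_n\in(G^*_{b,n})^s$). Then $$\sup_{\substack{f\in W_{s,\alpha,\boldsymbol{\gamma},q,r}\\ \|f\|_{s,\alpha,\boldsymbol{\gamma},q,r}\le 1}}\left|\sum_{\tau=1}^{\alpha}a_\tau^{(\alpha)}I(f;P_{b^{m-\tau+1}})-I(f)\right|\le\sum_{\tau=1}^{\alpha}|a_\tau^{(\alpha)}|\left(B_{\boldsymbol{\gamma},r}(P_{b^{m-\tau+1}})+\frac{H_{s,\boldsymbol{\gamma},q,r}}{b^{\alpha(m-\tau+1)}}\right),$$ where $$B_{\boldsymbol{\gamma},r}(P_{b^{n}})=\Bigg(\sum_{\emptyset\ne u\subseteq\{1,\ldots,s\}}\Bigg(\gamma_uC_\alpha^{|u|}\sum_{\substack{\boldsymbol{k}_u\in P^{\perp}_{b^{n},u}\\ \exists j\in u:\ b^{n}\nmid k_j}}b^{-\mu_\alpha(\boldsymbol{k}_u)}\Bigg)^{r'}\Bigg)^{1/r'}$$ and $$H_{s,\boldsymbol{\gamma},q,r}=\Bigg(\sum_{u\subseteq\{1,\ldots,s\}}\gamma_u^{r'}(\alpha+1)^{|u|r'/q'}D_\alpha^{r'|u|}\Bigg)^{1/r'},\qquad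 D_\alpha=\max\Big\{|b_1|,\ldots,|b_{\alpha-1}|,\sup_{x\in[0,1)}|\tilde b_\alpha(x)|\Big\}$$ (with the obvious modifications, i.e. maxima instead of sums, if $r'=\infty$).
   Context: **Integration.** $I(f)=\int_{[0,1)^s}f(\boldsymbol{x})\,d\boldsymbol{x}$, and for a finite point set $P$ with $N$ points (counted with multiplicity), $I(f;P)=\frac1N\sum_{\boldsymbol{x}\in P}f(\boldsymbol{x})$. **Extrapolation coefficients.** $a_\nu^{(\tau)}=\prod_{j=1}^{\nu-1}\left(\frac{-1}{b^j-1}\right)\prod_{j=1}^{\tau-\nu}\left(\frac{b^j}{b^j-1}\right)$ for $1\le\nu\le\tau$; empty products equal $1$. **Bernoulli polynomials.** $B_\tau(\cdot)$ is the Bernoulli polynomial of degree $\tau$, $b_\tau(\cdot)=B_\tau(\cdot)/\tau!$, $b_\tau=b_\tau(0)$, and $\tilde b_\tau:\mathbb{R}\to\mathbb{R}$ is the one-periodic extension of $b_\tau(\cdot):[0,1)\to\mathbb{R}$. **Function space.** The weights $\gamma_u$ are non-negative reals indexed by finite $u\subset\mathbb{N}$. For $f:[0,1)^s\to\mathbb{R}$ having partial mixed derivatives up to order $\alpha$ in each variable, put $$\|f\|_{s,\alpha,\boldsymbol{\gamma},q,r}=\Bigg(\sum_{u\subseteq\{1,\ldots,s\}}\Bigg(\gamma_u^{-q}\sum_{v\subseteq u}\sum_{\boldsymbol{\tau}_{u\setminus v}\in\{1,\ldots,\alpha\}^{|u\setminus v|}}\int_{[0,1)^{|v|}}\left|\int_{[0,1)^{s-|v|}}f^{(\boldsymbol{\tau}_{u\setminus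 v},\boldsymbol{\alpha}_v,\boldsymbol{0})}(\boldsymbol{x})\,d\boldsymbol{x}_{-v}\right|^q d\boldsymbol{x}_v\Bigg)^{r/q}\Bigg)^{1/r},$$ with the obvious modifications if $q$ or $r$ is infinite (and when $\gamma_u=0$, the inner double sum for that $u$ is required to vanish, the $u$-term then being $0$). Here $f^{(\boldsymbol{\tau}_{u\setminus v},\boldsymbol{\alpha}_v,\boldsymbol{0})}$ is the partial mixed derivative of order $\beta_j$ in $x_j$, with $\beta_j=\tau_j$ for $j\in u\setminus v$, $\beta_j=\alpha$ for $j\in v$, $\beta_j=0$ for $j\notin u$; $\boldsymbol{x}_v=(x_j)_{j\in v}$ and $\boldsymbol{x}_{-v}=(x_j)_{j\in\{1,\ldots,s\}\setminus v}$. $W_{s,\alpha,\boldsymbol{\gamma},q,r}$ is the Banach–Sobolev space of all such functions with finite norm. It is a known fact about this space (from the literature) that its elements satisfy, at every point $\boldsymbol{y}$, $f(\boldsymbol{y})=\sum_{u\subseteq\{1,\ldots,s\}}f_u(\boldsymbol{y}_u)$ with $$f_u(\boldsymbol{y}_u)=\sum_{v\subseteq u}\sum_{\boldsymbol{\tau}_{u\setminus v}\in\{1,\ldots,\alpha\}^{|u\setminus v|}}\prod_{j\in u\setminus v}b_{\tau_j}(y_j)\,(-1)^{(\alpha+1)|v|}\int_{[0,1)^s}f^{(\boldsymbol{\tau}_{u\setminus v},\boldsymbol{\alpha}_v,\boldsymbol{0})}(\boldsymbol{x})\prod_{j\in v}\tilde b_\alpha(x_j-y_j)\,d\boldsymbol{x}.$$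 **Polynomial lattices.** $\mathbb{F}_b$ is identified with $\{0,\ldots,b-1\}$, and $n=\nu_0+\nu_1b+\cdots\in\mathbb{N}_0$ ($b$-adic expansion) with the polynomial $\nu_0+\nu_1x+\cdots\in\mathbb{F}_b[x]$. $G_{b,m}=\{q\in\mathbb{F}_b[x]:\deg q<m\}$, $G_{b,m}^*=G_{b,m}\setminus\{0\}$. The map $v_m:\mathbb{F}_b((x^{-1}))\to[0,1)$ is $v_m(\sum_{i=w}^\infty a_ix^{-i})=\sum_{i=\max\{1,w\}}^m a_ib^{-i}$. For $p\in\mathbb{F}_b[x]$ with $\deg p=m$ and $\boldsymbol{q}=(q_1,\ldots,q_s)\in(G^*_{b,m})^s$, the polynomial lattice point set $P(p,\boldsymbol{q})$ consists of the $b^m$ points $\boldsymbol{x}_n=(v_m(nq_1/p),\ldots,v_m(nq_s/p))$, $0\le n<b^m$. For $k=\kappa_0+\kappa_1b+\cdots\in\mathbb{N}_0$, $\mathrm{tr}_m(k)=\kappa_0+\kappa_1x+\cdots+\kappa_{m-1}x^{m-1}$ (applied componentwise to vectors), and the dual polynomial lattice is $P^\perp(p,\boldsymbol{q})=\{\boldsymbol{k}\in\mathbb{N}_0^s:\mathrm{tr}_m(\boldsymbol{k})\cdot\boldsymbol{q}\equiv0\pmod p\}$. For $P_{b^n}=P(p_n,\boldsymbol{q}_n)$ and $\emptyset\ne u\subseteq\{1,\ldots,s\}$, $P^\perp_{b^n,u}=\{\boldsymbol{k}_u\in\mathbb{N}^{|u|}:(\boldsymbol{k}_u,\boldsymbol{0})\in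 P^\perp(p_n,\boldsymbol{q}_n)\}$, where $(\boldsymbol{k}_u,\boldsymbol{0})$ has components $k_j$ for $j\in u$ and $0$ otherwise. **The quantities $\mu_\alpha$ and $C_\alpha$.** For $k=\kappa_1b^{a_1-1}+\cdots+\kappa_vb^{a_v-1}\in\mathbb{N}$ with $a_1>\cdots>a_v>0$ and $\kappa_i\in\{1,\ldots,b-1\}$, $\mu_\alpha(k)=a_1+\cdots+a_{\min(v,\alpha)}$; $\mu_\alpha(0)=0$; for vectors $\mu_\alpha(\boldsymbol{k})=\sum_j\mu_\alpha(k_j)$. Further $$C_\alpha=\max\left(\frac{2}{(2\sin\frac{\pi}{b})^\alpha},\max_{1\le z\le\alpha-1}\frac{1}{(2\sin\frac{\pi}{b})^z}\right)\left(1+\frac1b+\frac1{b(b+1)}\right)^{\alpha-2}\left(3+\frac2b+\frac{2b+1}{b-1}\right).$$ *)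

theory Defs
  imports
    "HOL-Probability.Probability"
    "HOL-Computational_Algebra.Formal_Laurent_Series"
    "Berlekamp_Zassenhaus.Finite_Field"
begin

text \<open>
  Points of $[0,1)^J$, for a finite index set \<open>J\<close>, are the elements of
  \<open>J \<rightarrow>\<^sub>E {0..<1}\<close>. The coordinates of $[0,1)^s$ are indexed by \<open>{1..s}\<close>.
\<close>

definition cube :: "nat set \<Rightarrow> (nat \<Rightarrow> real) measure" where
  "cube J = (\<Pi>\<^sub>M j\<in>J. restrict_space lborel {0..<1})"

definition cube_integral :: "nat \<Rightarrow> ((nat \<Rightarrow> real) \<Rightarrow> real) \<Rightarrow> real" where
  "cube_integral s f = (LINT x|cube {1..s}. f x)"

text \<open>Equal-weight quadrature rule; the point set is given as a sequence, so points are
  counted with multiplicity.\<close>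

definition qmc :: "nat \<Rightarrow> (nat \<Rightarrow> nat \<Rightarrow> real) \<Rightarrow> ((nat \<Rightarrow> real) \<Rightarrow> real) \<Rightarrow> real" where
  "qmc N X f = (\<Sum>h<N. f (X h)) / real N"

definition extrap_coeff :: "nat \<Rightarrow> nat \<Rightarrow> nat \<Rightarrow> real" where
  "extrap_coeff b \<tau> \<nu> =
     (\<Prod>j=1..\<nu>-1. - 1 / (real b ^ j - 1)) * (\<Prod>j=1..\<tau>-\<nu>. real b ^ j / (real b ^ j - 1))"


section \<open>Bernoulli polynomials\<close>

fun bernoulli_num :: "nat \<Rightarrow> real" where
  "bernoulli_num n =
     (if n = 0 then 1
      else - (\<Sum>k<n. real (Suc n choose k) * bernoulli_num k) / real (Suc n))"

declare bernoulli_num.simps [simp del]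

definition bernoulli_poly :: "nat \<Rightarrow> real \<Rightarrow> real" where
  "bernoulli_poly n x = (\<Sum>k\<le>n. real (n choose k) * bernoulli_num k * x ^ (n - k))"

definition bern :: "nat \<Rightarrow> real \<Rightarrow> real" where
  "bern \<tau> x = bernoulli_poly \<tau> x / fact \<tau>"

definition bern_per :: "nat \<Rightarrow> real \<Rightarrow> real" where
  "bern_per \<tau> x = bern \<tau> (frac x)"


section \<open>Powers and p-norms of extended nonnegative reals\<close>

text \<open>Only used for exponents \<open>p > 0\<close>.\<close>

definition epow :: "ennreal \<Rightarrow> real \<Rightarrow> ennreal" where
  "epow x p = (if x = \<infinity> then \<infinity> else ennreal (enn2real x powr p))"

definition lp_sum :: "ennreal \<Rightarrow> 'a set \<Rightarrow> ('a \<Rightarrow> ennreal) \<Rightarrow> ennreal" where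
  "lp_sum p A g =
     (if p = \<infinity> then (SUP a\<in>A. g a)
      else epow (\<Sum>a\<in>A. epow (g a) (enn2real p)) (1 / enn2real p))"


section \<open>The Sobolev space\<close>

text \<open>
  \<open>h\<close> is the derivative of the absolutely continuous function \<open>g\<close> on $[0,1)$: \<open>g\<close> has derivative
  \<open>h\<close> almost everywhere and is the indefinite integral of the integrable function \<open>h\<close>.
  (Without the second part a function would not be determined by its derivative up to a constant.)
\<close>

definition ac_deriv :: "(real \<Rightarrow> real) \<Rightarrow> (real \<Rightarrow> real) \<Rightarrow> bool" where
  "ac_deriv g h \<longleftrightarrow>
     (AE t\<in>{0..<1} in lborel. (g has_real_derivative h t) (at t within {0..<1})) \<and>
     set_integrable lborel {0..<1} h \<and>
     (\<forall>t\<in>{0..<1}. g t = g 0 + (LBINT u:{0..<t}. h u))"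

definition multi_orders :: "nat \<Rightarrow> nat \<Rightarrow> (nat \<Rightarrow> nat) set" where
  "multi_orders s \<alpha> = {\<beta>. (\<forall>j\<in>{1..s}. \<beta> j \<le> \<alpha>) \<and> (\<forall>j. j \<notin> {1..s} \<longrightarrow> \<beta> j = 0)}"

text \<open>
  \<open>D \<beta>\<close>, for \<open>\<beta> \<in> {0,\<dots>,\<alpha>}\<^sup>s\<close>, is the partial mixed derivative of \<open>f\<close> of order \<open>\<beta> j\<close> in
  coordinate \<open>j\<close>. Derivatives of order less than \<open>\<alpha>\<close> in a coordinate are absolutely continuous in
  that coordinate. A derivative of full order \<open>\<alpha>\<close> exactly in the coordinates \<open>v\<close> is an integrable
  function that is meaningful only for almost every value of these coordinates, but for every value
  of the others; in particular for \<open>v = {}\<close> the conditions hold at every point.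
\<close>

definition is_mixed_derivs ::
    "nat \<Rightarrow> nat \<Rightarrow> ((nat \<Rightarrow> real) \<Rightarrow> real) \<Rightarrow> ((nat \<Rightarrow> nat) \<Rightarrow> (nat \<Rightarrow> real) \<Rightarrow> real) \<Rightarrow> bool" where
  "is_mixed_derivs s \<alpha> f D \<longleftrightarrow>
     (\<forall>x\<in>space (cube {1..s}). D (\<lambda>_. 0) x = f x) \<and>
     (\<forall>\<beta>\<in>multi_orders s \<alpha>. integrable (cube {1..s}) (D \<beta>)) \<and>
     (\<forall>\<beta>\<in>multi_orders s \<alpha>. \<forall>j\<in>{1..s}. \<beta> j < \<alpha> \<longrightarrow>
        (let v = {i\<in>{1..s}. \<beta> i = \<alpha>} in
         AE y in cube v. \<forall>x\<in>space (cube {1..s}). restrict x v = y \<longrightarrow>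
           ac_deriv (\<lambda>t. D \<beta> (x(j := t))) (\<lambda>t. D (\<beta>(j := Suc (\<beta> j))) (x(j := t)))))"

text \<open>Top-order derivatives are only determined up to null sets, which does not affect the norm.\<close>

definition mixed_deriv ::
    "nat \<Rightarrow> nat \<Rightarrow> ((nat \<Rightarrow> real) \<Rightarrow> real) \<Rightarrow> (nat \<Rightarrow> nat) \<Rightarrow> (nat \<Rightarrow> real) \<Rightarrow> real" where
  "mixed_deriv s \<alpha> f = (SOME D. is_mixed_derivs s \<alpha> f D)"

text \<open>The order $(\tau_{u \setminus v}, \alpha_v, 0)$.\<close>

definition deriv_order :: "nat \<Rightarrow> nat set \<Rightarrow> nat set \<Rightarrow> (nat \<Rightarrow> nat) \<Rightarrow> nat \<Rightarrow> nat" where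
  "deriv_order \<alpha> u v \<tau> j = (if j \<in> v then \<alpha> else if j \<in> u then \<tau> j else 0)"

text \<open>The absolute value of the inner integral of the norm, as a function of \<open>y\<close> $= x_v$.\<close>

definition marginal_deriv ::
    "nat \<Rightarrow> nat \<Rightarrow> ((nat \<Rightarrow> real) \<Rightarrow> real) \<Rightarrow> nat set \<Rightarrow> nat set \<Rightarrow> (nat \<Rightarrow> nat) \<Rightarrow> (nat \<Rightarrow> real)
      \<Rightarrow> ennreal" where
  "marginal_deriv s \<alpha> f u v \<tau> y =
     ennreal \<bar>LINT z|cube ({1..s} - v).
        mixed_deriv s \<alpha> f (deriv_order \<alpha> u v \<tau>) (merge v ({1..s} - v) (y, z))\<bar>"

text \<open>
  The contribution of \<open>u\<close> to the norm, before taking the \<open>r\<close>-norm over \<open>u\<close>. If \<open>\<gamma> u = 0\<close> then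
  \<open>inverse (ennreal (\<gamma> u)) = \<infinity>\<close>, so with \<open>\<infinity> * 0 = 0\<close> the term is \<open>0\<close> if the inner double sum
  vanishes and \<open>\<infinity>\<close> otherwise.
\<close>

definition sobolev_term ::
    "nat \<Rightarrow> nat \<Rightarrow> (nat set \<Rightarrow> real) \<Rightarrow> ennreal \<Rightarrow> ((nat \<Rightarrow> real) \<Rightarrow> real) \<Rightarrow> nat set \<Rightarrow> ennreal" where
  "sobolev_term s \<alpha> \<gamma> q f u =
     (if q = \<infinity> then
        inverse (ennreal (\<gamma> u)) *
          (SUP v\<in>Pow u. SUP \<tau>\<in>(u - v) \<rightarrow>\<^sub>E {1..\<alpha>}. esssup (cube v) (marginal_deriv s \<alpha> f u v \<tau>))
      else
        epow (epow (inverse (ennreal (\<gamma> u))) (enn2real q) *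
                (\<Sum>v\<in>Pow u. \<Sum>\<tau>\<in>(u - v) \<rightarrow>\<^sub>E {1..\<alpha>}.
                   \<integral>\<^sup>+ y. epow (marginal_deriv s \<alpha> f u v \<tau> y) (enn2real q) \<partial>cube v))
             (1 / enn2real q))"

definition sobolev_norm ::
    "nat \<Rightarrow> nat \<Rightarrow> (nat set \<Rightarrow> real) \<Rightarrow> ennreal \<Rightarrow> ennreal \<Rightarrow> ((nat \<Rightarrow> real) \<Rightarrow> real) \<Rightarrow> ennreal" where
  "sobolev_norm s \<alpha> \<gamma> q r f = lp_sum r (Pow {1..s}) (sobolev_term s \<alpha> \<gamma> q f)"

definition sobolev_space ::
    "nat \<Rightarrow> nat \<Rightarrow> (nat set \<Rightarrow> real) \<Rightarrow> ennreal \<Rightarrow> ennreal \<Rightarrow> ((nat \<Rightarrow> real) \<Rightarrow> real) set" where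
  "sobolev_space s \<alpha> \<gamma> q r =
     {f. (\<exists>D. is_mixed_derivs s \<alpha> f D) \<and> sobolev_norm s \<alpha> \<gamma> q r f < \<infinity>}"


section \<open>Polynomial lattices\<close>

text \<open>
  The prime field with \<open>b = CARD('b)\<close> elements is \<open>'b mod_ring\<close>.
  The field $F_b((x^{-1}))$ is \<open>'b mod_ring fls\<close>, with \<open>fls_X\<close> in the role of $x^{-1}$; hence
  the coefficient of $x^{-i}$ is \<open>fls_nth L i\<close>, and $x$ is \<open>fls_X_inv\<close>.
\<close>

definition poly_to_laurent :: "'a::field poly \<Rightarrow> 'a fls" where
  "poly_to_laurent p = poly (map_poly fls_const p) fls_X_inv"

text \<open>The \<open>b\<close>-adic digits of \<open>n\<close> at positions \<open>i \<ge> n\<close> are zero.\<close>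

definition nat_poly :: "nat \<Rightarrow> 'b::prime_card mod_ring poly" where
  "nat_poly n = (\<Sum>i<n. Polynomial.monom (of_nat (n div CARD('b) ^ i mod CARD('b))) i)"

definition tr_poly :: "nat \<Rightarrow> nat \<Rightarrow> 'b::prime_card mod_ring poly" where
  "tr_poly m k = (\<Sum>i<m. Polynomial.monom (of_nat (k div CARD('b) ^ i mod CARD('b))) i)"

text \<open>Coefficients of positive powers of $x$ and the constant one do not contribute;
  those of $x^{-i}$ below the order of the series are zero.\<close>

definition v_map :: "nat \<Rightarrow> 'b::prime_card mod_ring fls \<Rightarrow> real" where
  "v_map m L = (\<Sum>i=1..m. real_of_int (to_int_mod_ring (fls_nth L (int i))) / real CARD('b) ^ i)"

definition poly_lattice_point ::
    "nat \<Rightarrow> nat \<Rightarrow> 'b::prime_card mod_ring poly \<Rightarrow> (nat \<Rightarrow> 'b mod_ring poly) \<Rightarrow> nat \<Rightarrow> nat \<Rightarrow> real" where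
  "poly_lattice_point s m p Q h =
     (\<lambda>j\<in>{1..s}. v_map m (poly_to_laurent (nat_poly h * Q j) / poly_to_laurent p))"

definition dual_lattice ::
    "nat \<Rightarrow> nat \<Rightarrow> 'b::prime_card mod_ring poly \<Rightarrow> (nat \<Rightarrow> 'b mod_ring poly) \<Rightarrow> (nat \<Rightarrow> nat) set" where
  "dual_lattice s m p Q = {k \<in> {1..s} \<rightarrow>\<^sub>E UNIV. p dvd (\<Sum>j=1..s. tr_poly m (k j) * Q j)}"

definition dual_lattice_proj ::
    "nat \<Rightarrow> nat \<Rightarrow> 'b::prime_card mod_ring poly \<Rightarrow> (nat \<Rightarrow> 'b mod_ring poly) \<Rightarrow> nat set
      \<Rightarrow> (nat \<Rightarrow> nat) set" where
  "dual_lattice_proj s m p Q u =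
     {k \<in> u \<rightarrow>\<^sub>E {1..}. (\<lambda>j\<in>{1..s}. if j \<in> u then k j else 0) \<in> dual_lattice s m p Q}"


section \<open>The constants of the error bound\<close>

text \<open>The positions \<open>a\<^sub>1 > a\<^sub>2 > \<dots>\<close> are those of the nonzero \<open>b\<close>-adic digits, counted from \<open>1\<close>.\<close>

definition digit_positions :: "nat \<Rightarrow> nat \<Rightarrow> nat set" where
  "digit_positions b k = {a. a \<ge> 1 \<and> k div b ^ (a - 1) mod b \<noteq> 0}"

definition mu :: "nat \<Rightarrow> nat \<Rightarrow> nat \<Rightarrow> nat" where
  "mu b \<alpha> k = sum_list (take \<alpha> (rev (sorted_list_of_set (digit_positions b k))))"

definition C_const :: "nat \<Rightarrow> nat \<Rightarrow> real" where
  "C_const b \<alpha> =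
     max (2 / (2 * sin (pi / real b)) ^ \<alpha>)
         (Max ((\<lambda>z. 1 / (2 * sin (pi / real b)) ^ z) ` {1..\<alpha>-1})) *
     (1 + 1 / real b + 1 / (real b * (real b + 1))) ^ (\<alpha> - 2) *
     (3 + 2 / real b + (2 * real b + 1) / (real b - 1))"

definition D_const :: "nat \<Rightarrow> real" where
  "D_const \<alpha> = Max (insert (SUP x\<in>{0..<1}. \<bar>bern_per \<alpha> x\<bar>) ((\<lambda>\<tau>. \<bar>bern \<tau> 0\<bar>) ` {1..\<alpha>-1}))"

text \<open>Here and below \<open>r'\<close> and \<open>q'\<close> denote the conjugate exponents.\<close>

definition B_bound ::
    "nat \<Rightarrow> nat \<Rightarrow> (nat set \<Rightarrow> real) \<Rightarrow> ennreal \<Rightarrow> nat \<Rightarrow> 'b::prime_card mod_ring poly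
      \<Rightarrow> (nat \<Rightarrow> 'b mod_ring poly) \<Rightarrow> ennreal" where
  "B_bound s \<alpha> \<gamma> r' n p Q =
     lp_sum r' (Pow {1..s} - {{}}) (\<lambda>u.
       ennreal (\<gamma> u * C_const CARD('b) \<alpha> ^ card u) *
       (\<Sum>\<^sub>\<infinity>k\<in>{k \<in> dual_lattice_proj s n p Q u. \<exists>j\<in>u. \<not> CARD('b) ^ n dvd k j}.
          ennreal (1 / real CARD('b) ^ (\<Sum>j\<in>u. mu CARD('b) \<alpha> (k j)))))"

text \<open>In \<open>H_bound\<close> the exponents \<open>|u| r' / q'\<close> and \<open>r' |u|\<close> arise from the outer power \<open>r'\<close>;
  \<open>1 / q' = 0\<close> if \<open>q' = \<infinity>\<close>.\<close>

definition H_bound ::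
    "nat \<Rightarrow> nat \<Rightarrow> (nat set \<Rightarrow> real) \<Rightarrow> ennreal \<Rightarrow> ennreal \<Rightarrow> ennreal" where
  "H_bound s \<alpha> \<gamma> q' r' =
     lp_sum r' (Pow {1..s}) (\<lambda>u.
       ennreal (\<gamma> u * real (\<alpha> + 1) powr (real (card u) * enn2real (1 / q')) * D_const \<alpha> ^ card u))"

end

theory Submission
  imports Defs
begin

text \<open>
  The proof compares three averages of \<open>f\<close>: over the polynomial lattice with \<open>b ^ n\<close> points, over the
  full regular grid of mesh \<open>b ^ - n\<close>, and over the cube.

  By the Bernoulli expansion \<open>bernoulli_expansion_subsets\<close>, \<open>f y\<close> is a sum of integrals of mixed
  derivatives of \<open>f\<close> against products of one-dimensional kernels. As functions of \<open>y\<close> these kernels are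
  the Bernoulli polynomials of degree \<open>1, \<dots>, \<alpha>\<close> and, for the remainder, the translates of the
  periodic Bernoulli function of degree \<open>\<alpha>\<close>. So it is enough to know the averages of products of such
  kernels, uniformly in the position of the translates.

  Averages over the full grid factorise. By the multiplication theorem for Bernoulli polynomials
  they are exact powers of \<open>b ^ - n\<close> with coefficients that do not depend on \<open>n\<close>, unless a remainder
  kernel occurs, which already gives \<open>b ^ (- \<alpha> n)\<close>. The generating polynomial of the extrapolation
  coefficients vanishes at \<open>b, \<dots>, b ^ (\<alpha> - 1)\<close> and has value \<open>1\<close> at \<open>1\<close>, so the combination over the
  different \<open>n\<close> removes all powers of order below \<open>\<alpha>\<close> and reproduces the integral. What is left is the
  term with \<open>H_bound\<close>: see \<open>extrapolated_grid_kernels_le\<close>.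

  The difference between the lattice and the full grid is a finite sum, since only the values at the
  grid points matter and these are inverted by the discrete Walsh transform with \<open>b ^ n\<close> frequencies
  per coordinate (\<open>DW_inversion\<close>). Averaging over the lattice keeps the frequency vectors in the
  dual lattice (\<open>lattice_average_prod\<close>), and the zero vector among them gives the average over the
  grid. Each nonzero one is bounded by the decay of the Walsh coefficients of Bernoulli functions,
  \<open>norm_DW_bern_per_le\<close>: every nonzero digit at position \<open>a\<close> is traded, by summation by parts, for one
  derivative and a factor \<open>b ^ - a\<close>, at most \<open>\<alpha>\<close> times. Summed over all kernels the bounds stay below
  the constant \<open>C_const\<close>. A coordinate with frequency zero is paid for by the multiples of \<open>b ^ n\<close>
  in the dual lattice (\<open>sum_lift_weights_le\<close>). This is the term with \<open>B_bound\<close>.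

  Finally each integral of a mixed derivative against a kernel depends on the derivative only through
  a marginal, and the Hoelder inequality, first over the kernels and then over the sets of
  coordinates, turns these marginals into the norm.
\<close>

section \<open>Bernoulli polynomials\<close>

lemma sum_binomial_bernoulli_num:
  assumes "n \<ge> 2"
  shows "(\<Sum>k<n. real (n choose k) * bernoulli_num k) = 0"
proof -
  obtain m where m: "n = Suc m" "m \<ge> 1"
    using assms by (cases n) auto
  have "bernoulli_num m = - (\<Sum>k<m. real (Suc m choose k) * bernoulli_num k) / real (Suc m)"
    using m(2) by (subst bernoulli_num.simps) simp
  then have "real (Suc m) * bernoulli_num m = - (\<Sum>k<m. real (Suc m choose k) * bernoulli_num k)"
    by (simp add: field_simps)
  then show ?thesis
    unfolding m(1) by simp
qed

lemma bern_0 [simp]: "bern 0 x = 1"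
  by (simp add: bern_def bernoulli_poly_def bernoulli_num.simps)

lemma bern_1: "bern 1 x = x - 1/2"
proof -
  have "bernoulli_num 1 = - (1/2)"
    by (subst bernoulli_num.simps) (simp add: bernoulli_num.simps[of 0])
  then show ?thesis
    by (simp add: bern_def bernoulli_poly_def bernoulli_num.simps[of 0])
qed

lemma bernoulli_poly_Suc_DERIV:
  "(bernoulli_poly (Suc n) has_real_derivative real (Suc n) * bernoulli_poly n x) (at x)"
proof -
  have eq: "real (Suc n choose k) * bernoulli_num k * (real (Suc n - k) * x ^ (Suc n - k - 1)) =
      real (Suc n) * (real (n choose k) * bernoulli_num k * x ^ (n - k))" if "k \<le> n" for k
  proof -
    have "(Suc n - k) * (Suc n choose k) = Suc n * (n choose k)"
      using binomial_absorb_comp[of "Suc n" k] by simp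
    then have "real (Suc n - k) * real (Suc n choose k) = real (Suc n) * real (n choose k)"
      by (metis of_nat_mult)
    moreover have "Suc n - k - 1 = n - k" by simp
    ultimately show ?thesis
      by (metis (no_types, opaque_lifting) mult.assoc mult.commute)
  qed
  have "((\<lambda>x. \<Sum>k\<le>Suc n. real (Suc n choose k) * bernoulli_num k * x ^ (Suc n - k))
      has_real_derivative
      (\<Sum>k\<le>Suc n. real (Suc n choose k) * bernoulli_num k * (real (Suc n - k) * x ^ (Suc n - k - 1)))) (at x)"
    by (rule DERIV_sum) (auto intro!: derivative_eq_intros)
  also have "(\<Sum>k\<le>Suc n. real (Suc n choose k) * bernoulli_num k * (real (Suc n - k) * x ^ (Suc n - k - 1)))
     = real (Suc n) * bernoulli_poly n x"
  proof -
    have "(\<Sum>k\<le>n. real (Suc n choose k) * bernoulli_num k * (real (Suc n - k) * x ^ (Suc n - k - 1))) =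
        (\<Sum>k\<le>n. real (Suc n) * (real (n choose k) * bernoulli_num k * x ^ (n - k)))"
      by (rule sum.cong[OF refl], rule eq) simp
    then show ?thesis
      unfolding bernoulli_poly_def sum_distrib_left sum.atMost_Suc by simp
  qed
  finally show ?thesis
    by (simp add: bernoulli_poly_def[abs_def])
qed

lemma bern_Suc_DERIV: "(bern (Suc \<tau>) has_real_derivative bern \<tau> x) (at x)"
proof -
  have "((\<lambda>x. bernoulli_poly (Suc \<tau>) x / fact (Suc \<tau>)) has_real_derivative
      real (Suc \<tau>) * bernoulli_poly \<tau> x / fact (Suc \<tau>)) (at x)"
    by (rule DERIV_cdivide[OF bernoulli_poly_Suc_DERIV])
  also have "real (Suc \<tau>) * bernoulli_poly \<tau> x / fact (Suc \<tau>) = bern \<tau> x"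
    by (simp add: bern_def del: of_nat_Suc)
  finally show ?thesis
    by (simp add: bern_def[abs_def])
qed

lemma continuous_bern: "continuous_on S (bern \<tau>)"
proof (cases \<tau>)
  case 0
  have "bern 0 = (\<lambda>x. 1)" by auto
  then show ?thesis using 0 by simp
next
  case (Suc n)
  then show ?thesis
    using bern_Suc_DERIV DERIV_isCont continuous_at_imp_continuous_on by metis
qed

lemma bern_at_1:
  assumes "\<tau> \<ge> 2"
  shows "bern \<tau> 1 = bern \<tau> 0"
proof -
  have "bernoulli_poly \<tau> 0 = bernoulli_num \<tau>"
  proof -
    have "bernoulli_poly \<tau> 0 = (\<Sum>k\<le>\<tau>. if k = \<tau> then bernoulli_num \<tau> else 0)"
      unfolding bernoulli_poly_def by (rule sum.cong) auto
    then show ?thesis by simp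
  qed
  moreover have "bernoulli_poly \<tau> 1 = bernoulli_num \<tau>"
    using sum_binomial_bernoulli_num[OF assms]
    by (simp add: bernoulli_poly_def lessThan_Suc_atMost[symmetric])
  ultimately show ?thesis by (simp add: bern_def)
qed

text \<open>
  The functions \<open>bern \<tau>\<close> are the only sequence of iterated antiderivatives of \<open>1\<close> whose members
  of index at least two take the same value at both ends of the unit interval: a wrong constant
  of integration at one index would show up as a nonzero increment at the next index. Both the
  reflection formula and the multiplication theorem follow from this.
\<close>

lemma bern_unique:
  fixes G :: "nat \<Rightarrow> real \<Rightarrow> real"
  assumes G0: "\<And>x. G 0 x = 1"
    and deriv: "\<And>\<tau> x. (G (Suc \<tau>) has_real_derivative G \<tau> x) (at x)"
    and per: "\<And>\<tau>. \<tau> \<ge> 2 \<Longrightarrow> G \<tau> 1 = G \<tau> 0"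
  shows "G \<tau> x = bern \<tau> x"
proof (induction \<tau> arbitrary: x)
  case 0
  then show ?case by (simp add: G0)
next
  case (Suc \<tau>)
  define c where "c = G (Suc \<tau>) 0 - bern (Suc \<tau>) 0"
  have c: "G (Suc \<tau>) x - bern (Suc \<tau>) x = c" for x
  proof -
    have "((\<lambda>x. G (Suc \<tau>) x - bern (Suc \<tau>) x) has_real_derivative 0) (at x)" for x
      using DERIV_diff[OF deriv[of \<tau> x] bern_Suc_DERIV[of \<tau> x]] Suc.IH by simp
    then show ?thesis
      unfolding c_def using DERIV_isconst_all by blast
  qed
  define h where "h x = G (Suc (Suc \<tau>)) x - bern (Suc (Suc \<tau>)) x - c * x" for x
  have "(h has_real_derivative 0) (at x)" for x
  proof -
    have "(h has_real_derivative G (Suc \<tau>) x - bern (Suc \<tau>) x - c) (at x)"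
      unfolding h_def using deriv[of "Suc \<tau>" x] bern_Suc_DERIV[of "Suc \<tau>" x]
      by (auto intro!: derivative_eq_intros)
    then show ?thesis by (simp add: c)
  qed
  then have "h 1 = h 0"
    using DERIV_isconst_all by blast
  then have "c = 0"
    using per[of "Suc (Suc \<tau>)"] bern_at_1[of "Suc (Suc \<tau>)"] by (simp add: h_def)
  then show ?case using c[of x] by simp
qed

lemma bern_reflect: "bern \<tau> (1 - x) = (-1) ^ \<tau> * bern \<tau> x"
proof -
  define G where "G \<tau> x = (-1) ^ \<tau> * bern \<tau> (1 - x)" for \<tau> and x :: real
  have "G \<tau> x = bern \<tau> x"
  proof (rule bern_unique)
    show "G 0 x = 1" for x by (simp add: G_def)
    show "(G (Suc \<tau>) has_real_derivative G \<tau> x) (at x)" for \<tau> x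
    proof -
      have "((\<lambda>x. bern (Suc \<tau>) (1 - x)) has_real_derivative bern \<tau> (1 - x) * (- 1)) (at x)"
        by (rule DERIV_chain2[OF bern_Suc_DERIV]) (auto intro!: derivative_eq_intros)
      from DERIV_cmult[OF this, of "(-1) ^ Suc \<tau>"] show ?thesis
        by (simp add: G_def[abs_def])
    qed
    show "G \<tau> 1 = G \<tau> 0" if "\<tau> \<ge> 2" for \<tau>
      using bern_at_1[OF that] by (simp add: G_def)
  qed
  then have "(-1) ^ \<tau> * bern \<tau> x = (-1) ^ \<tau> * ((-1) ^ \<tau> * bern \<tau> (1 - x))"
    by (simp add: G_def)
  then show ?thesis
    by (simp add: mult.assoc[symmetric] power_mult_distrib[symmetric])
qed

lemma bern_multiplication:
  assumes N: "N > 0"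
  shows "(\<Sum>d<N. bern \<tau> ((x + real d) / real N)) = real N / real N ^ \<tau> * bern \<tau> x"
proof -
  define G where "G \<tau> x = real N ^ \<tau> / real N * (\<Sum>d<N. bern \<tau> ((x + real d) / real N))" for \<tau> x
  have "G \<tau> x = bern \<tau> x"
  proof (rule bern_unique)
    show "G 0 x = 1" for x using N by (simp add: G_def)
    show "(G (Suc \<tau>) has_real_derivative G \<tau> x) (at x)" for \<tau> x
    proof -
      have "((\<lambda>x. \<Sum>d<N. bern (Suc \<tau>) ((x + real d) / real N)) has_real_derivative
          (\<Sum>d<N. bern \<tau> ((x + real d) / real N) * (1 / real N))) (at x)"
        by (intro DERIV_sum DERIV_chain2[OF bern_Suc_DERIV]) (auto intro!: derivative_eq_intros)
      from DERIV_cmult[OF this, of "real N ^ Suc \<tau> / real N"] show ?thesis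
        using N by (simp add: G_def[abs_def] sum_divide_distrib[symmetric])
    qed
    show "G \<tau> 1 = G \<tau> 0" if "\<tau> \<ge> 2" for \<tau>
    proof -
      have "(\<Sum>d<N. bern \<tau> ((1 + real d) / real N) - bern \<tau> (real d / real N)) =
          bern \<tau> (real N / real N) - bern \<tau> 0"
        using sum_lessThan_telescope[of "\<lambda>d. bern \<tau> (real d / real N)" N]
        by (simp add: add.commute)
      then show ?thesis
        using bern_at_1[OF that] N by (simp add: G_def sum_subtractf)
    qed
  qed
  then show ?thesis using N by (simp add: G_def field_simps)
qed

lemma bern_per_plus_int [simp]: "bern_per \<tau> (x + of_int n) = bern_per \<tau> x"
  by (simp add: bern_per_def frac_def)

lemma bern_per_plus_1 [simp]: "bern_per \<tau> (x + 1) = bern_per \<tau> x"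
  using bern_per_plus_int[of \<tau> x 1] by simp

lemma bern_per_eq_bern: "x \<in> {0..<1} \<Longrightarrow> bern_per \<tau> x = bern \<tau> x"
  by (simp add: bern_per_def frac_eq)

lemma bern_per_measurable [measurable]: "bern_per \<tau> \<in> borel_measurable borel"
proof -
  have [measurable]: "bern \<tau> \<in> borel_measurable borel"
    by (rule borel_measurable_continuous_onI) (rule continuous_bern)
  show ?thesis unfolding bern_per_def[abs_def] frac_def by measurable
qed

lemma bern_per_on_unit_interval:
  assumes "\<tau> \<ge> 2" and "x \<in> {of_int n..of_int n + 1}"
  shows "bern_per \<tau> x = bern \<tau> (x - of_int n)"
proof (cases "x = of_int n + 1")
  case True
  then show ?thesis using bern_at_1[OF assms(1)] by (simp add: bern_per_def frac_def)
next
  case False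
  then have "\<lfloor>x\<rfloor> = n" using assms(2) by (intro floor_unique) auto
  then show ?thesis by (simp add: bern_per_def frac_def)
qed

lemma isCont_bern_per:
  assumes "\<tau> \<ge> 2"
  shows "isCont (bern_per \<tau>) x"
proof -
  have *: "continuous_on {of_int n..of_int n + 1} (bern_per \<tau>)" for n
  proof -
    have "continuous_on {of_int n..of_int n + 1} (\<lambda>x. bern \<tau> (x - of_int n))"
      by (rule continuous_on_compose2[OF continuous_bern[of UNIV]]) (auto intro!: continuous_intros)
    then show ?thesis
      by (rule continuous_on_eq) (metis bern_per_on_unit_interval[OF assms])
  qed
  define n where "n = \<lfloor>x\<rfloor>"
  have "continuous_on ({of_int (n-1)..of_int (n-1) + 1} \<union> {of_int n..of_int n + 1}) (bern_per \<tau>)"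
    by (intro continuous_on_closed_Un *) auto
  moreover have "{of_int (n-1)..of_int (n-1) + 1} \<union> {of_int n..of_int n + 1} = {of_int n - 1..of_int n + (1::real)}"
    by auto
  ultimately have "continuous_on {of_int n - 1..of_int n + 1} (bern_per \<tau>)"
    by simp
  moreover have "x \<in> interior {of_int n - 1..of_int n + 1}"
    unfolding n_def interior_atLeastAtMost_real greaterThanLessThan_iff by linarith
  ultimately show ?thesis
    by (rule continuous_on_interior)
qed

lemma bern_per_DERIV:
  assumes "x \<notin> \<int>"
  shows "(bern_per (Suc \<tau>) has_real_derivative bern_per \<tau> x) (at x)"
proof -
  define n where "n = \<lfloor>x\<rfloor>"
  have x: "x \<in> {of_int n<..<of_int n + 1}"
    using assms unfolding n_def by (metis Ints_of_int floor_correct greaterThanLessThan_iff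
        less_le of_int_1 of_int_add)
  have fl: "\<lfloor>t\<rfloor> = n" if "t \<in> {of_int n<..<of_int n + 1}" for t :: real
    using that by (intro floor_unique) auto
  have "((\<lambda>x. bern (Suc \<tau>) (x - of_int n)) has_real_derivative bern \<tau> (x - of_int n) * 1) (at x)"
    by (rule DERIV_chain2[OF bern_Suc_DERIV]) (auto intro!: derivative_eq_intros)
  then have "(bern_per (Suc \<tau>) has_real_derivative bern \<tau> (x - of_int n) * 1) (at x)"
    by (rule has_field_derivative_transform_within_open[OF _ _ x]) (auto simp: bern_per_def frac_def fl)
  moreover have "bern_per \<tau> x = bern \<tau> (x - of_int n)"
    using fl[OF x] by (simp add: bern_per_def frac_def)
  ultimately show ?thesis by simp
qed

lemma finite_Ints_in_interval: "finite ({x..y} \<inter> (\<int> :: real set))"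
proof (rule finite_subset)
  show "{x..y} \<inter> \<int> \<subseteq> of_int ` {\<lfloor>x\<rfloor>..\<lceil>y\<rceil>}"
    by (auto elim!: Ints_cases intro!: imageI simp: floor_le_iff le_ceiling_iff)
qed auto

lemma bern_per_has_integral:
  assumes "\<tau> \<ge> 1" and "x \<le> y"
  shows "(bern_per \<tau> has_integral bern_per (Suc \<tau>) y - bern_per (Suc \<tau>) x) {x..y}"
proof (rule fundamental_theorem_of_calculus_strong)
  show "finite ({x..y} \<inter> (\<int> :: real set))" by (rule finite_Ints_in_interval)
  show "(bern_per (Suc \<tau>) has_vector_derivative bern_per \<tau> t) (at t)"
    if "t \<in> {x..y} - {x..y} \<inter> \<int>" for t
    using bern_per_DERIV[of t \<tau>] that by (auto simp: has_real_derivative_iff_has_vector_derivative)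
  show "continuous_on {x..y} (bern_per (Suc \<tau>))"
    using assms by (intro continuous_at_imp_continuous_on ballI isCont_bern_per) auto
qed (rule assms)

text \<open>
  The bound is needed where \<open>F\<close> has corners, so it is stated for indefinite integrals and not
  for differentiable functions.
\<close>

lemma Lipschitz_if_has_integral:
  fixes F :: "real \<Rightarrow> 'a :: euclidean_space"
  assumes int: "\<And>x y. x \<le> y \<Longrightarrow> (f has_integral F y - F x) {x..y}"
    and bound: "\<And>t. norm (f t) \<le> B"
  shows "norm (F y - F x) \<le> B * \<bar>y - x\<bar>"
proof -
  have B: "0 \<le> B" using bound[of 0] norm_ge_zero order_trans by blast
  have *: "norm (F y - F x) \<le> B * (y - x)" if "x \<le> y" for x y
    using has_integral_bound[of B f "F y - F x" x y] int[OF that] bound B that by simp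
  show ?thesis
    using *[of x y] *[of y x] by (cases "x \<le> y") (auto simp: norm_minus_commute abs_if)
qed

text \<open>
  Each \<open>bern_per \<tau>\<close> has a zero modulo \<open>1\<close> within distance \<open>1/2\<close> of any point, which gains a
  factor \<open>1/2\<close> over the bound for its derivative.
\<close>

lemma abs_bern_per_le:
  assumes "\<tau> \<ge> 1"
  shows "\<bar>bern_per \<tau> x\<bar> \<le> 1 / 2 ^ \<tau>"
  using assms
proof (induction \<tau> arbitrary: x rule: dec_induct)
  case base
  have "0 \<le> frac x" "frac x < 1" by (auto simp: frac_lt_1)
  moreover have "bern_per 1 x = frac x - 1/2" by (simp only: bern_per_def bern_1)
  ultimately show ?case by (simp only: abs_le_iff power_one_right) auto
next
  case (step \<tau>)
  have "\<exists>\<xi>>0. \<xi> < 1 \<and> bern (Suc (Suc \<tau>)) 1 - bern (Suc (Suc \<tau>)) 0 = (1 - 0) * bern (Suc \<tau>) \<xi>"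
    by (rule MVT2) (auto intro: bern_Suc_DERIV)
  then obtain \<xi> where \<xi>: "0 < \<xi>" "\<xi> < 1" "bern (Suc \<tau>) \<xi> = 0"
    using bern_at_1[of "Suc (Suc \<tau>)"] by auto
  \<comment> \<open>the translate of the zero \<open>\<xi>\<close> by an integer that is nearest to \<open>x\<close>\<close>
  define z where "z = \<xi> + of_int (round (x - \<xi>))"
  have z: "bern_per (Suc \<tau>) z = 0"
    using \<xi> by (simp add: z_def bern_per_eq_bern)
  have "\<bar>x - z\<bar> \<le> 1/2"
    using of_int_round_abs_le[of "x - \<xi>"] by (simp add: z_def abs_minus_commute algebra_simps)
  moreover have "norm (bern_per (Suc \<tau>) x - bern_per (Suc \<tau>) z) \<le> 1 / 2 ^ \<tau> * \<bar>x - z\<bar>"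
    by (rule Lipschitz_if_has_integral[OF bern_per_has_integral]) (use step in auto)
  ultimately have "\<bar>bern_per (Suc \<tau>) x\<bar> \<le> 1 / 2 ^ \<tau> * (1/2)"
    unfolding z by (smt (verit) mult_left_mono real_norm_def zero_le_divide_1_iff zero_le_power)
  then show ?case by simp
qed

lemma bern_per_reflect:
  assumes "\<tau> \<ge> 2"
  shows "bern_per \<tau> (- x) = (-1) ^ \<tau> * bern_per \<tau> x"
proof (cases "x \<in> \<int>")
  case True
  then have "bern_per \<tau> (- x) = bern \<tau> 0" "bern_per \<tau> x = bern \<tau> 0"
    by (simp_all only: bern_per_def frac_eq_0_iff[THEN iffD2] Ints_minus)
  then show ?thesis
    using bern_reflect[of \<tau> 0] bern_at_1[OF assms] by (simp only: diff_0_right)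
next
  case False
  then show ?thesis
    using bern_reflect[of \<tau> "frac x"] by (simp add: bern_per_def frac_neg)
qed

lemma sum_shift_grid:
  fixes g :: "real \<Rightarrow> 'a :: ab_group_add"
  assumes per: "\<And>x. g (x + 1) = g x" and N: "N > 0"
  shows "(\<Sum>d<N. g (z + of_int j / real N + real d / real N)) = (\<Sum>d<N. g (z + real d / real N))"
proof -
  define S where "S z = (\<Sum>d<N. g (z + real d / real N))" for z
  have step: "S (z + 1 / real N) = S z" for z
  proof -
    have "(\<Sum>d<N. g (z + real (Suc d) / real N) - g (z + real d / real N)) =
        g (z + real N / real N) - g (z + real 0 / real N)"
      by (rule sum_lessThan_telescope)
    then have "(\<Sum>d<N. g (z + real (Suc d) / real N)) = S z"
      using per[of z] N by (simp add: S_def sum_subtractf)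
    moreover have "z + real (Suc d) / real N = z + 1 / real N + real d / real N" for d
      by (simp add: add_divide_distrib)
    ultimately show ?thesis by (simp only: S_def)
  qed
  have "S (z + of_int j / real N) = S z"
  proof (induction j rule: int_induct[where k = 0])
    case base then show ?case by simp
  next
    case (step1 i)
    then show ?case using step[of "z + of_int i / real N"] by (simp add: add_divide_distrib add.assoc)
  next
    case (step2 i)
    then show ?case using step[of "z + of_int (i - 1) / real N"]
      by (simp add: add_divide_distrib diff_divide_distrib)
  qed
  then show ?thesis by (simp add: S_def)
qed

lemma bern_per_multiplication:
  assumes N: "N > 0"
  shows "(\<Sum>d<N. bern_per \<tau> (z + real d / real N)) = real N / real N ^ \<tau> * bern_per \<tau> (real N * z)"
proof -
  define x where "x = frac (real N * z)"
  have x: "0 \<le> x" "x < 1" by (auto simp: x_def frac_lt_1)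
  have z: "z = x / real N + of_int \<lfloor>real N * z\<rfloor> / real N"
    using N by (simp add: x_def frac_def field_simps)
  have "(\<Sum>d<N. bern_per \<tau> (z + real d / real N)) = (\<Sum>d<N. bern_per \<tau> (x / real N + real d / real N))"
    by (subst z) (rule sum_shift_grid, use N in auto)
  also have "\<dots> = (\<Sum>d<N. bern \<tau> ((x + real d) / real N))"
  proof (rule sum.cong[OF refl])
    fix d assume "d \<in> {..<N}"
    then have "real (Suc d) \<le> real N" by (subst of_nat_le_iff) auto
    then have "real d + 1 \<le> real N" by simp
    then have "(x + real d) / real N \<in> {0..<1}"
      using x N by (auto simp: divide_simps)
    then show "bern_per \<tau> (x / real N + real d / real N) = bern \<tau> ((x + real d) / real N)"
      by (simp add: bern_per_eq_bern add_divide_distrib)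
  qed
  also have "\<dots> = real N / real N ^ \<tau> * bern \<tau> x"
    by (rule bern_multiplication[OF N])
  finally show ?thesis by (simp add: x_def bern_per_def)
qed

section \<open>Walsh coefficients on a grid\<close>

definition chr :: "nat \<Rightarrow> int \<Rightarrow> complex" where
  "chr b x = cis (2 * pi * real_of_int x / real b)"

lemma chr_0 [simp]: "chr b 0 = 1"
  by (simp add: chr_def)

lemma chr_add: "chr b (x + y) = chr b x * chr b y"
  by (simp add: chr_def cis_mult algebra_simps add_divide_distrib)

lemma norm_chr [simp]: "norm (chr b x) = 1"
  by (simp add: chr_def)

lemma cnj_chr: "cnj (chr b x) = chr b (- x)"
  by (simp add: chr_def cis_cnj)

lemma chr_power: "chr b x ^ d = chr b (int d * x)"
  by (simp add: chr_def Complex.DeMoivre algebra_simps)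

lemma chr_multiple: "b > 0 \<Longrightarrow> int b dvd x \<Longrightarrow> chr b x = 1"
proof -
  assume b: "b > 0" and "int b dvd x"
  then obtain k where "x = int b * k" by blast
  then have "2 * pi * real_of_int x / real b = 2 * pi * of_int k" using b by simp
  then show ?thesis unfolding chr_def by (simp only: cis_multiple_2pi Ints_of_int)
qed

lemma chr_mod: "b > 0 \<Longrightarrow> chr b (x mod int b) = chr b x"
proof -
  assume b: "b > 0"
  have "chr b x = chr b (int b * (x div int b) + x mod int b)" by simp
  also have "\<dots> = chr b (int b * (x div int b)) * chr b (x mod int b)" by (rule chr_add)
  also have "chr b (int b * (x div int b)) = 1" using b by (rule chr_multiple) simp
  finally show ?thesis by simp
qed

text \<open>
  By concavity the sine lies above its chord on the first quarter period. The consequence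
  \<open>2 b sin (\<pi> / b) \<ge> 4\<close> makes the decay bounds smaller by \<open>1 / 2\<close> with each degree beyond the number of
  digits.
\<close>

lemma sin_pi_div_ge: "b \<ge> 2 \<Longrightarrow> sin (pi / real b) \<ge> 2 / real b"
proof -
  assume b: "b \<ge> 2"
  have conc: "concave_on {0..pi/2} sin"
  proof (rule f''_le0_imp_concave)
    show "(sin has_real_derivative cos x) (at x)" for x by (rule DERIV_sin)
    show "(cos has_real_derivative - sin x) (at x)" for x by (rule DERIV_cos)
    show "- sin x \<le> 0" if "x \<in> {0..pi/2}" for x
      using that sin_ge_zero[of x] by (auto simp: field_simps)
  qed auto
  have "sin ((1 - 2 / real b) *\<^sub>R 0 + (2 / real b) *\<^sub>R (pi / 2)) \<ge> (1 - 2 / real b) * sin 0 + (2 / real b) * sin (pi / 2)"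
    by (rule concave_onD[OF conc]) (use b in auto)
  then show ?thesis by simp
qed

lemma sin_pi_div_mono:
  assumes "0 < c" "c < b"
  shows "sin (pi / real b) \<le> sin (pi * real c / real b)"
proof -
  have le: "sin (pi / real b) \<le> sin (pi * real d / real b)" if "0 < d" "2 * d \<le> b" for d
  proof (rule sin_monotone_2pi_le)
    have "0 \<le> pi / real b" "0 \<le> pi / 2" by simp_all
    then show "- (pi / 2) \<le> pi / real b" by linarith
    show "pi / real b \<le> pi * real d / real b"
    proof (rule divide_right_mono)
      have "pi * 1 \<le> pi * real d" using that by (intro mult_left_mono) auto
      then show "pi \<le> pi * real d" by simp
    qed auto
    have "2 * real d \<le> real b" using that(2) by (metis of_nat_le_iff of_nat_mult of_nat_numeral)
    then have "pi * (2 * real d) \<le> pi * real b" by (intro mult_left_mono) auto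
    then show "pi * real d / real b \<le> pi / 2"
      using that by (simp add: field_simps)
  qed
  show ?thesis
  proof (cases "2 * c \<le> b")
    case True then show ?thesis using le assms by blast
  next
    case False
    have "pi * real (b - c) / real b = pi - pi * real c / real b"
      using assms by (simp add: of_nat_diff field_simps)
    then have "sin (pi * real (b - c) / real b) = sin (pi * real c / real b)"
      by simp
    then show ?thesis using le[of "b - c"] assms False by simp
  qed
qed

lemma norm_1_minus_chr:
  assumes b: "b \<ge> 2" and c: "\<not> int b dvd c"
  shows "norm (1 - chr b c) \<ge> 2 * sin (pi / real b)"
proof -
  define d where "d = nat (c mod int b)"
  have d: "int d = c mod int b" using b by (simp add: d_def)
  have "0 < c mod int b" "c mod int b < int b"
    using b c pos_mod_bound[of "int b" c] pos_mod_sign[of "int b" c]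
    by (simp_all add: dvd_eq_mod_eq_0 less_le)
  then have d': "0 < d" "d < b" using d by auto
  have "norm (1 - chr b c) = norm (1 - chr b (int d))"
    using b by (simp add: d chr_mod)
  also have "\<dots> = norm (cis 0 - cis (2 * (pi * real d / real b)))"
    by (simp add: chr_def mult.assoc)
  also have "\<dots> = 2 * \<bar>sin (pi * real d / real b)\<bar>"
  proof -
    define t where "t = pi * real d / real b"
    have "norm (cis 0 - cis (2 * t)) ^ 2 = (2 * \<bar>sin t\<bar>) ^ 2"
    proof -
      have "norm (cis 0 - cis (2 * t)) ^ 2 = (1 - cos (2*t))^2 + (sin (2*t))^2"
        by (simp add: cmod_power2)
      also have "\<dots> = (2 * sin t ^ 2)^2 + (2 * sin t * cos t)^2"
        by (simp add: cos_double_sin sin_double)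
      also have "\<dots> = 4 * sin t ^ 2 * (sin t ^ 2 + cos t ^ 2)"
      proof -
        have "(2 * x ^ 2)^2 + (2 * x * y)^2 = 4 * x ^ 2 * (x ^ 2 + y ^ 2)" for x y :: real
          by (simp add: power2_eq_square algebra_simps)
        then show ?thesis .
      qed
      also have "\<dots> = (2 * \<bar>sin t\<bar>) ^ 2"
        by (simp add: power_mult_distrib)
      finally show ?thesis .
    qed
    then show ?thesis unfolding t_def[symmetric] by (rule power2_eq_imp_eq) auto
  qed
  finally show ?thesis using sin_pi_div_mono[OF d'] by linarith
qed

lemma chr_neq_1:
  assumes b: "b \<ge> 2" and c: "\<not> int b dvd c"
  shows "chr b c \<noteq> 1"
proof -
  have "0 < 2 / real b" using b by auto
  then have "0 < norm (1 - chr b c)"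
    using norm_1_minus_chr[OF assms] sin_pi_div_ge[OF b] by linarith
  then show ?thesis by auto
qed

lemma sum_chr:
  assumes b: "b \<ge> 2"
  shows "(\<Sum>d<b. chr b (int d * c)) = (if int b dvd c then of_nat b else 0)"
proof (cases "int b dvd c")
  case True
  then show ?thesis using b by (simp add: chr_multiple dvd_mult)
next
  case False
  have "(chr b c) ^ b = 1" using b by (simp add: chr_power chr_multiple)
  then have "(\<Sum>d<b. chr b c ^ d) = 0"
    using geometric_sum[OF chr_neq_1[OF b False], of b] by simp
  then show ?thesis using False by (simp add: chr_power)
qed

text \<open>
  With \<open>\<kappa> a\<close> the frequency at digit position \<open>a\<close>, \<open>wgt b \<kappa> L h\<close> is the complex conjugate of a
  Walsh function at the grid point \<open>h / b ^ L\<close>, whose digits \<open>L, L - 1, \<dots>\<close> after the point are the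
  lowest, second lowest, \<open>\<dots>\<close> digit of \<open>h\<close>. The discrete Walsh coefficient \<open>DW\<close> is taken on the grid
  translated by \<open>z\<close>, because summation by parts moves the grid.
\<close>

fun wgt :: "nat \<Rightarrow> (nat \<Rightarrow> nat) \<Rightarrow> nat \<Rightarrow> nat \<Rightarrow> complex" where
  "wgt b \<kappa> 0 h = 1"
| "wgt b \<kappa> (Suc L) h = wgt b \<kappa> L (h div b) * chr b (- int (\<kappa> (Suc L) * (h mod b)))"

definition DW :: "nat \<Rightarrow> (nat \<Rightarrow> nat) \<Rightarrow> nat \<Rightarrow> (real \<Rightarrow> complex) \<Rightarrow> real \<Rightarrow> complex" where
  "DW b \<kappa> L g z = (\<Sum>h<b ^ L. wgt b \<kappa> L h * g (z + real h / real b ^ L)) / of_nat (b ^ L)"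

lemma norm_wgt [simp]: "norm (wgt b \<kappa> L h) = 1"
  by (induction L arbitrary: h) (simp_all add: norm_mult)

lemma DW_0 [simp]: "DW b \<kappa> 0 g z = g z"
  by (simp add: DW_def)

lemma sum_digit_split:
  fixes f :: "nat \<Rightarrow> 'a :: comm_monoid_add"
  shows "(\<Sum>h<b ^ Suc L. f h) = (\<Sum>h<b ^ L. \<Sum>d<b. f (b * h + d))"
proof -
  have "(\<Sum>h<b ^ Suc L. f h) = (\<Sum>h<b ^ L. sum f {h * b..<h * b + b})"
    by (subst sum.nat_group) (simp add: mult.commute)
  also have "\<dots> = (\<Sum>h<b ^ L. \<Sum>d<b. f (b * h + d))"
  proof (rule sum.cong[OF refl])
    fix h
    have "sum f {h * b..<h * b + b} = sum f {0 + h * b..<b + h * b}"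
      by (simp only: add_0 add.commute)
    also have "\<dots> = (\<Sum>d=0..<b. f (d + h * b))"
      by (rule sum.shift_bounds_nat_ivl)
    finally show "sum f {h * b..<h * b + b} = (\<Sum>d<b. f (b * h + d))"
      by (simp only: lessThan_atLeast0 add.commute mult.commute)
  qed
  finally show ?thesis .
qed

lemma DW_Suc:
  assumes b: "b > 0"
  shows "DW b \<kappa> (Suc L) g z =
    (\<Sum>d<b. chr b (- int (\<kappa> (Suc L) * d)) * DW b \<kappa> L g (z + real d / real b ^ Suc L)) / of_nat b"
proof -
  have "(\<Sum>h<b ^ Suc L. wgt b \<kappa> (Suc L) h * g (z + real h / real b ^ Suc L)) =
      (\<Sum>h<b ^ L. \<Sum>d<b. wgt b \<kappa> (Suc L) (b * h + d) * g (z + real (b * h + d) / real b ^ Suc L))"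
    by (rule sum_digit_split)
  also have "\<dots> = (\<Sum>h<b ^ L. \<Sum>d<b. wgt b \<kappa> L h * chr b (- int (\<kappa> (Suc L) * d)) *
      g (z + real d / real b ^ Suc L + real h / real b ^ L))"
  proof (intro sum.cong refl)
    fix h d assume "d \<in> {..<b}"
    then have 1: "(b * h + d) div b = h" "(b * h + d) mod b = d" using b by auto
    have 2: "real (b * h + d) / real b ^ Suc L = real d / real b ^ Suc L + real h / real b ^ L"
      using b by (simp add: field_simps)
    show "wgt b \<kappa> (Suc L) (b * h + d) * g (z + real (b * h + d) / real b ^ Suc L) =
      wgt b \<kappa> L h * chr b (- int (\<kappa> (Suc L) * d)) * g (z + real d / real b ^ Suc L + real h / real b ^ L)"
      unfolding 2 wgt.simps 1 by (simp only: add.assoc)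
  qed
  also have "\<dots> = (\<Sum>d<b. \<Sum>h<b ^ L. wgt b \<kappa> L h * chr b (- int (\<kappa> (Suc L) * d)) *
      g (z + real d / real b ^ Suc L + real h / real b ^ L))"
    by (rule sum.swap)
  also have "\<dots> = of_nat (b ^ L) * (\<Sum>d<b. chr b (- int (\<kappa> (Suc L) * d)) * DW b \<kappa> L g (z + real d / real b ^ Suc L))"
    unfolding sum_distrib_left
  proof (rule sum.cong[OF refl])
    fix d
    define c where "c = chr b (- int (\<kappa> (Suc L) * d))"
    define G where "G h = g (z + real d / real b ^ Suc L + real h / real b ^ L)" for h
    have "of_nat (b ^ L) * (c * ((\<Sum>h<b ^ L. wgt b \<kappa> L h * G h) / of_nat (b ^ L))) =
        (\<Sum>h<b ^ L. wgt b \<kappa> L h * G h) * c"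
      using b by simp
    then show "(\<Sum>h<b ^ L. wgt b \<kappa> L h * chr b (- int (\<kappa> (Suc L) * d)) *
        g (z + real d / real b ^ Suc L + real h / real b ^ L)) =
      of_nat (b ^ L) * (chr b (- int (\<kappa> (Suc L) * d)) * DW b \<kappa> L g (z + real d / real b ^ Suc L))"
      unfolding DW_def c_def[symmetric] G_def[symmetric] sum_distrib_right
      by (simp add: mult.assoc mult.commute[of c])
  qed
  finally have "DW b \<kappa> (Suc L) g z = of_nat (b ^ L) * (\<Sum>d<b. chr b (- int (\<kappa> (Suc L) * d)) *
      DW b \<kappa> L g (z + real d / real b ^ Suc L)) / of_nat (b ^ Suc L)"
    unfolding DW_def[of b \<kappa> "Suc L"] by (rule arg_cong)
  then show ?thesis using b by simp
qed

lemma DW_shift: "DW b \<kappa> L (\<lambda>y. g (y + w)) z = DW b \<kappa> L g (z + w)"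
  by (simp add: DW_def add_ac)

lemma DW_cmult: "DW b \<kappa> L (\<lambda>y. c * g y) z = c * DW b \<kappa> L g z"
  by (simp add: DW_def sum_distrib_left mult_ac)

lemma DW_cong_grid:
  assumes "b > 0" and "\<And>y. 0 \<le> y \<Longrightarrow> y < 1 \<Longrightarrow> g y = g' y"
  shows "DW b \<kappa> L g 0 = DW b \<kappa> L g' 0"
proof -
  have "real h / real b ^ L < 1" if "h < b ^ L" for h
  proof -
    have "real h < real (b ^ L)" using that by (subst of_nat_less_iff)
    then show ?thesis using assms(1) by (simp add: field_simps)
  qed
  then show ?thesis unfolding DW_def using assms by (auto intro!: sum.cong)
qed

lemma norm_DW_Suc_le:
  assumes b: "b > 0" and "\<And>z. norm (DW b \<kappa> L g z) \<le> B"
  shows "norm (DW b \<kappa> (Suc L) g z) \<le> B"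
proof -
  have "norm (\<Sum>d<b. chr b (- int (\<kappa> (Suc L) * d)) * DW b \<kappa> L g (z + real d / real b ^ Suc L)) \<le>
      (\<Sum>d<b. B)"
    by (rule sum_norm_le) (use assms in \<open>simp add: norm_mult\<close>)
  then show ?thesis using b by (simp add: DW_Suc norm_divide divide_le_eq mult.commute)
qed

lemma DW_trivial_frequencies:
  assumes b: "b > 0" and "\<forall>a\<in>{1..L}. b dvd \<kappa> a"
  shows "wgt b \<kappa> L h = 1"
  using assms(2)
proof (induction L arbitrary: h)
  case (Suc L)
  have "int b dvd - int (\<kappa> (Suc L) * (h mod b))"
    using Suc.prems by (auto intro!: dvd_mult2)
  then show ?case using Suc b by (simp only: wgt.simps chr_multiple) auto
qed simp

lemma sum_wgt:
  assumes b: "b \<ge> 2"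
  shows "(\<Sum>h<b ^ L. wgt b \<kappa> L h) = (if \<forall>a\<in>{1..L}. b dvd \<kappa> a then of_nat (b ^ L) else 0)"
proof (cases "\<forall>a\<in>{1..L}. b dvd \<kappa> a")
  case True
  then show ?thesis using b by (simp add: DW_trivial_frequencies)
next
  case False
  then have "(\<Sum>h<b ^ L. wgt b \<kappa> L h) = 0"
  proof (induction L)
    case (Suc L)
    have "(\<Sum>h<b ^ Suc L. wgt b \<kappa> (Suc L) h) =
        (\<Sum>h<b ^ L. \<Sum>d<b. wgt b \<kappa> L h * chr b (int d * - int (\<kappa> (Suc L))))"
      unfolding sum_digit_split by (intro sum.cong refl) (simp add: mult.commute)
    also have "\<dots> = (\<Sum>h<b ^ L. wgt b \<kappa> L h) * (\<Sum>d<b. chr b (int d * - int (\<kappa> (Suc L))))"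
      by (simp only: sum_product)
    also have "\<dots> = 0"
    proof (cases "b dvd \<kappa> (Suc L)")
      case True
      have "\<not> (\<forall>a\<in>{1..L}. b dvd \<kappa> a)"
      proof
        assume "\<forall>a\<in>{1..L}. b dvd \<kappa> a"
        then have "\<forall>a\<in>{1..Suc L}. b dvd \<kappa> a" using True by (auto simp: atLeastAtMostSuc_conv)
        with Suc.prems show False by blast
      qed
      then show ?thesis using Suc.IH by simp
    next
      case False
      then show ?thesis unfolding sum_chr[OF b] by simp
    qed
    finally show ?case .
  qed simp
  with False show ?thesis by auto
qed

text \<open>
  Summation by parts in the lowest digit. If \<open>S\<close> shifts by \<open>h\<close> and \<open>w\<close> is a nontrivial root of
  unity, then \<open>(1 - w S) \<Sum>\<^sub>d (w S)\<^sup>d = 1 - S\<^sup>b\<close>, and \<open>1 - w S = (1 - w) + w (1 - S)\<close>. So the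
  weighted average is expressed by increments over \<open>b h\<close> and over \<open>h\<close>.
\<close>

lemma norm_root_average_le:
  fixes F :: "real \<Rightarrow> complex" and w :: complex
  assumes b: "b > 0" and w: "w ^ b = 1" "norm w = 1" "w \<noteq> 1"
    and T: "\<And>z. T z = (\<Sum>d<b. w ^ d * F (z + real d * h)) / of_nat b"
  shows "norm (T z) \<le> (norm (F (z + real b * h) - F z) / real b + norm (T (z + h) - T z)) / norm (1 - w)"
proof -
  have "(\<Sum>d<b. w ^ d * F (z + real d * h) - w ^ Suc d * F (z + real (Suc d) * h)) =
      w ^ 0 * F (z + real 0 * h) - w ^ b * F (z + real b * h)"
    by (rule sum_lessThan_telescope')
  then have "(\<Sum>d<b. w ^ d * F (z + real d * h)) - (\<Sum>d<b. w ^ Suc d * F (z + real (Suc d) * h)) =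
      F z - F (z + real b * h)"
    using w by (simp add: sum_subtractf)
  moreover have "(\<Sum>d<b. w ^ d * F (z + real d * h)) = of_nat b * T z"
    using b by (simp add: T)
  moreover have "(\<Sum>d<b. w ^ Suc d * F (z + real (Suc d) * h)) = of_nat b * (w * T (z + h))"
  proof -
    have "of_nat b * T (z + h) = (\<Sum>d<b. w ^ d * F (z + h + real d * h))"
      using b by (simp add: T)
    moreover have "z + real (Suc d) * h = z + h + real d * h" for d
      by (simp add: algebra_simps)
    ultimately show ?thesis
      by (simp only: mult.left_commute[of "of_nat b"]) (simp add: sum_distrib_left mult.assoc)
  qed
  ultimately have "of_nat b * T z - of_nat b * (w * T (z + h)) = F z - F (z + real b * h)"
    by simp
  then have "of_nat b * (T z - w * T (z + h)) = F z - F (z + real b * h)"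
    by (simp add: algebra_simps)
  then have "T z - w * T (z + h) = (F z - F (z + real b * h)) / of_nat b"
    using b by (simp add: field_simps)
  then have "(1 - w) * T z = (F z - F (z + real b * h)) / of_nat b + w * (T (z + h) - T z)"
    by (simp add: diff_eq_eq left_diff_distrib right_diff_distrib)
  then have "norm (1 - w) * norm (T z) = norm ((F z - F (z + real b * h)) / of_nat b + w * (T (z + h) - T z))"
    by (metis norm_mult)
  also have "\<dots> \<le> norm ((F z - F (z + real b * h)) / of_nat b) + norm (w * (T (z + h) - T z))"
    by (rule norm_triangle_ineq)
  also have "\<dots> = norm (F (z + real b * h) - F z) / real b + norm (T (z + h) - T z)"
    using w by (simp add: norm_mult norm_divide norm_minus_commute)
  finally show ?thesis using w(3) by (simp add: field_simps)
qed

text \<open>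
  Summation by parts at the lowest digit: the increments on the right are over \<open>b ^ - L\<close> without
  the digit \<open>L + 1\<close> and over \<open>b ^ - (L + 1)\<close> with it.
\<close>

lemma norm_DW_active_le:
  assumes b: "b \<ge> 2" and act: "\<not> b dvd \<kappa> (Suc L)"
  shows "norm (DW b \<kappa> (Suc L) g z) \<le>
    (norm (DW b \<kappa> L g (z + 1 / real b ^ L) - DW b \<kappa> L g z) / real b +
     norm (DW b \<kappa> (Suc L) g (z + 1 / real b ^ Suc L) - DW b \<kappa> (Suc L) g z)) / (2 * sin (pi / real b))"
proof -
  define w where "w = chr b (- int (\<kappa> (Suc L)))"
  have nd: "\<not> int b dvd - int (\<kappa> (Suc L))" using act by simp
  have w: "w ^ b = 1" "norm w = 1" "w \<noteq> 1"
    unfolding w_def using b chr_neq_1[OF b nd] by (auto simp: chr_power chr_multiple)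
  have "norm (DW b \<kappa> (Suc L) g z) \<le>
    (norm (DW b \<kappa> L g (z + real b * (1 / real b ^ Suc L)) - DW b \<kappa> L g z) / real b +
     norm (DW b \<kappa> (Suc L) g (z + 1 / real b ^ Suc L) - DW b \<kappa> (Suc L) g z)) / norm (1 - w)"
  proof (rule norm_root_average_le[OF _ w])
    show "DW b \<kappa> (Suc L) g z = (\<Sum>d<b. w ^ d * DW b \<kappa> L g (z + real d * (1 / real b ^ Suc L))) / of_nat b" for z
      using b by (simp add: DW_Suc w_def chr_power mult.commute)
  qed (use b in auto)
  also have "\<dots> \<le> (norm (DW b \<kappa> L g (z + real b * (1 / real b ^ Suc L)) - DW b \<kappa> L g z) / real b +
     norm (DW b \<kappa> (Suc L) g (z + 1 / real b ^ Suc L) - DW b \<kappa> (Suc L) g z)) / (2 * sin (pi / real b))"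
  proof (rule divide_left_mono)
    show "2 * sin (pi / real b) \<le> norm (1 - w)" unfolding w_def by (rule norm_1_minus_chr[OF b nd])
    have "0 < 2 / real b" using b by auto
    then have "0 < 2 * sin (pi / real b)" using sin_pi_div_ge[OF b] by linarith
    then show "0 < norm (1 - w) * (2 * sin (pi / real b))" using w(3) by simp
  qed (intro add_nonneg_nonneg divide_nonneg_nonneg norm_ge_zero of_nat_0_le_iff)
  finally show ?thesis using b by simp
qed

abbreviation bern_perc :: "nat \<Rightarrow> real \<Rightarrow> complex" where
  "bern_perc \<tau> \<equiv> (\<lambda>y. complex_of_real (bern_per \<tau> y))"

text \<open>
  Differentiation commutes with the weighted average over the grid, so a bound for the coefficient
  of degree \<open>\<tau>\<close> at all translates is a Lipschitz constant for the coefficient of degree \<open>\<tau> + 1\<close>.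
\<close>

lemma DW_bern_per_increment:
  assumes "\<tau> \<ge> 1" and bound: "\<And>t. norm (DW b \<kappa> L (bern_perc \<tau>) t) \<le> B"
  shows "norm (DW b \<kappa> L (bern_perc (Suc \<tau>)) y - DW b \<kappa> L (bern_perc (Suc \<tau>)) x) \<le> B * \<bar>y - x\<bar>"
proof (rule Lipschitz_if_has_integral[OF _ bound])
  fix x y :: real assume xy: "x \<le> y"
  have "((\<lambda>t. wgt b \<kappa> L h * bern_perc \<tau> (t + real h / real b ^ L)) has_integral
      wgt b \<kappa> L h * (bern_perc (Suc \<tau>) (y + real h / real b ^ L) -
        bern_perc (Suc \<tau>) (x + real h / real b ^ L))) {x..y}" for h
  proof (rule has_integral_mult_right)
    have "(bern_per \<tau> has_integral bern_per (Suc \<tau>) (real h / real b ^ L + y) - bern_per (Suc \<tau>) (real h / real b ^ L + x))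
        {x + real h / real b ^ L..y + real h / real b ^ L}"
      unfolding add.commute[of x] add.commute[of y]
      using xy by (intro bern_per_has_integral assms) auto
    then have "((\<lambda>t. bern_per \<tau> (t + real h / real b ^ L)) has_integral
        bern_per (Suc \<tau>) (real h / real b ^ L + y) - bern_per (Suc \<tau>) (real h / real b ^ L + x)) {x..y}"
      by (subst (asm) has_integral_shift_Icc_real[symmetric]) (simp add: o_def add_ac)
    from has_integral_linear[OF this bounded_linear_of_real]
    show "((\<lambda>t. bern_perc \<tau> (t + real h / real b ^ L)) has_integral
        bern_perc (Suc \<tau>) (y + real h / real b ^ L) - bern_perc (Suc \<tau>) (x + real h / real b ^ L)) {x..y}"
      by (simp add: add_ac o_def)
  qed
  then have "((\<lambda>t. \<Sum>h<b ^ L. wgt b \<kappa> L h * bern_perc \<tau> (t + real h / real b ^ L)) has_integral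
      (\<Sum>h<b ^ L. wgt b \<kappa> L h * (bern_perc (Suc \<tau>) (y + real h / real b ^ L) -
        bern_perc (Suc \<tau>) (x + real h / real b ^ L)))) {x..y}"
    by (intro has_integral_sum) auto
  from has_integral_divide[OF this, of "of_nat (b ^ L)"]
  show "(DW b \<kappa> L (bern_perc \<tau>) has_integral
      DW b \<kappa> L (bern_perc (Suc \<tau>)) y - DW b \<kappa> L (bern_perc (Suc \<tau>)) x) {x..y}"
    by (simp add: DW_def[abs_def] right_diff_distrib sum_subtractf diff_divide_distrib)
qed

text \<open>
  The first Bernoulli function increases with slope one, and jumps by \<open>-1\<close> once per period. In the
  weighted sum of its increments the linear part disappears unless all frequencies are trivial,
  while the jump meets exactly one weight. For trivial frequencies the sum telescopes.
\<close>

lemma DW_bern_per_1_increment: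
  assumes b: "b \<ge> 2"
  shows "norm (DW b \<kappa> L (bern_perc 1) (z + 1 / real b ^ L) - DW b \<kappa> L (bern_perc 1) z) \<le> 1 / real b ^ L"
proof -
  define N where "N = b ^ L"
  have N: "N > 0" using b by (simp add: N_def)
  define x where "x h = z + real h / real N" for h
  have xS: "z + 1 / real N + real h / real N = x (Suc h)" for h
    by (simp add: x_def add_divide_distrib)
  have eq: "DW b \<kappa> L (bern_perc 1) (z + 1 / real b ^ L) - DW b \<kappa> L (bern_perc 1) z =
      (\<Sum>h<N. wgt b \<kappa> L h * (bern_perc 1 (x (Suc h)) - bern_perc 1 (x h))) / of_nat N"
    unfolding DW_def of_nat_power[symmetric] N_def[symmetric] xS
    by (simp add: x_def right_diff_distrib sum_subtractf diff_divide_distrib)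
  have "norm (\<Sum>h<N. wgt b \<kappa> L h * (bern_perc 1 (x (Suc h)) - bern_perc 1 (x h))) \<le> 1"
  proof (cases "\<forall>a\<in>{1..L}. b dvd \<kappa> a")
    case True
    have "(\<Sum>h<N. wgt b \<kappa> L h * (bern_perc 1 (x (Suc h)) - bern_perc 1 (x h))) =
        (\<Sum>h<N. bern_perc 1 (x (Suc h)) - bern_perc 1 (x h))"
      using True b by (simp add: DW_trivial_frequencies)
    also have "\<dots> = bern_perc 1 (x N) - bern_perc 1 (x 0)"
      by (rule sum_lessThan_telescope)
    also have "\<dots> = 0"
      using N by (simp add: x_def del: One_nat_def)
    finally show ?thesis by simp
  next
    case False
    define J where "J h = real_of_int \<lfloor>x (Suc h)\<rfloor> - real_of_int \<lfloor>x h\<rfloor>" for h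
    have "x h \<le> x (Suc h)" for h
      unfolding x_def by (intro add_left_mono divide_right_mono) auto
    then have J: "J h \<ge> 0" for h
      by (simp add: J_def floor_mono)
    have "bern_perc 1 (x (Suc h)) - bern_perc 1 (x h) = complex_of_real (1 / real N) - complex_of_real (J h)" for h
    proof -
      have "bern_per 1 (x (Suc h)) - bern_per 1 (x h) = x (Suc h) - x h - J h"
        by (simp only: bern_per_def bern_1 J_def frac_def)
      also have "x (Suc h) - x h = 1 / real N"
        by (simp add: x_def add_divide_distrib)
      finally show ?thesis by (metis of_real_diff)
    qed
    then have "(\<Sum>h<N. wgt b \<kappa> L h * (bern_perc 1 (x (Suc h)) - bern_perc 1 (x h))) =
        (\<Sum>h<N. wgt b \<kappa> L h) * complex_of_real (1 / real N) - (\<Sum>h<N. wgt b \<kappa> L h * complex_of_real (J h))"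
      by (simp only: right_diff_distrib sum_subtractf sum_distrib_right)
    also have "(\<Sum>h<N. wgt b \<kappa> L h) = 0"
      using sum_wgt[OF b, of \<kappa> L] False by (simp only: N_def if_False)
    finally have "norm (\<Sum>h<N. wgt b \<kappa> L h * (bern_perc 1 (x (Suc h)) - bern_perc 1 (x h))) =
        norm (\<Sum>h<N. wgt b \<kappa> L h * complex_of_real (J h))"
      by simp
    also have "\<dots> \<le> (\<Sum>h<N. J h)"
      by (rule sum_norm_le) (use J in \<open>simp add: norm_mult\<close>)
    also have "\<dots> = real_of_int \<lfloor>x N\<rfloor> - real_of_int \<lfloor>x 0\<rfloor>"
      unfolding J_def by (rule sum_lessThan_telescope)
    also have "\<dots> = 1"
      using N by (simp add: x_def)
    finally show ?thesis .
  qed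
  then have "norm ((\<Sum>h<N. wgt b \<kappa> L h * (bern_perc 1 (x (Suc h)) - bern_perc 1 (x h))) / of_nat N) \<le> 1 / real N"
    unfolding norm_divide norm_of_nat by (rule divide_right_mono) simp
  then show ?thesis
    unfolding eq by (simp only: N_def of_nat_power)
qed

text \<open>
  \<open>nact\<close> counts the digit positions up to \<open>L\<close> with a nontrivial frequency, and \<open>topsum\<close> adds up the
  \<open>r\<close> largest of them. The latter is \<open>mu\<close> in a form that fits to an induction over \<open>L\<close>.
\<close>

fun nact :: "nat \<Rightarrow> (nat \<Rightarrow> nat) \<Rightarrow> nat \<Rightarrow> nat" where
  "nact b \<kappa> 0 = 0"
| "nact b \<kappa> (Suc L) = (if b dvd \<kappa> (Suc L) then nact b \<kappa> L else Suc (nact b \<kappa> L))"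

fun topsum :: "nat \<Rightarrow> (nat \<Rightarrow> nat) \<Rightarrow> nat \<Rightarrow> nat \<Rightarrow> nat" where
  "topsum b \<kappa> 0 r = 0"
| "topsum b \<kappa> (Suc L) r =
     (if b dvd \<kappa> (Suc L) then topsum b \<kappa> L r else if r = 0 then 0 else Suc L + topsum b \<kappa> L (r - 1))"

lemma topsum_0 [simp]: "topsum b \<kappa> L 0 = 0"
  by (induction L) auto

lemma nact_le: "nact b \<kappa> L \<le> L"
  by (induction L) auto

lemma nact_eq_0_iff: "nact b \<kappa> L = 0 \<longleftrightarrow> (\<forall>a\<in>{1..L}. b dvd \<kappa> a)"
  by (induction L) (auto simp: atLeastAtMostSuc_conv)

lemma topsum_le: "topsum b \<kappa> L r \<le> L + topsum b \<kappa> L (r - 1)"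
proof (induction L arbitrary: r)
  case (Suc L)
  show ?case using Suc.IH[of r] Suc.IH[of "r - 1"] by auto
qed simp

lemma topsum_eq_nact: "r \<ge> nact b \<kappa> L \<Longrightarrow> topsum b \<kappa> L r = topsum b \<kappa> L (nact b \<kappa> L)"
proof (induction L arbitrary: r)
  case (Suc L)
  show ?case
    using Suc.IH[of r] Suc.IH[of "r - 1"] Suc.prems by (auto split: if_splits)
qed simp

section \<open>Decay of the Walsh coefficients of Bernoulli functions\<close>

text \<open>
  The factor in the decay bound that depends on the degree \<open>\<tau>\<close> and on the number \<open>t\<close> of digits
  that are paid for by derivatives.
\<close>

definition decay :: "nat \<Rightarrow> nat \<Rightarrow> nat \<Rightarrow> real" where
  "decay b \<tau> t = (if t = 0 then (1/2) ^ \<tau> else 2 * (1 + 1 / real b) ^ (t - 1) * (1/2) ^ (\<tau> - t))"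

lemma decay_nonneg: "0 \<le> decay b \<tau> t"
  by (simp add: decay_def)

text \<open>
  The two inequalities below are the induction steps of the decay bound, for the cases that the
  other digits suffice for all derivatives, or not. In the first case the second summand is smaller by
  a ratio of scales of at least \<open>b\<close>.
\<close>

lemma decay_step_saturated:
  assumes "b \<ge> 2" and "\<tau> \<ge> 1" and "B' \<ge> Suc A"
  shows "decay b \<tau> \<tau> / real b ^ A + decay b \<tau> \<tau> / real b ^ B' \<le> decay b (Suc \<tau>) (Suc \<tau>) / real b ^ A"
proof -
  have "real b ^ Suc A \<le> real b ^ B'"
    using assms by (intro power_increasing) auto
  then have "decay b \<tau> \<tau> / real b ^ B' \<le> decay b \<tau> \<tau> / real b ^ Suc A"
    using assms by (intro divide_left_mono decay_nonneg) auto
  moreover have "decay b (Suc \<tau>) (Suc \<tau>) = decay b \<tau> \<tau> * (1 + 1 / real b)"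
    using assms(2) by (cases \<tau>) (auto simp: decay_def)
  moreover have "decay b \<tau> \<tau> / real b ^ Suc A = decay b \<tau> \<tau> * (1 / real b) / real b ^ A"
    by simp
  ultimately show ?thesis by (simp add: distrib_left add_divide_distrib)
qed

lemma decay_step_unsaturated:
  assumes b: "b \<ge> 2" and t: "t < \<tau>" and X: "X \<ge> 4 * real b ^ t"
  shows "decay b \<tau> t + decay b \<tau> (Suc t) / X \<le> decay b (Suc \<tau>) (Suc t)"
proof -
  define \<rho> where "\<rho> = 1 + 1 / real b"
  define E where "E = (1/2::real) ^ (\<tau> - t)"
  have E: "E > 0" by (simp add: E_def)
  have E2: "(1/2::real) ^ (\<tau> - Suc t) = 2 * E"
    using t by (simp add: E_def Suc_diff_Suc[symmetric])
  have \<rho>: "1 \<le> \<rho>" "\<rho> \<le> 2" using b by (auto simp: \<rho>_def)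
  have X0: "0 < 4 * real b ^ t" using b by simp
  have "decay b \<tau> (Suc t) / X \<le> decay b \<tau> (Suc t) / (4 * real b ^ t)"
    using X X0 by (intro divide_left_mono decay_nonneg mult_pos_pos) linarith+
  also have "decay b \<tau> (Suc t) / (4 * real b ^ t) = \<rho> ^ t * E / real b ^ t"
    by (simp add: decay_def E2 \<rho>_def)
  finally have 1: "decay b \<tau> (Suc t) / X \<le> \<rho> ^ t * E / real b ^ t" .
  have 2: "decay b (Suc \<tau>) (Suc t) = 2 * \<rho> ^ t * E"
    by (simp add: decay_def \<rho>_def E_def)
  show ?thesis
  proof (cases t)
    case 0
    then have "decay b \<tau> t = E" by (simp add: decay_def E_def)
    then show ?thesis using 1 2 0 by simp
  next
    case (Suc u)
    have 3: "decay b \<tau> t = 2 * \<rho> ^ u * E"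
      by (simp add: decay_def \<rho>_def E_def Suc)
    have "real b ^ 1 \<le> real b ^ t" using b Suc by (intro power_increasing) auto
    then have "\<rho> ^ t * E / real b ^ t \<le> \<rho> ^ t * E / real b"
      using b E \<rho> by (intro divide_left_mono) auto
    also have "\<dots> \<le> 2 * \<rho> ^ u * E / real b"
      using b E \<rho> by (intro divide_right_mono) (auto simp: Suc)
    finally have "decay b \<tau> t + decay b \<tau> (Suc t) / X \<le> 2 * \<rho> ^ u * E + 2 * \<rho> ^ u * E / real b"
      using 1 3 by linarith
    also have "\<dots> = 2 * (\<rho> ^ u * \<rho>) * E"
      by (simp add: \<rho>_def algebra_simps)
    finally show ?thesis using 2 Suc by (simp add: mult.commute)
  qed
qed

text \<open>
  Every nontrivial frequency at a digit position \<open>a\<close> can be traded for one derivative, with a gain of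
  \<open>b ^ - a\<close>. For a Bernoulli function the derivative is again a Bernoulli function, so the
  induction runs over the digit positions from the coarsest to the finest and over the degree.
  Summation by parts at the finest position \<open>L\<close> leaves two terms of lower degree: one without that
  position, and one that still has it and thus is smaller by the ratio of scales. This is where the
  factor \<open>1 + 1 / b\<close> per digit comes from.
\<close>

lemma norm_DW_bern_per_le:
  assumes b: "b \<ge> 2" and "\<tau> \<ge> 1"
  shows "norm (DW b \<kappa> L (bern_perc \<tau>) z) \<le>
    decay b \<tau> (min (nact b \<kappa> L) \<tau>) / (2 * sin (pi / real b)) ^ min (nact b \<kappa> L) \<tau>
      / real b ^ topsum b \<kappa> L \<tau>"
  using assms(2)
proof (induction L arbitrary: \<tau> z)
  case 0
  then show ?case using abs_bern_per_le[of \<tau> z] by (simp add: decay_def power_one_over)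
next
  case (Suc L)
  define m where "m = 2 * sin (pi / real b)"
  have "m \<ge> 2 * (2 / real b)" using sin_pi_div_ge[OF b] by (simp add: m_def)
  then have mb: "m * real b \<ge> 4" using b by (simp add: field_simps)
  have m: "m > 0" using mb by (metis less_le_trans mult_nonpos_nonneg not_less of_nat_0_le_iff order.strict_trans2 zero_less_numeral)
  define bd where "bd L \<tau> = decay b \<tau> (min (nact b \<kappa> L) \<tau>) / m ^ min (nact b \<kappa> L) \<tau> / real b ^ topsum b \<kappa> L \<tau>" for L \<tau>
  have IH: "norm (DW b \<kappa> L (bern_perc \<tau>) z) \<le> bd L \<tau>" if "\<tau> \<ge> 1" for \<tau> z
    unfolding bd_def m_def using that by (rule Suc.IH)
  have goal: "norm (DW b \<kappa> (Suc L) (bern_perc \<tau>) z) \<le> bd (Suc L) \<tau>" if "\<tau> \<ge> 1" for \<tau> z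
  proof (cases "b dvd \<kappa> (Suc L)")
    case True
    then have "bd (Suc L) \<tau> = bd L \<tau>" by (simp add: bd_def)
    then show ?thesis using norm_DW_Suc_le[of b \<kappa> L "bern_perc \<tau>" "bd L \<tau>" z] b IH[OF that] by simp
  next
    case False
    define h where "h = 1 / real b ^ Suc L"
    have h: "h > 0" using b by (simp add: h_def)
    have bh: "1 / real b ^ L = real b * h" using b by (simp add: h_def)
    show ?thesis using that
    proof (induction \<tau> arbitrary: z rule: dec_induct)
      case base
      have "norm (DW b \<kappa> (Suc L) (bern_perc 1) z) \<le> (real b * h / real b + h) / m"
      proof (rule order_trans[OF norm_DW_active_le[where b = b and \<kappa> = \<kappa> and L = L, OF b False, of "bern_perc 1" z]])
        show "(norm (DW b \<kappa> L (bern_perc 1) (z + 1 / real b ^ L) - DW b \<kappa> L (bern_perc 1) z) / real b +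
            norm (DW b \<kappa> (Suc L) (bern_perc 1) (z + 1 / real b ^ Suc L) - DW b \<kappa> (Suc L) (bern_perc 1) z)) /
            (2 * sin (pi / real b)) \<le> (real b * h / real b + h) / m"
          unfolding m_def[symmetric]
        proof (intro divide_right_mono add_mono)
          show "norm (DW b \<kappa> L (bern_perc 1) (z + 1 / real b ^ L) - DW b \<kappa> L (bern_perc 1) z) \<le> real b * h"
            using DW_bern_per_1_increment[OF b, of \<kappa> L z] by (simp only: bh)
          show "norm (DW b \<kappa> (Suc L) (bern_perc 1) (z + 1 / real b ^ Suc L) - DW b \<kappa> (Suc L) (bern_perc 1) z) \<le> h"
            using DW_bern_per_1_increment[OF b, of \<kappa> "Suc L" z] by (simp only: h_def)
        qed (use m in auto)
      qed
      also have "\<dots> = 2 * h / m" using b by simp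
      also have "\<dots> = bd (Suc L) 1"
        using False by (simp add: bd_def decay_def h_def)
      finally show ?case .
    next
      case (step \<tau>)
      define t where "t = min (nact b \<kappa> L) \<tau>"
      define A where "A = topsum b \<kappa> L \<tau>"
      have "norm (DW b \<kappa> (Suc L) (bern_perc (Suc \<tau>)) z) \<le> (bd L \<tau> * (real b * h) / real b + bd (Suc L) \<tau> * h) / m"
      proof (rule order_trans[OF norm_DW_active_le[where b = b and \<kappa> = \<kappa> and L = L, OF b False, of "bern_perc (Suc \<tau>)" z]])
        have 1: "norm (DW b \<kappa> L (bern_perc (Suc \<tau>)) (z + 1 / real b ^ L) - DW b \<kappa> L (bern_perc (Suc \<tau>)) z)
            \<le> bd L \<tau> * (real b * h)"
          using DW_bern_per_increment[of \<tau> b \<kappa> L "bd L \<tau>" "z + 1 / real b ^ L" z] IH step.hyps h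
          by (simp add: bh)
        have 2: "norm (DW b \<kappa> (Suc L) (bern_perc (Suc \<tau>)) (z + 1 / real b ^ Suc L) - DW b \<kappa> (Suc L) (bern_perc (Suc \<tau>)) z)
            \<le> bd (Suc L) \<tau> * h"
          using DW_bern_per_increment[of \<tau> b \<kappa> "Suc L" "bd (Suc L) \<tau>" "z + h" z] step.IH step.hyps h
          by (simp add: h_def)
        show "(norm (DW b \<kappa> L (bern_perc (Suc \<tau>)) (z + 1 / real b ^ L) - DW b \<kappa> L (bern_perc (Suc \<tau>)) z) / real b +
            norm (DW b \<kappa> (Suc L) (bern_perc (Suc \<tau>)) (z + 1 / real b ^ Suc L) - DW b \<kappa> (Suc L) (bern_perc (Suc \<tau>)) z)) /
            (2 * sin (pi / real b)) \<le> (bd L \<tau> * (real b * h) / real b + bd (Suc L) \<tau> * h) / m"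
          unfolding m_def[symmetric]
          by (intro divide_right_mono add_mono) (use 1 2 m in auto)
      qed
      also have "\<dots> = h / m * (bd L \<tau> + bd (Suc L) \<tau>)"
        using b by (simp add: distrib_left add_divide_distrib mult.commute)
      also have "\<dots> \<le> h / m * (decay b (Suc \<tau>) (Suc t) / m ^ t / real b ^ A)"
      proof (rule mult_left_mono)
        have 3: "bd L \<tau> = decay b \<tau> t / m ^ t / real b ^ A"
          by (simp add: bd_def t_def A_def)
        show "bd L \<tau> + bd (Suc L) \<tau> \<le> decay b (Suc \<tau>) (Suc t) / m ^ t / real b ^ A"
        proof (cases "nact b \<kappa> L \<ge> \<tau>")
          case True
          then have t: "t = \<tau>" by (simp add: t_def)
          have 4: "bd (Suc L) \<tau> = decay b \<tau> \<tau> / m ^ \<tau> / real b ^ topsum b \<kappa> (Suc L) \<tau>"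
            using True False by (simp add: bd_def)
          have "topsum b \<kappa> (Suc L) \<tau> \<ge> Suc A"
            using topsum_le[of b \<kappa> L \<tau>] False step.hyps by (simp add: A_def)
          from decay_step_saturated[OF b step.hyps(1) this]
          have "(decay b \<tau> \<tau> / real b ^ A + decay b \<tau> \<tau> / real b ^ topsum b \<kappa> (Suc L) \<tau>) / m ^ \<tau>
              \<le> decay b (Suc \<tau>) (Suc \<tau>) / real b ^ A / m ^ \<tau>"
            using m by (intro divide_right_mono) auto
          then show ?thesis unfolding 3 4 t by (simp add: add_divide_distrib mult.commute)
        next
          case less: False
          then have t: "t = nact b \<kappa> L" "t < \<tau>" by (auto simp: t_def)
          have "topsum b \<kappa> L (\<tau> - 1) = A"
            unfolding A_def using less topsum_eq_nact[of b \<kappa> L "\<tau> - 1"] topsum_eq_nact[of b \<kappa> L \<tau>] by simp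
          then have "bd (Suc L) \<tau> = decay b \<tau> (Suc t) / m ^ Suc t / real b ^ (Suc L + A)"
            using False t by (simp add: bd_def)
          also have "\<dots> = decay b \<tau> (Suc t) / (m * real b ^ Suc L) / m ^ t / real b ^ A"
            by (simp add: power_add mult_ac)
          finally have 4: "bd (Suc L) \<tau> = decay b \<tau> (Suc t) / (m * real b ^ Suc L) / m ^ t / real b ^ A" .
          have "m * real b ^ Suc L = (m * real b) * real b ^ L" by simp
          also have "\<dots> \<ge> 4 * real b ^ t"
            using mb nact_le[of b \<kappa> L] b by (intro mult_mono power_increasing) (auto simp: t)
          finally have "(decay b \<tau> t + decay b \<tau> (Suc t) / (m * real b ^ Suc L)) / m ^ t / real b ^ A
              \<le> decay b (Suc \<tau>) (Suc t) / m ^ t / real b ^ A"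
            using m by (intro divide_right_mono decay_step_unsaturated[OF b t(2)]) auto
          then show ?thesis unfolding 3 4 by (simp add: add_divide_distrib)
        qed
      qed (use h m in auto)
      also have "\<dots> = bd (Suc L) (Suc \<tau>)"
        using False by (simp add: bd_def t_def A_def h_def power_add)
      finally show ?case .
    qed
  qed
  then show ?case using Suc.prems by (simp only: bd_def m_def)
qed

lemma DW_trivial_bern_per:
  assumes b: "b > 0" and "\<forall>a\<in>{1..L}. b dvd \<kappa> a"
  shows "DW b \<kappa> L (bern_perc \<tau>) z = of_real (bern_per \<tau> (real b ^ L * z) / real b ^ (L * \<tau>))"
proof -
  have "DW b \<kappa> L (bern_perc \<tau>) z = of_real ((\<Sum>h<b ^ L. bern_per \<tau> (z + real h / real (b ^ L))) / real (b ^ L))"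
    by (simp add: DW_def DW_trivial_frequencies[OF assms])
  also have "(\<Sum>h<b ^ L. bern_per \<tau> (z + real h / real (b ^ L))) =
      real (b ^ L) / real (b ^ L) ^ \<tau> * bern_per \<tau> (real (b ^ L) * z)"
    by (rule bern_per_multiplication) (use b in simp)
  finally show ?thesis using b by (simp add: power_mult)
qed

lemma degree_shift_diff:
  fixes p :: "complex poly"
  shows "p \<circ>\<^sub>p [:c, 1:] - p = 0 \<or> Polynomial.degree (p \<circ>\<^sub>p [:c, 1:] - p) < Polynomial.degree p"
proof -
  have deg: "Polynomial.degree (p \<circ>\<^sub>p [:c, 1:]) = Polynomial.degree p" by simp
  have "lead_coeff (p \<circ>\<^sub>p [:c, 1:]) = lead_coeff p"
    by (subst lead_coeff_comp) auto
  then have "Polynomial.coeff (p \<circ>\<^sub>p [:c, 1:] - p) (Polynomial.degree p) = 0"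
    unfolding deg by simp
  moreover have "Polynomial.degree (p \<circ>\<^sub>p [:c, 1:] - p) \<le> Polynomial.degree p"
    using degree_diff_le[of "p \<circ>\<^sub>p [:c, 1:]" "Polynomial.degree p" p] deg by simp
  ultimately show ?thesis
    using degree_less_if_less_eqI by blast
qed

text \<open>
  On the grid a polynomial is annihilated by more nontrivial frequencies than its degree, because
  each of them lowers the degree: its weights add up to zero, so they act through differences of shifts.
\<close>

lemma DW_poly:
  fixes p :: "complex poly"
  assumes b: "b \<ge> 2"
  shows "\<exists>q. (\<forall>z. DW b \<kappa> L (\<lambda>y. poly p (of_real y)) z = poly q (of_real z)) \<and>
    (q = 0 \<or> Polynomial.degree q + nact b \<kappa> L \<le> Polynomial.degree p)"
proof (induction L)
  case 0
  show ?case by (intro exI[of _ p]) simp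
next
  case (Suc L)
  then obtain q where q: "\<And>z. DW b \<kappa> L (\<lambda>y. poly p (of_real y)) z = poly q (of_real z)"
      "q = 0 \<or> Polynomial.degree q + nact b \<kappa> L \<le> Polynomial.degree p"
    by blast
  define w where "w d = chr b (- int (\<kappa> (Suc L) * d)) / of_nat b" for d
  define s where "s d = [:complex_of_real (real d / real b ^ Suc L), 1:]" for d
  define r where "r = (\<Sum>d<b. Polynomial.smult (w d) (q \<circ>\<^sub>p s d))"
  have r: "DW b \<kappa> (Suc L) (\<lambda>y. poly p (of_real y)) z = poly r (of_real z)" for z
  proof -
    have "DW b \<kappa> (Suc L) (\<lambda>y. poly p (of_real y)) z =
      (\<Sum>d<b. chr b (- int (\<kappa> (Suc L) * d)) * poly q (of_real (z + real d / real b ^ Suc L))) / of_nat b"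
      using b by (simp add: DW_Suc q(1))
    also have "\<dots> = poly r (of_real z)"
      by (simp add: r_def w_def s_def poly_sum poly_pcompose sum_divide_distrib add.commute)
    finally show ?thesis .
  qed
  show ?case
  proof (cases "b dvd \<kappa> (Suc L)")
    case True
    have "r = 0 \<or> Polynomial.degree r \<le> Polynomial.degree q"
      unfolding r_def by (intro disjI2 degree_sum_le) (auto simp: s_def degree_smult_le[THEN order_trans])
    moreover have "r = 0" if "q = 0" using that by (simp add: r_def)
    ultimately show ?thesis using r q(2) True by (intro exI[of _ r]) auto
  next
    case False
    have "(\<Sum>d<b. w d) = (\<Sum>d<b. chr b (int d * - int (\<kappa> (Suc L)))) / of_nat b"
      by (simp add: w_def sum_divide_distrib mult.commute)
    also have "\<dots> = 0"
      unfolding sum_chr[OF b] using False by simp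
    finally have "(\<Sum>d<b. Polynomial.smult (w d) q) = 0"
      by (simp add: smult_sum[symmetric])
    then have r_eq: "r = (\<Sum>d<b. Polynomial.smult (w d) (q \<circ>\<^sub>p s d - q))"
      by (simp add: r_def smult_diff_right sum_subtractf)
    have sd: "q \<circ>\<^sub>p s d - q = 0 \<or> Polynomial.degree (q \<circ>\<^sub>p s d - q) < Polynomial.degree q" for d
      unfolding s_def by (rule degree_shift_diff)
    have "r = 0 \<or> Polynomial.degree r < Polynomial.degree q"
    proof (cases "Polynomial.degree q = 0")
      case True
      then have "q \<circ>\<^sub>p s d - q = 0" for d using sd[of d] by auto
      then show ?thesis by (simp add: r_eq)
    next
      case False
      have "Polynomial.degree r < Polynomial.degree q"
        unfolding r_eq
      proof (rule degree_sum_less)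
        fix d show "Polynomial.degree (Polynomial.smult (w d) (q \<circ>\<^sub>p s d - q)) < Polynomial.degree q"
          using sd[of d] False by (auto intro: le_less_trans[OF degree_smult_le])
      qed (use False in auto)
      then show ?thesis by simp
    qed
    moreover have "r = 0" if "q = 0" using that by (simp add: r_def)
    ultimately show ?thesis using r q(2) False by (intro exI[of _ r]) auto
  qed
qed

lemma bern_as_poly:
  obtains p :: "complex poly" where "Polynomial.degree p \<le> \<tau>" "\<And>y. complex_of_real (bern \<tau> y) = poly p (of_real y)"
proof
  let ?p = "\<Sum>k\<le>\<tau>. Polynomial.monom (complex_of_real (real (\<tau> choose k) * bernoulli_num k / fact \<tau>)) (\<tau> - k)"
  show "Polynomial.degree ?p \<le> \<tau>"
    by (intro degree_sum_le) (auto intro: order_trans[OF degree_monom_le])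
  show "complex_of_real (bern \<tau> y) = poly ?p (of_real y)" for y
    by (simp add: bern_def bernoulli_poly_def poly_sum poly_monom sum_divide_distrib)
qed

lemma DW_bern_per_vanishes:
  assumes b: "b \<ge> 2" and "nact b \<kappa> L > \<tau>"
  shows "DW b \<kappa> L (bern_perc \<tau>) 0 = 0"
proof -
  obtain p :: "complex poly" where p: "Polynomial.degree p \<le> \<tau>" "\<And>y. complex_of_real (bern \<tau> y) = poly p (of_real y)"
    using bern_as_poly[of \<tau>] by metis
  have "DW b \<kappa> L (bern_perc \<tau>) 0 = DW b \<kappa> L (\<lambda>y. poly p (of_real y)) 0"
    by (rule DW_cong_grid) (use b in \<open>auto simp: p(2)[symmetric] bern_per_eq_bern\<close>)
  also obtain q where "DW b \<kappa> L (\<lambda>y. poly p (of_real y)) 0 = poly q (of_real 0)"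
      "q = 0 \<or> Polynomial.degree q + nact b \<kappa> L \<le> Polynomial.degree p"
    using DW_poly[OF b, of \<kappa> L p] by blast
  then have "DW b \<kappa> L (\<lambda>y. poly p (of_real y)) 0 = 0"
    using assms(2) p(1) by auto
  finally show ?thesis .
qed

lemma two_sin_pi_div:
  assumes "b \<ge> 2"
  shows "0 < 2 * sin (pi / real b)" "2 * sin (pi / real b) \<le> 2"
proof -
  have "0 < 2 / real b" using assms by auto
  then show "0 < 2 * sin (pi / real b)" using sin_pi_div_ge[OF assms] by linarith
  show "2 * sin (pi / real b) \<le> 2" using sin_le_one[of "pi / real b"] by linarith
qed

text \<open>
  The case \<open>t = \<alpha>\<close> uses the first entry of the outer maximum in the constant, the case \<open>t < \<alpha>\<close> the
  second one. The last factor of the constant is at least \<open>5\<close> and at least \<open>2 (1 + 1 / b)\<close>.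
\<close>

lemma C_const_ge:
  assumes b: "b \<ge> 2" and "\<alpha> \<ge> 2" and t: "1 \<le> t" "t \<le> \<alpha>"
  shows "4 * (1 + 1 / real b) ^ (t - 1) / (2 * sin (pi / real b)) ^ t \<le> C_const b \<alpha>"
proof -
  define m where "m = 2 * sin (pi / real b)"
  have m: "0 < m" unfolding m_def using two_sin_pi_div[OF b] by simp
  define Mx where "Mx = max (2 / m ^ \<alpha>) (Max ((\<lambda>z. 1 / m ^ z) ` {1..\<alpha>-1}))"
  define R where "R = 1 + 1 / real b + 1 / (real b * (real b + 1))"
  define Z where "Z = 3 + 2 / real b + (2 * real b + 1) / (real b - 1)"
  have C: "C_const b \<alpha> = Mx * R ^ (\<alpha> - 2) * Z"
    by (simp add: C_const_def Mx_def R_def Z_def m_def)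
  have "(2 * real b + 1) / (real b - 1) \<ge> 2" using b by (simp add: field_simps)
  moreover have "2 / real b \<ge> 0" by simp
  moreover have "2 * (1 + 1 / real b) = 2 + 2 / real b" by simp
  ultimately have Z: "Z \<ge> 5" "Z \<ge> 2 * (1 + 1 / real b)" unfolding Z_def by linarith+
  have rho: "1 \<le> 1 + 1 / real b" "1 + 1 / real b \<le> R" by (auto simp: R_def)
  have R: "1 \<le> R" using rho by linarith
  have Mx0: "Mx \<ge> 0" using m by (auto simp: Mx_def le_max_iff_disj)
  show ?thesis
  proof (cases "t = \<alpha>")
    case True
    have "4 * (1 + 1 / real b) ^ (t - 1) / m ^ t = 2 / m ^ \<alpha> * (1 + 1 / real b) ^ (\<alpha> - 2) * (2 * (1 + 1 / real b))"
    proof -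
      have "t - 1 = Suc (\<alpha> - 2)" using True assms by simp
      then show ?thesis by (simp add: True)
    qed
    also have "\<dots> \<le> Mx * R ^ (\<alpha> - 2) * Z"
      using Z rho R Mx0 m by (intro mult_mono power_mono mult_nonneg_nonneg) (auto simp: Mx_def)
    finally show ?thesis by (simp add: C m_def)
  next
    case False
    have "1 / m ^ t \<le> Max ((\<lambda>z. 1 / m ^ z) ` {1..\<alpha>-1})"
      using t False by (intro Max_ge) auto
    then have Mx: "1 / m ^ t \<le> Mx" by (simp add: Mx_def)
    have "4 * (1 + 1 / real b) ^ (t - 1) / m ^ t = 1 / m ^ t * (1 + 1 / real b) ^ (t - 1) * 4"
      by simp
    also have "\<dots> \<le> Mx * R ^ (\<alpha> - 2) * Z"
    proof (intro mult_mono mult_nonneg_nonneg)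
      have "(1 + 1 / real b) ^ (t - 1) \<le> R ^ (t - 1)" using rho by (intro power_mono) auto
      also have "\<dots> \<le> R ^ (\<alpha> - 2)" using t False R by (intro power_increasing) auto
      finally show "(1 + 1 / real b) ^ (t - 1) \<le> R ^ (\<alpha> - 2)" .
    qed (use Mx Z m Mx0 R in auto)
    finally show ?thesis by (simp add: C m_def)
  qed
qed

lemma C_const_ge_2:
  assumes "b \<ge> 2" and "\<alpha> \<ge> 2"
  shows "C_const b \<alpha> \<ge> 2"
proof -
  have "2 \<le> 4 / (2 * sin (pi / real b))"
    using two_sin_pi_div[OF assms(1)] by (simp add: pos_le_divide_eq)
  then show ?thesis using C_const_ge[OF assms, of 1] assms by simp
qed

lemma sum_half_powers: "(\<Sum>c=v..v + d. (1/2::real) ^ (c - v)) + (1/2) ^ d = 2"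
  by (induction d) auto

text \<open>
  The bounds for one frequency, summed over all degrees, stay below the constant. Degrees below
  the number of nontrivial digits do not contribute, and each further degree gains a factor
  \<open>1 / 2\<close>. The last summand on the left is the bound for the kernel of the remainder term.
\<close>

lemma sum_norm_DW_bern_per_le:
  assumes b: "b \<ge> 2" and \<alpha>: "\<alpha> \<ge> 2" and act: "nact b \<kappa> L \<ge> 1"
  shows "(\<Sum>c=1..\<alpha>. norm (DW b \<kappa> L (bern_perc c) 0)) +
      decay b \<alpha> (min (nact b \<kappa> L) \<alpha>) / (2 * sin (pi / real b)) ^ min (nact b \<kappa> L) \<alpha> / real b ^ topsum b \<kappa> L \<alpha>
    \<le> C_const b \<alpha> / real b ^ topsum b \<kappa> L \<alpha>"
proof -
  define m where "m = 2 * sin (pi / real b)"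
  have m: "0 < m" unfolding m_def using two_sin_pi_div[OF b] by simp
  define v where "v = nact b \<kappa> L"
  define t where "t = min v \<alpha>"
  have t: "1 \<le> t" "t \<le> \<alpha>" using act \<alpha> by (auto simp: t_def v_def)
  define P where "P = 2 * (1 + 1 / real b) ^ (t - 1) / m ^ t / real b ^ topsum b \<kappa> L \<alpha>"
  have P: "P \<ge> 0" unfolding P_def using m by auto
  have kernel: "decay b \<alpha> (min v \<alpha>) / m ^ min v \<alpha> / real b ^ topsum b \<kappa> L \<alpha> = P * (1/2) ^ (\<alpha> - t)"
    using t by (simp add: P_def decay_def t_def[symmetric])
  have "(\<Sum>c=1..\<alpha>. norm (DW b \<kappa> L (bern_perc c) 0)) \<le> (\<Sum>c=t..\<alpha>. P * (1/2) ^ (c - t))"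
  proof -
    have low: "DW b \<kappa> L (bern_perc c) 0 = 0" if "c < v" for c
      by (rule DW_bern_per_vanishes[OF b]) (use that in \<open>simp add: v_def\<close>)
    have "(\<Sum>c=1..\<alpha>. norm (DW b \<kappa> L (bern_perc c) 0)) = (\<Sum>c=t..\<alpha>. norm (DW b \<kappa> L (bern_perc c) 0))"
      using t by (intro sum.mono_neutral_right) (auto simp: low t_def)
    also have "\<dots> \<le> (\<Sum>c=t..\<alpha>. P * (1/2) ^ (c - t))"
    proof (rule sum_mono)
      fix c assume c: "c \<in> {t..\<alpha>}"
      show "norm (DW b \<kappa> L (bern_perc c) 0) \<le> P * (1/2) ^ (c - t)"
      proof (cases "c < v")
        case True
        then show ?thesis using P by (simp add: low)
      next
        case False
        then have tv: "t = v" "min v c = v" using c by (auto simp: t_def)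
        have "topsum b \<kappa> L c = topsum b \<kappa> L \<alpha>"
          using topsum_eq_nact[of b \<kappa> L c] topsum_eq_nact[of b \<kappa> L \<alpha>] False c by (simp add: v_def)
        then show ?thesis
          using norm_DW_bern_per_le[OF b, of c \<kappa> L 0] c t tv(2)
          by (simp add: v_def[symmetric] m_def[symmetric] P_def tv(1)[symmetric] decay_def)
      qed
    qed
    finally show ?thesis .
  qed
  then have "(\<Sum>c=1..\<alpha>. norm (DW b \<kappa> L (bern_perc c) 0)) + P * (1/2) ^ (\<alpha> - t) \<le>
      P * ((\<Sum>c=t..t + (\<alpha> - t). (1/2) ^ (c - t)) + (1/2) ^ (\<alpha> - t))"
    using t by (simp add: sum_distrib_left distrib_left)
  also have "\<dots> = 4 * (1 + 1 / real b) ^ (t - 1) / m ^ t / real b ^ topsum b \<kappa> L \<alpha>"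
    unfolding sum_half_powers by (simp add: P_def)
  also have "\<dots> \<le> C_const b \<alpha> / real b ^ topsum b \<kappa> L \<alpha>"
    unfolding m_def by (intro divide_right_mono C_const_ge[OF b \<alpha> t]) simp
  finally show ?thesis unfolding kernel[symmetric] by (simp only: v_def m_def)
qed

text \<open>
  The analogue for the frequency zero, where the multiplication theorem gives the decay. The
  factors \<open>2 ^ - c\<close> from the bounds of the Bernoulli functions add up to one.
\<close>

lemma sum_trivial_bern_per_le:
  assumes b: "b \<ge> 2" and "\<alpha> \<ge> 1"
  shows "(\<Sum>c=1..\<alpha>. 1 / 2 ^ c / real b ^ (n * c)) + 1 / 2 ^ \<alpha> / real b ^ (n * \<alpha>) \<le> 1 / real b ^ n"
proof -
  have le: "1 / 2 ^ c / real b ^ (n * c) \<le> 1 / 2 ^ c / real b ^ n" if "c \<ge> 1" for c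
    using b that by (intro divide_left_mono power_increasing) auto
  have half: "(\<Sum>c=1..d. 1 / 2 ^ c) + 1 / 2 ^ d = (1::real)" for d
    by (induction d) auto
  have "(\<Sum>c=1..\<alpha>. 1 / 2 ^ c / real b ^ (n * c)) + 1 / 2 ^ \<alpha> / real b ^ (n * \<alpha>) \<le>
      (\<Sum>c=1..\<alpha>. 1 / 2 ^ c / real b ^ n) + 1 / 2 ^ \<alpha> / real b ^ n"
    using le assms(2) by (intro add_mono sum_mono) auto
  also have "\<dots> = ((\<Sum>c=1..\<alpha>. 1 / 2 ^ c) + 1 / 2 ^ \<alpha>) / real b ^ n"
    by (simp add: sum_divide_distrib add_divide_distrib)
  finally show ?thesis by (simp only: half)
qed

definition dig :: "nat \<Rightarrow> nat \<Rightarrow> nat \<Rightarrow> nat" where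
  "dig b k a = k div b ^ (a - 1) mod b"

lemma dig_less: "b > 0 \<Longrightarrow> dig b k a < b"
  by (simp add: dig_def)

lemma dvd_dig_iff: "b > 0 \<Longrightarrow> b dvd dig b k a \<longleftrightarrow> dig b k a = 0"
  using dig_less[of b k a] nat_dvd_not_less by fastforce

lemma dig_0 [simp]: "dig b 0 a = 0"
  by (simp add: dig_def)

lemma digits_zero_imp_dvd:
  assumes "b > 0" and "\<forall>a\<in>{1..n}. dig b k a = 0"
  shows "b ^ n dvd k"
  using assms(2)
proof (induction n)
  case (Suc n)
  then obtain j where j: "k = b ^ n * j" by (auto simp: atLeastAtMostSuc_conv)
  have "k div b ^ n mod b = 0" using Suc.prems by (auto simp: dig_def atLeastAtMostSuc_conv)
  then have "b dvd j" using assms(1) by (simp add: j mod_eq_0_iff_dvd)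
  then show ?case by (auto simp: j)
qed simp

lemma nact_dig_ge_1:
  assumes "b \<ge> 2" "0 < k" "k < b ^ n"
  shows "nact b (dig b k) n \<ge> 1"
proof (rule ccontr)
  assume "\<not> ?thesis"
  then have "\<forall>a\<in>{1..n}. dig b k a = 0"
    using assms(1) dvd_dig_iff[of b k] nact_eq_0_iff[of b "dig b k" n] by auto
  then have "b ^ n dvd k" using assms(1) by (intro digits_zero_imp_dvd) auto
  then show False using assms by (auto dest: dvd_imp_le)
qed

lemma sorted_list_of_set_insert_greatest:
  fixes A :: "nat set"
  assumes "finite A" "\<forall>a\<in>A. a < x"
  shows "sorted_list_of_set (insert x A) = sorted_list_of_set A @ [x]"
  using assms by (intro strict_sorted_equal) (auto simp: sorted_wrt_append simp del: sorted_list_of_set_insert_remove)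

lemma topsum_eq_sum_list:
  "topsum b \<kappa> L r = sum_list (take r (rev (sorted_list_of_set {a \<in> {1..L}. \<not> b dvd \<kappa> a})))"
proof (induction L arbitrary: r)
  case (Suc L)
  show ?case
  proof (cases "b dvd \<kappa> (Suc L)")
    case True
    then have "{a \<in> {1..Suc L}. \<not> b dvd \<kappa> a} = {a \<in> {1..L}. \<not> b dvd \<kappa> a}"
      by (auto simp: le_Suc_eq)
    then show ?thesis using True Suc.IH by simp
  next
    case False
    then have "{a \<in> {1..Suc L}. \<not> b dvd \<kappa> a} = insert (Suc L) {a \<in> {1..L}. \<not> b dvd \<kappa> a}"
      by (auto simp: le_Suc_eq)
    then have "sorted_list_of_set {a \<in> {1..Suc L}. \<not> b dvd \<kappa> a} =
        sorted_list_of_set {a \<in> {1..L}. \<not> b dvd \<kappa> a} @ [Suc L]"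
      by (simp only:) (rule sorted_list_of_set_insert_greatest, auto)
    then show ?thesis using False Suc.IH by (cases r) auto
  qed
qed simp

lemma mu_eq_topsum:
  assumes b: "b \<ge> 2" and k: "k < b ^ n"
  shows "mu b \<alpha> k = topsum b (dig b k) n \<alpha>"
proof -
  have "digit_positions b k = {a \<in> {1..n}. \<not> b dvd dig b k a}"
  proof -
    have "a \<le> n" if "dig b k a \<noteq> 0" for a
    proof (rule ccontr)
      assume "\<not> a \<le> n"
      then have "b ^ n \<le> b ^ (a - 1)" using b by (intro power_increasing) auto
      then have "k div b ^ (a - 1) = 0" using k by simp
      then show False using that by (simp add: dig_def)
    qed
    then show ?thesis using b by (auto simp: digit_positions_def dvd_dig_iff) (auto simp: dig_def)
  qed
  then show ?thesis unfolding mu_def topsum_eq_sum_list by simp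
qed

lemma mu_digit_times_power:
  assumes b: "b \<ge> 2" and c: "0 < c" "c < b" and "\<alpha> \<ge> 1"
  shows "mu b \<alpha> (c * b ^ n) = Suc n"
proof -
  have "c * b ^ n div b ^ (a - 1) mod b \<noteq> 0 \<longleftrightarrow> a = Suc n" if "a \<ge> 1" for a
  proof -
    consider "a - 1 < n" | "a - 1 = n" | "a - 1 > n" by linarith
    then show ?thesis
    proof cases
      case 1
      then obtain d where d: "n = a - 1 + Suc d" using less_imp_Suc_add by fastforce
      then have "c * b ^ n = b ^ (a - 1) * (c * b ^ d * b)" by (simp add: power_add mult_ac)
      then have "c * b ^ n div b ^ (a - 1) = c * b ^ d * b" using b by (simp only:) simp
      then show ?thesis using 1 by simp
    next
      case 2
      then show ?thesis using b c that by auto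
    next
      case 3
      have "b ^ Suc n \<le> b ^ (a - 1)" using b 3 by (intro power_increasing) auto
      moreover have "c * b ^ n < b ^ Suc n" using b c by simp
      ultimately have "c * b ^ n div b ^ (a - 1) = 0" by (intro div_less) linarith
      then show ?thesis using 3 by simp
    qed
  qed
  then have "digit_positions b (c * b ^ n) = {Suc n}"
    by (auto simp: digit_positions_def)
  then show ?thesis using assms(4) by (cases \<alpha>) (auto simp: mu_def)
qed

section \<open>Polynomial lattices and their duals\<close>

lemma sum_prod_digits:
  fixes F :: "nat \<Rightarrow> nat \<Rightarrow> 'a :: comm_semiring_1"
  assumes b: "b > 0"
  shows "(\<Sum>h<b ^ n. \<Prod>i<n. F i (h div b ^ i mod b)) = (\<Prod>i<n. \<Sum>d<b. F i d)"
proof (induction n arbitrary: F)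
  case (Suc n)
  have "(\<Sum>h<b ^ Suc n. \<Prod>i<Suc n. F i (h div b ^ i mod b)) =
      (\<Sum>h<b ^ n. \<Sum>d<b. F 0 d * (\<Prod>i<n. F (Suc i) (h div b ^ i mod b)))"
    unfolding sum_digit_split
  proof (intro sum.cong refl)
    fix h d assume "d \<in> {..<b}"
    then have "(b * h + d) mod b = d" "(b * h + d) div b = h" by auto
    then show "(\<Prod>i<Suc n. F i ((b * h + d) div b ^ i mod b)) = F 0 d * (\<Prod>i<n. F (Suc i) (h div b ^ i mod b))"
      by (simp add: prod.lessThan_Suc_shift div_mult2_eq del: prod.lessThan_Suc)
  qed
  also have "\<dots> = (\<Sum>d<b. F 0 d) * (\<Prod>i<n. \<Sum>d<b. F (Suc i) d)"
    unfolding Suc.IH[of "\<lambda>i. F (Suc i)", symmetric] by (simp add: sum_product sum.swap[of _ "{..<b ^ n}"])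
  also have "\<dots> = (\<Prod>i<Suc n. \<Sum>d<b. F i d)"
    by (simp add: prod.lessThan_Suc_shift del: prod.lessThan_Suc)
  finally show ?case .
qed simp

lemma wgt_cong: "(\<And>a. a \<in> {1..n} \<Longrightarrow> \<kappa> a = \<kappa>' a) \<Longrightarrow> wgt b \<kappa> n h = wgt b \<kappa>' n h"
proof (induction n arbitrary: h)
  case (Suc n)
  then show ?case by (simp del: of_nat_mult)
qed simp

lemma dig_shifted_add:
  assumes b: "b > 0" and k: "k < b ^ n" and a: "a \<in> {1..n}"
  shows "dig b (c * b ^ n + k) a = dig b k a"
proof -
  obtain d where d: "n = a - 1 + Suc d" using a less_imp_Suc_add[of "a - 1" n] by fastforce
  then have "c * b ^ n = c * b ^ d * b * b ^ (a - 1)" by (simp add: power_add mult_ac)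
  then have "(c * b ^ n + k) div b ^ (a - 1) = c * b ^ d * b + k div b ^ (a - 1)"
    using b by (simp only: div_mult_self3) simp
  then show ?thesis by (simp add: dig_def)
qed

text \<open>
  Orthogonality in the frequency. The weights recurse on the lowest digit of the grid index, which is
  paired with the highest digit of the frequency.
\<close>

lemma sum_wgt_orthogonal:
  assumes b: "b \<ge> 2"
  shows "h < b ^ n \<Longrightarrow> h' < b ^ n \<Longrightarrow>
    (\<Sum>k<b ^ n. wgt b (dig b k) n h * cnj (wgt b (dig b k) n h')) = (if h = h' then of_nat (b ^ n) else 0)"
proof (induction n arbitrary: h h')
  case (Suc n)
  have b0: "b > 0" using b by simp
  define t where "t k = wgt b (dig b k) (Suc n) h * cnj (wgt b (dig b k) (Suc n) h')" for k
  define O' where "O' k = wgt b (dig b k) n (h div b) * cnj (wgt b (dig b k) n (h' div b))" for k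
  define e where "e c = chr b (int c * (int (h' mod b) - int (h mod b)))" for c
  have div_less: "h div b < b ^ n" "h' div b < b ^ n"
    using Suc.prems by (auto simp: less_mult_imp_div_less mult.commute)
  have t: "t (k + c * b ^ n) = e c * O' k" if "k < b ^ n" "c < b" for k c
  proof -
    have 1: "wgt b (dig b (k + c * b ^ n)) n x = wgt b (dig b k) n x" for x
      using dig_shifted_add[OF b0 that(1), of _ c] by (intro wgt_cong) (simp add: add.commute)
    have 2: "dig b (k + c * b ^ n) (Suc n) = c"
      using that b by (simp add: dig_def)
    have 3: "A * c1 * cnj (B * c2) = c1 * cnj c2 * (A * cnj B)" for A B c1 c2 :: complex
      by simp
    have "chr b (- int (c * (h mod b))) * cnj (chr b (- int (c * (h' mod b)))) = e c"
      by (simp add: e_def cnj_chr chr_add[symmetric] right_diff_distrib)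
    then show ?thesis
      unfolding t_def O'_def wgt.simps 1 2 3 by (simp only:)
  qed
  have "sum t {..<b ^ Suc n} = (\<Sum>c<b. sum t {c * b ^ n..<c * b ^ n + b ^ n})"
    by (subst sum.nat_group) simp
  also have "\<dots> = (\<Sum>c<b. e c * sum O' {..<b ^ n})"
  proof (rule sum.cong[OF refl])
    fix c assume c: "c \<in> {..<b}"
    have "sum t {c * b ^ n..<c * b ^ n + b ^ n} = sum t {0 + c * b ^ n..<b ^ n + c * b ^ n}"
      by (simp only: add_0 add.commute)
    also have "\<dots> = (\<Sum>k=0..<b ^ n. t (k + c * b ^ n))"
      by (rule sum.shift_bounds_nat_ivl)
    also have "\<dots> = (\<Sum>k=0..<b ^ n. e c * O' k)"
      using c t by (intro sum.cong refl) auto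
    finally show "sum t {c * b ^ n..<c * b ^ n + b ^ n} = e c * sum O' {..<b ^ n}"
      by (simp only: sum_distrib_left lessThan_atLeast0)
  qed
  also have "\<dots> = (\<Sum>c<b. e c) * sum O' {..<b ^ n}"
    by (simp only: sum_distrib_right)
  also have "\<dots> = (if h = h' then of_nat (b ^ Suc n) else 0)"
  proof -
    have "int b dvd int (h' mod b) - int (h mod b) \<longleftrightarrow> h' mod b = h mod b"
      by (metis (no_types, opaque_lifting) mod_eq_dvd_iff mod_mod_trivial of_nat_eq_iff zmod_int)
    moreover have "h = h' \<longleftrightarrow> h' mod b = h mod b \<and> h div b = h' div b"
      by (metis div_mult_mod_eq)
    ultimately show ?thesis
      unfolding e_def O'_def sum_chr[OF b] Suc.IH[OF div_less] by auto
  qed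
  finally show ?case unfolding t_def[abs_def] .
qed simp

lemma DW_inversion:
  assumes b: "b \<ge> 2" and h: "h < b ^ n"
  shows "g (real h / real b ^ n) = (\<Sum>k<b ^ n. DW b (dig b k) n g 0 * cnj (wgt b (dig b k) n h))"
proof -
  have "(\<Sum>k<b ^ n. DW b (dig b k) n g 0 * cnj (wgt b (dig b k) n h)) =
      (\<Sum>k<b ^ n. \<Sum>h'<b ^ n. g (real h' / real b ^ n) / of_nat (b ^ n) *
        (wgt b (dig b k) n h' * cnj (wgt b (dig b k) n h)))"
    unfolding DW_def sum_divide_distrib sum_distrib_right by (simp add: mult_ac)
  also have "\<dots> = (\<Sum>h'<b ^ n. \<Sum>k<b ^ n. g (real h' / real b ^ n) / of_nat (b ^ n) *
        (wgt b (dig b k) n h' * cnj (wgt b (dig b k) n h)))"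
    by (rule sum.swap)
  also have "\<dots> = (\<Sum>h'<b ^ n. if h' = h then g (real h' / real b ^ n) else 0)"
    unfolding sum_distrib_left[symmetric]
    using b h by (intro sum.cong refl) (simp add: sum_wgt_orthogonal)
  also have "\<dots> = g (real h / real b ^ n)"
    using h by simp
  finally show ?thesis by simp
qed

text \<open>
  The number with the base \<open>b\<close> digits \<open>y 1, \<dots>, y n\<close>, from the highest to the lowest. It is the
  index in the grid of the point with these digits after the point.
\<close>

fun point_index :: "nat \<Rightarrow> (nat \<Rightarrow> nat) \<Rightarrow> nat \<Rightarrow> nat" where
  "point_index b y 0 = 0"
| "point_index b y (Suc n) = b * point_index b y n + y (Suc n)"

lemma point_index_less:
  assumes "\<And>a. y a < b"
  shows "point_index b y n < b ^ n"
proof (induction n)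
  case (Suc n)
  then have "b * point_index b y n + b \<le> b * b ^ n"
    by (metis Suc_leI mult_Suc_right mult_le_mono2 add.commute)
  then show ?case using assms[of "Suc n"] by simp
qed simp

lemma point_index_value:
  assumes "b > 0"
  shows "real (point_index b y n) / real b ^ n = (\<Sum>a=1..n. real (y a) / real b ^ a)"
  by (induction n) (use assms in \<open>auto simp: field_simps\<close>)

lemma wgt_point_index:
  assumes "\<And>a. y a < b"
  shows "wgt b \<kappa> n (point_index b y n) = (\<Prod>a=1..n. chr b (- int (\<kappa> a * y a)))"
proof (induction n)
  case (Suc n)
  have "(b * point_index b y n + y (Suc n)) div b = point_index b y n"
    "(b * point_index b y n + y (Suc n)) mod b = y (Suc n)"
    using assms[of "Suc n"] by auto
  then show ?case using Suc by simp
qed simp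

lemma to_int_mod_ring_bounds:
  "0 \<le> to_int_mod_ring (x :: 'b::prime_card mod_ring)" "to_int_mod_ring x < int CARD('b)"
proof -
  have "to_int_mod_ring x \<in> range (to_int_mod_ring :: 'b mod_ring \<Rightarrow> int)" by simp
  then show "0 \<le> to_int_mod_ring x" "to_int_mod_ring x < int CARD('b)"
    unfolding range_to_int_mod_ring by auto
qed

definition laurent_digit :: "'b::prime_card mod_ring fls \<Rightarrow> nat \<Rightarrow> nat" where
  "laurent_digit L a = nat (to_int_mod_ring (fls_nth L (int a)))"

lemma laurent_digit:
  fixes L :: "'b::prime_card mod_ring fls"
  shows "laurent_digit L a < CARD('b)" "int (laurent_digit L a) = to_int_mod_ring (fls_nth L (int a))"
  using to_int_mod_ring_bounds[of "fls_nth L (int a)"] by (auto simp: laurent_digit_def)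

lemma v_map_eq_point_index:
  fixes L :: "'b::prime_card mod_ring fls"
  shows "v_map n L = real (point_index CARD('b) (laurent_digit L) n) / real CARD('b) ^ n"
  unfolding v_map_def laurent_digit(2)[symmetric] by (subst point_index_value) simp_all

text \<open>
  The canonical additive character of the prime field.
\<close>

definition chm :: "'b::prime_card mod_ring \<Rightarrow> complex" where
  "chm x = chr CARD('b) (to_int_mod_ring x)"

lemma card_prime_card_ge_2: "CARD('b::prime_card) \<ge> 2"
  using prime_card prime_ge_2_nat by blast

lemma chm_add: "chm (x + y) = chm x * chm y"
  by (simp add: chm_def to_int_mod_ring_add chr_mod chr_add)

lemma chm_0 [simp]: "chm 0 = 1"
  by (simp add: chm_def)

lemma chm_sum: "finite A \<Longrightarrow> chm (sum f A) = (\<Prod>x\<in>A. chm (f x))"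
  by (induction A rule: finite_induct) (auto simp: chm_add)

lemma chm_of_nat_mult: "chm (of_nat c * x :: 'b::prime_card mod_ring) = chr CARD('b) (int c * to_int_mod_ring x)"
proof (induction c)
  case (Suc c)
  have "chm (of_nat (Suc c) * x) = chm (x + of_nat c * x)" by (simp add: algebra_simps)
  also have "\<dots> = chr CARD('b) (int (Suc c) * to_int_mod_ring x)"
    unfolding chm_add Suc by (simp add: chm_def chr_add[symmetric] algebra_simps)
  finally show ?case .
qed simp

lemma sum_chm_multiples:
  "(\<Sum>d<CARD('b). chm (of_nat d * x :: 'b::prime_card mod_ring)) = (if x = 0 then of_nat CARD('b) else 0)"
proof -
  have "int CARD('b) dvd to_int_mod_ring x \<longleftrightarrow> to_int_mod_ring x = 0"
    using to_int_mod_ring_bounds[of x] zdvd_not_zless[of "to_int_mod_ring x" "int CARD('b)"] by fastforce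
  also have "\<dots> \<longleftrightarrow> x = 0"
    by (metis of_int_mod_ring_to_int_mod_ring of_int_mod_ring_hom.hom_zero to_int_mod_ring_hom.hom_zero)
  finally show ?thesis
    unfolding chm_of_nat_mult sum_chr[OF card_prime_card_ge_2] by simp
qed

lemma fls_nth_poly_to_laurent:
  "fls_nth (poly_to_laurent p) i = (if i \<le> 0 then Polynomial.coeff p (nat (- i)) else 0)"
proof -
  have "poly_to_laurent p = (\<Sum>k\<le>Polynomial.degree (map_poly fls_const p). fls_const (Polynomial.coeff p k) * fls_X_inv ^ k)"
    by (simp add: poly_to_laurent_def poly_altdef coeff_map_poly)
  also have "Polynomial.degree (map_poly fls_const p) = Polynomial.degree p"
    by (rule degree_map_poly) auto
  finally have "fls_nth (poly_to_laurent p) i = (\<Sum>k\<le>Polynomial.degree p. if i = - int k then Polynomial.coeff p k else 0)"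
    by (simp add: fls_nth_sum if_distrib cong: if_cong)
  also have "\<dots> = (\<Sum>k\<le>Polynomial.degree p. if k = nat (- i) then (if i \<le> 0 then Polynomial.coeff p k else 0) else 0)"
    by (intro sum.cong refl) auto
  also have "\<dots> = (if i \<le> 0 then Polynomial.coeff p (nat (- i)) else 0)"
    by (auto simp: coeff_eq_0)
  finally show ?thesis .
qed

lemma poly_to_laurent_0 [simp]: "poly_to_laurent 0 = 0"
  by (rule fls_eqI) (simp add: fls_nth_poly_to_laurent)

lemma poly_to_laurent_add: "poly_to_laurent (p + q) = poly_to_laurent p + poly_to_laurent q"
  by (rule fls_eqI) (simp add: fls_nth_poly_to_laurent)

lemma poly_to_laurent_mult: "poly_to_laurent (p * q) = poly_to_laurent p * poly_to_laurent (q :: 'a::field poly)"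
proof -
  interpret h: comm_ring_hom "fls_const :: 'a \<Rightarrow> 'a fls"
    by unfold_locales (auto simp: fls_plus_const)
  interpret m: map_poly_comm_ring_hom "fls_const :: 'a \<Rightarrow> 'a fls" ..
  show ?thesis unfolding poly_to_laurent_def by (simp add: m.hom_mult)
qed

lemma poly_to_laurent_monom: "poly_to_laurent (Polynomial.monom c k) = fls_const c * fls_X_inv ^ k"
  by (rule fls_eqI) (auto simp: fls_nth_poly_to_laurent)

lemma fls_subdegree_poly_to_laurent:
  assumes "p \<noteq> 0"
  shows "fls_subdegree (poly_to_laurent p) = - int (Polynomial.degree p)"
  by (rule fls_subdegree_eqI) (use assms in \<open>auto simp: fls_nth_poly_to_laurent coeff_eq_0\<close>)

lemma poly_to_laurent_eq_0_iff [simp]: "poly_to_laurent p = 0 \<longleftrightarrow> p = 0"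
proof
  assume *: "poly_to_laurent p = 0"
  show "p = 0"
  proof (rule poly_eqI)
    fix i show "Polynomial.coeff p i = Polynomial.coeff 0 i"
      using fls_nth_poly_to_laurent[of p "- int i"] * by simp
  qed
qed simp

text \<open>The residue of the rational function \<open>A / p\<close>, that is, its coefficient of \<open>1 / x\<close>.\<close>

definition res :: "'a::field poly \<Rightarrow> 'a poly \<Rightarrow> 'a" where
  "res p A = fls_nth (poly_to_laurent A / poly_to_laurent p) 1"

lemma res_add: "res p (A + B) = res p A + res p B"
  by (simp add: res_def poly_to_laurent_add add_divide_distrib)

lemma res_0 [simp]: "res p 0 = 0"
  by (simp add: res_def)

lemma res_sum: "res p (sum f S) = (\<Sum>x\<in>S. res p (f x))"
  by (induction S rule: infinite_finite_induct) (auto simp: res_add)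

lemma res_monom_mult: "res p (Polynomial.monom c i * A) = c * fls_nth (poly_to_laurent A / poly_to_laurent p) (int i + 1)"
proof -
  have eq: "poly_to_laurent (Polynomial.monom c i * A) / poly_to_laurent p =
      fls_const c * (fls_X_inv ^ i * (poly_to_laurent A / poly_to_laurent p))"
    by (simp only: poly_to_laurent_mult poly_to_laurent_monom times_divide_eq_right mult.assoc)
  show ?thesis
    unfolding res_def eq fls_X_inv_power_times_conv_shift(1) by (simp add: add.commute)
qed

text \<open>
  Multiples of \<open>p\<close> have residue zero. A nonzero remainder of degree \<open>deg p - 1 - i\<close> is detected by the
  factor \<open>x\<^sup>i\<close>, which raises the degree to \<open>deg p - 1\<close>, so that the quotient by \<open>p\<close> begins with \<open>1 / x\<close>.
\<close>

lemma dvd_iff_res: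
  fixes p A :: "'a::field_gcd poly"
  assumes p: "p \<noteq> 0" and n: "Polynomial.degree p = n"
  shows "p dvd A \<longleftrightarrow> (\<forall>i<n. res p (Polynomial.monom 1 i * A) = 0)"
proof
  have mult: "res p (p * B) = 0" for B
    using p by (simp add: res_def poly_to_laurent_mult fls_nth_poly_to_laurent)
  {
    assume "p dvd A"
    then obtain B where "A = p * B" by blast
    then have "Polynomial.monom 1 i * A = p * (Polynomial.monom 1 i * B)" for i
      by (simp add: mult_ac)
    then show "\<forall>i<n. res p (Polynomial.monom 1 i * A) = 0" by (simp only: mult) simp
  next
    assume *: "\<forall>i<n. res p (Polynomial.monom 1 i * A) = 0"
    show "p dvd A"
    proof (rule ccontr)
      assume "\<not> p dvd A"
      define R where "R = A mod p"
      have R: "R \<noteq> 0" using \<open>\<not> p dvd A\<close> by (simp add: R_def dvd_eq_mod_eq_0)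
      have deg: "Polynomial.degree R < n"
        using degree_mod_less[OF p, of A] R n by (auto simp: R_def)
      define i where "i = n - 1 - Polynomial.degree R"
      have i: "i < n" using deg by (simp add: i_def)
      have "Polynomial.monom 1 i * A = p * (Polynomial.monom 1 i * (A div p)) + Polynomial.monom 1 i * R"
      proof -
        have "Polynomial.monom 1 i * A = Polynomial.monom 1 i * (p * (A div p) + A mod p)" by simp
        then show ?thesis by (simp only: R_def distrib_left mult.left_commute)
      qed
      then have "res p (p * (Polynomial.monom 1 i * (A div p)) + Polynomial.monom 1 i * R) = 0"
        using * i by metis
      then have 0: "res p (Polynomial.monom 1 i * R) = 0"
        by (simp only: res_add mult add_0)
      have mR: "Polynomial.monom 1 i * R \<noteq> 0" using R by (simp add: monom_eq_0_iff)
      have "Polynomial.degree (Polynomial.monom 1 i * R) = n - 1"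
        using R deg by (subst degree_mult_eq) (auto simp: degree_monom_eq monom_eq_0_iff i_def)
      then have "fls_subdegree (poly_to_laurent (Polynomial.monom 1 i * R) / poly_to_laurent p) = 1"
        using p mR deg by (subst fls_divide_subdegree) (auto simp: fls_subdegree_poly_to_laurent n)
      moreover have "poly_to_laurent (Polynomial.monom 1 i * R) / poly_to_laurent p \<noteq> 0"
        using p mR by simp
      ultimately have "res p (Polynomial.monom 1 i * R) \<noteq> 0"
        unfolding res_def by (metis nth_fls_subdegree_nonzero)
      then show False using 0 by simp
    qed
  }
qed

lemma nat_poly_eq:
  assumes "h < CARD('b) ^ n"
  shows "(nat_poly h :: 'b::prime_card mod_ring poly) =
    (\<Sum>i<n. Polynomial.monom (of_nat (h div CARD('b) ^ i mod CARD('b))) i)"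
proof -
  have b: "CARD('b) \<ge> 2" by (rule card_prime_card_ge_2)
  have z: "h div CARD('b) ^ i = 0" if "i \<ge> n \<or> i \<ge> h" for i
  proof -
    have "h < CARD('b) ^ i"
    proof (cases "i \<ge> n")
      case True
      then have "CARD('b) ^ n \<le> CARD('b) ^ i" using b by (intro power_increasing) auto
      then show ?thesis using assms by simp
    next
      case False
      then have "h \<le> i" using that by simp
      also have "i < 2 ^ i" by (rule less_exp)
      also have "2 ^ i \<le> CARD('b) ^ i" using b by (intro power_mono) auto
      finally show ?thesis .
    qed
    then show ?thesis by simp
  qed
  have "nat_poly h = (\<Sum>i<min h n. Polynomial.monom (of_nat (h div CARD('b) ^ i mod CARD('b))) i :: 'b mod_ring poly)"
    unfolding nat_poly_def by (rule sum.mono_neutral_right) (auto simp: z)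
  also have "\<dots> = (\<Sum>i<n. Polynomial.monom (of_nat (h div CARD('b) ^ i mod CARD('b))) i)"
    by (rule sum.mono_neutral_left) (auto simp: z)
  finally show ?thesis .
qed

text \<open>
  The sum over all polynomials of degree below \<open>n\<close> factorises into sums over the single
  coefficients, each of which vanishes unless the corresponding residue does.
\<close>

lemma sum_chm_res:
  fixes p A :: "'b::prime_card mod_ring poly"
  assumes p: "p \<noteq> 0" and n: "Polynomial.degree p = n"
  shows "(\<Sum>h<CARD('b) ^ n. chm (res p (nat_poly h * A))) = (if p dvd A then of_nat (CARD('b) ^ n) else 0)"
proof -
  define c where "c i = res p (Polynomial.monom 1 i * A)" for i
  have "chm (res p (nat_poly h * A)) = (\<Prod>i<n. chm (of_nat (h div CARD('b) ^ i mod CARD('b)) * c i))"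
    if "h < CARD('b) ^ n" for h
  proof -
    have "res p (nat_poly h * A) = (\<Sum>i<n. of_nat (h div CARD('b) ^ i mod CARD('b)) * c i)"
      unfolding nat_poly_eq[OF that] sum_distrib_right res_sum c_def res_monom_mult by simp
    then show ?thesis by (simp add: chm_sum)
  qed
  then have "(\<Sum>h<CARD('b) ^ n. chm (res p (nat_poly h * A))) =
      (\<Sum>h<CARD('b) ^ n. \<Prod>i<n. chm (of_nat (h div CARD('b) ^ i mod CARD('b)) * c i))"
    by (intro sum.cong refl) simp
  also have "\<dots> = (\<Prod>i<n. \<Sum>d<CARD('b). chm (of_nat d * c i))"
    by (rule sum_prod_digits) simp
  also have "\<dots> = (\<Prod>i<n. if c i = 0 then of_nat CARD('b) else 0)"
    by (simp only: sum_chm_multiples)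
  also have "\<dots> = (if \<forall>i<n. c i = 0 then of_nat (CARD('b) ^ n) else 0)"
    by auto
  finally show ?thesis using dvd_iff_res[OF p n, of A] by (simp add: c_def)
qed

text \<open>
  After Walsh inversion in every factor, a frequency vector contributes the sum over the lattice of
  a character of the residue of \<open>nat_poly h * A\<close>, where \<open>A\<close> is the polynomial that decides about the
  membership in the dual lattice. This sum vanishes unless \<open>p\<close> divides \<open>A\<close>.
\<close>

lemma lattice_average_prod:
  fixes p :: "'b::prime_card mod_ring poly" and Q :: "nat \<Rightarrow> 'b mod_ring poly"
    and g :: "nat \<Rightarrow> real \<Rightarrow> complex"
  assumes p: "p \<noteq> 0" and n: "Polynomial.degree p = n" and u: "u \<subseteq> {1..s}"
  shows "(\<Sum>h<CARD('b) ^ n. \<Prod>j\<in>u. g j (poly_lattice_point s n p Q h j)) / of_nat (CARD('b) ^ n) =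
    (\<Sum>k\<in>{k \<in> u \<rightarrow>\<^sub>E {..<CARD('b) ^ n}. p dvd (\<Sum>j\<in>u. tr_poly n (k j) * Q j)}.
      \<Prod>j\<in>u. DW CARD('b) (dig CARD('b) (k j)) n (g j) 0)"
proof -
  define b where "b = CARD('b)"
  have b: "b \<ge> 2" unfolding b_def by (rule card_prime_card_ge_2)
  have fin: "finite u" using u finite_subset by blast
  define L where "L h j = poly_to_laurent (nat_poly h * Q j) / poly_to_laurent p" for h j
  define H where "H h j = point_index b (laurent_digit (L h j)) n" for h j
  have H: "H h j < b ^ n" for h j
    unfolding H_def b_def by (intro point_index_less laurent_digit)
  have pt: "poly_lattice_point s n p Q h j = real (H h j) / real b ^ n" if "j \<in> u" for h j
  proof -
    have "j \<in> {1..s}" using that u by blast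
    then show ?thesis by (simp add: poly_lattice_point_def L_def H_def b_def v_map_eq_point_index)
  qed
  define A where "A k = (\<Sum>j\<in>u. tr_poly n (k j) * Q j)" for k
  have char: "(\<Prod>j\<in>u. cnj (wgt b (dig b (k j)) n (H h j))) = chm (res p (nat_poly h * A k))" for h k
  proof -
    have "(\<Prod>j\<in>u. cnj (wgt b (dig b (k j)) n (H h j))) =
        (\<Prod>j\<in>u. \<Prod>a=1..n. chm (of_nat (dig b (k j) a) * fls_nth (L h j) (int a)))"
      unfolding H_def b_def wgt_point_index[OF laurent_digit(1)] chm_of_nat_mult laurent_digit(2)[symmetric]
      by (simp add: cnj_chr)
    also have "\<dots> = chm (\<Sum>j\<in>u. \<Sum>a=1..n. of_nat (dig b (k j) a) * fls_nth (L h j) (int a))"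
      using fin by (simp add: chm_sum)
    also have "(\<Sum>j\<in>u. \<Sum>a=1..n. of_nat (dig b (k j) a) * fls_nth (L h j) (int a)) =
        (\<Sum>j\<in>u. \<Sum>i<n. res p (Polynomial.monom (of_nat (k j div b ^ i mod b)) i * (nat_poly h * Q j)))"
    proof (rule sum.cong[OF refl])
      fix j
      have "(\<Sum>a=1..n. of_nat (dig b (k j) a) * fls_nth (L h j) (int a)) =
          (\<Sum>i<n. of_nat (dig b (k j) (Suc i)) * fls_nth (L h j) (int (Suc i)))"
        by (rule sum.reindex_bij_witness[of _ Suc "\<lambda>a. a - 1"]) auto
      then show "(\<Sum>a=1..n. of_nat (dig b (k j) a) * fls_nth (L h j) (int a)) =
          (\<Sum>i<n. res p (Polynomial.monom (of_nat (k j div b ^ i mod b)) i * (nat_poly h * Q j)))"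
        by (simp add: res_monom_mult L_def dig_def add.commute)
    qed
    also have "\<dots> = res p (nat_poly h * A k)"
      by (simp add: A_def tr_poly_def b_def res_sum[symmetric] sum_distrib_left sum_distrib_right mult_ac)
    finally show ?thesis .
  qed
  have "(\<Sum>h<b ^ n. \<Prod>j\<in>u. g j (poly_lattice_point s n p Q h j)) =
      (\<Sum>h<b ^ n. \<Prod>j\<in>u. \<Sum>k<b ^ n. DW b (dig b k) n (g j) 0 * cnj (wgt b (dig b k) n (H h j)))"
    using DW_inversion[OF b H] by (intro sum.cong prod.cong refl) (simp add: pt)
  also have "\<dots> = (\<Sum>h<b ^ n. \<Sum>k\<in>u \<rightarrow>\<^sub>E {..<b ^ n}.
      (\<Prod>j\<in>u. DW b (dig b (k j)) n (g j) 0) * chm (res p (nat_poly h * A k)))"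
    using fin by (subst prod_sum_PiE) (auto simp: prod.distrib char[symmetric])
  also have "\<dots> = (\<Sum>k\<in>u \<rightarrow>\<^sub>E {..<b ^ n}.
      (\<Prod>j\<in>u. DW b (dig b (k j)) n (g j) 0) * (\<Sum>h<b ^ n. chm (res p (nat_poly h * A k))))"
    by (subst sum.swap) (simp only: sum_distrib_left)
  also have "\<dots> = (\<Sum>k\<in>u \<rightarrow>\<^sub>E {..<b ^ n}.
      if p dvd A k then (\<Prod>j\<in>u. DW b (dig b (k j)) n (g j) 0) * of_nat (b ^ n) else 0)"
    unfolding b_def sum_chm_res[OF p n] by (intro sum.cong refl) auto
  also have "\<dots> = (\<Sum>k\<in>{k \<in> u \<rightarrow>\<^sub>E {..<b ^ n}. p dvd A k}.
      (\<Prod>j\<in>u. DW b (dig b (k j)) n (g j) 0)) * of_nat (b ^ n)"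
    unfolding sum_distrib_right using fin by (intro sum.inter_filter[symmetric] finite_PiE) auto
  finally show ?thesis
    using b unfolding b_def[symmetric] A_def[symmetric] by simp
qed

text \<open>
  The dual lattice contains, besides the vectors \<open>k\<close> with entries below \<open>b ^ n\<close>, all vectors that are
  congruent to these modulo \<open>b ^ n\<close>. If \<open>k j = 0\<close> for some but not for all \<open>j\<close>, then replacing the
  zeros by the numbers \<open>b ^ n, \<dots>, (b - 1) b ^ n\<close> produces vectors with positive entries. Their weights
  pay for the frequency zero in such coordinates.
\<close>

definition lifts :: "nat \<Rightarrow> nat \<Rightarrow> nat \<Rightarrow> nat set" where
  "lifts b n k = (if k = 0 then (\<lambda>c. c * b ^ n) ` {1..<b} else {k})"

definition lift_weight :: "nat \<Rightarrow> nat \<Rightarrow> nat \<Rightarrow> nat \<Rightarrow> real" where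
  "lift_weight b \<alpha> n k = (\<Sum>l\<in>lifts b n k. 1 / real b ^ mu b \<alpha> l)"

lemma finite_lifts [simp]: "finite (lifts b n k)"
  by (simp add: lifts_def)

lemma lift_weight_nonneg: "0 \<le> lift_weight b \<alpha> n k"
  unfolding lift_weight_def by (intro sum_nonneg) auto

lemma lift_mod: "l \<in> lifts b n k \<Longrightarrow> k < b ^ n \<Longrightarrow> l mod b ^ n = k"
  by (auto simp: lifts_def split: if_splits)

lemma lift_pos: "b \<ge> 2 \<Longrightarrow> l \<in> lifts b n k \<Longrightarrow> l \<ge> 1"
  by (auto simp: lifts_def split: if_splits)

lemma lift_weight_pos:
  assumes "b \<ge> 2" "0 < k" "k < b ^ n"
  shows "lift_weight b \<alpha> n k = 1 / real b ^ topsum b (dig b k) n \<alpha>"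
  using assms by (simp add: lift_weight_def lifts_def mu_eq_topsum)

lemma lift_weight_0:
  assumes b: "b \<ge> 2" and "\<alpha> \<ge> 1"
  shows "lift_weight b \<alpha> n 0 \<ge> 1 / (2 * real b ^ n)"
proof -
  have "lift_weight b \<alpha> n 0 = (\<Sum>c\<in>{1..<b}. 1 / real b ^ mu b \<alpha> (c * b ^ n))"
    unfolding lift_weight_def lifts_def using b by (simp, subst sum.reindex) (auto simp: inj_on_def)
  also have "\<dots> = (\<Sum>c\<in>{1..<b}. 1 / real b ^ Suc n)"
    using assms by (intro sum.cong refl) (subst mu_digit_times_power, auto)
  also have "\<dots> = (real b - 1) / (real b * real b ^ n)"
    using b by (simp add: of_nat_diff)
  also have "\<dots> \<ge> 1 / (2 * real b ^ n)"
    using b by (simp add: divide_simps)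
  finally show ?thesis .
qed

lemma tr_poly_mod:
  "tr_poly n (l mod CARD('b) ^ n) = (tr_poly n l :: 'b::prime_card mod_ring poly)"
proof -
  have "(l mod CARD('b) ^ n) div CARD('b) ^ i mod CARD('b) = l div CARD('b) ^ i mod CARD('b)" if i: "i < n" for i
  proof -
    let ?b = "CARD('b)"
    obtain d where d: "n = i + Suc d" using less_imp_Suc_add[OF i] by auto
    have "(l mod ?b ^ n) div ?b ^ i = (l div ?b ^ i) mod ?b ^ Suc d"
      unfolding d power_add by (simp add: mod_mult2_eq)
    then show ?thesis by (simp add: mod_mult2_eq)
  qed
  then show ?thesis unfolding tr_poly_def by (intro sum.cong refl) simp
qed

definition short_dual ::
    "nat \<Rightarrow> 'b::prime_card mod_ring poly \<Rightarrow> (nat \<Rightarrow> 'b mod_ring poly) \<Rightarrow> nat set \<Rightarrow> (nat \<Rightarrow> nat) set" where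
  "short_dual n p Q u =
     {k \<in> u \<rightarrow>\<^sub>E {..<CARD('b) ^ n}. p dvd (\<Sum>j\<in>u. tr_poly n (k j) * Q j) \<and> (\<exists>j\<in>u. k j \<noteq> 0)}"

lemma finite_short_dual: "finite u \<Longrightarrow> finite (short_dual n p Q u)"
  unfolding short_dual_def by (rule finite_subset[OF _ finite_PiE[of u "\<lambda>_. {..<CARD('b) ^ n}"]]) auto

text \<open>
  Reduction modulo \<open>b ^ n\<close> recovers the short vector from any of its lifts. So the lifts of different
  vectors are different, and they form a part of the index set on the right.
\<close>

lemma sum_lift_weights_le:
  fixes p :: "'b::prime_card mod_ring poly"
  assumes u: "u \<subseteq> {1..s}"
  shows "ennreal (\<Sum>k\<in>short_dual n p Q u. \<Prod>j\<in>u. lift_weight CARD('b) \<alpha> n (k j)) \<le>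
    (\<Sum>\<^sub>\<infinity>k\<in>{k \<in> dual_lattice_proj s n p Q u. \<exists>j\<in>u. \<not> CARD('b) ^ n dvd k j}.
       ennreal (1 / real CARD('b) ^ (\<Sum>j\<in>u. mu CARD('b) \<alpha> (k j))))"
proof -
  define b where "b = CARD('b)"
  have b: "b \<ge> 2" unfolding b_def by (rule card_prime_card_ge_2)
  have fin: "finite u" using u finite_subset by blast
  define K where "K = short_dual n p Q u"
  define F where "F k = (\<Pi>\<^sub>E j\<in>u. lifts b n (k j))" for k
  define wt where "wt l = 1 / real b ^ (\<Sum>j\<in>u. mu b \<alpha> (l j))" for l :: "nat \<Rightarrow> nat"
  define S where "S = {k \<in> dual_lattice_proj s n p Q u. \<exists>j\<in>u. \<not> b ^ n dvd k j}"
  have K: "k j < b ^ n" if "k \<in> K" "j \<in> u" for k j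
    using that by (auto simp: K_def short_dual_def b_def dest!: PiE_mem)
  have ext: "k \<in> extensional u" if "k \<in> K" for k
    using that by (auto simp: K_def short_dual_def PiE_def)
  have prod: "(\<Prod>j\<in>u. lift_weight b \<alpha> n (k j)) = sum wt (F k)" for k
  proof -
    have "(\<Prod>j\<in>u. lift_weight b \<alpha> n (k j)) = (\<Sum>l\<in>F k. \<Prod>j\<in>u. 1 / real b ^ mu b \<alpha> (l j))"
      unfolding lift_weight_def F_def by (rule prod_sum_PiE) (use fin in auto)
    also have "\<dots> = sum wt (F k)"
      by (simp add: wt_def power_sum prod_dividef)
    finally show ?thesis .
  qed
  have mod: "l j mod b ^ n = k j" if "l \<in> F k" "k \<in> K" "j \<in> u" for l k j
    using that K by (intro lift_mod) (auto simp: F_def dest: PiE_mem)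
  have disj: "F k \<inter> F k' = {}" if "k \<in> K" "k' \<in> K" "k \<noteq> k'" for k k'
  proof (rule ccontr)
    assume "F k \<inter> F k' \<noteq> {}"
    then obtain l where l: "l \<in> F k" "l \<in> F k'" by blast
    have "k = k'"
      by (rule extensionalityI[OF ext ext]) (use that l mod in \<open>metis+\<close>)
    then show False using that by simp
  qed
  have finF: "finite (F k)" for k unfolding F_def using fin by (intro finite_PiE) auto
  have sub: "(\<Union>k\<in>K. F k) \<subseteq> S"
  proof
    fix l assume "l \<in> (\<Union>k\<in>K. F k)"
    then obtain k where k: "k \<in> K" "l \<in> F k" by blast
    have pos: "l \<in> u \<rightarrow>\<^sub>E {1..}"
    proof (rule PiE_I)
      show "l j \<in> {1..}" if "j \<in> u" for j
        using lift_pos[OF b, of "l j" n "k j"] PiE_mem[OF k(2)[unfolded F_def] that] by simp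
      show "l j = undefined" if "j \<notin> u" for j
        using PiE_arb[OF k(2)[unfolded F_def] that] .
    qed
    have "(\<Sum>j=1..s. tr_poly n ((\<lambda>j\<in>{1..s}. if j \<in> u then l j else 0) j) * Q j) = (\<Sum>j=1..s. if j \<in> u then tr_poly n (l j) * Q j else 0)"
      by (intro sum.cong refl) (auto simp: tr_poly_def)
    also have "\<dots> = (\<Sum>j\<in>u. tr_poly n (l j) * Q j)"
      using u by (simp add: sum.If_cases Int_absorb1)
    also have "\<dots> = (\<Sum>j\<in>u. tr_poly n (k j) * Q j)"
    proof (rule sum.cong[OF refl])
      fix j assume "j \<in> u"
      then have "tr_poly n (l j) = (tr_poly n (k j) :: 'b mod_ring poly)"
        using mod[OF k(2,1)] tr_poly_mod[of n "l j", where 'b = 'b] by (simp add: b_def)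
      then show "tr_poly n (l j) * Q j = tr_poly n (k j) * Q j" by simp
    qed
    finally have "(\<lambda>j\<in>{1..s}. if j \<in> u then l j else 0) \<in> dual_lattice s n p Q"
      using k(1) by (auto simp: dual_lattice_def K_def short_dual_def)
    moreover obtain j where "j \<in> u" "k j \<noteq> 0"
      using k(1) by (auto simp: K_def short_dual_def)
    then have "\<exists>j\<in>u. \<not> b ^ n dvd l j"
      using mod[OF k(2,1)] by (intro bexI[of _ j]) (simp_all add: dvd_eq_mod_eq_0)
    ultimately show "l \<in> S" using pos by (auto simp: S_def dual_lattice_proj_def)
  qed
  have "ennreal (\<Sum>k\<in>K. \<Prod>j\<in>u. lift_weight b \<alpha> n (k j)) = ennreal (sum wt (\<Union>k\<in>K. F k))"
  proof -
    have "finite K" unfolding K_def using fin by (rule finite_short_dual)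
    moreover have "\<forall>k\<in>K. finite (F k)" using finF by blast
    moreover have "\<forall>k\<in>K. \<forall>k'\<in>K. k \<noteq> k' \<longrightarrow> F k \<inter> F k' = {}" using disj by blast
    ultimately have "sum wt (\<Union>k\<in>K. F k) = (\<Sum>k\<in>K. sum wt (F k))"
      by (rule sum.UNION_disjoint)
    then show ?thesis by (simp only: prod)
  qed
  also have "\<dots> = (\<Sum>l\<in>(\<Union>k\<in>K. F k). ennreal (wt l))"
    by (rule sum_ennreal[symmetric]) (simp add: wt_def)
  also have "\<dots> \<le> (\<Sum>\<^sub>\<infinity>l\<in>S. ennreal (wt l))"
    unfolding nonneg_infsum_complete[OF zero_le]
  proof (rule SUP_upper)
    have "finite (\<Union>k\<in>K. F k)"
      unfolding K_def using fin finF by (intro finite_UN_I finite_short_dual) auto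
    then show "(\<Union>k\<in>K. F k) \<in> {F. finite F \<and> F \<subseteq> S}" using sub by blast
  qed
  finally show ?thesis by (simp only: K_def S_def wt_def b_def)
qed

section \<open>The kernels of the Bernoulli representation\<close>

text \<open>
  The index \<open>0\<close> stands for the mean, the indices \<open>1, \<dots>, \<alpha>\<close> stand for the Bernoulli polynomials, and
  \<open>\<alpha> + 1\<close> stands for the remainder.
\<close>

definition rep_kernel :: "nat \<Rightarrow> nat \<Rightarrow> real \<Rightarrow> real \<Rightarrow> real" where
  "rep_kernel \<alpha> c x y =
     (if c = 0 then 1 else if c \<le> \<alpha> then bern c y else (-1) ^ (\<alpha> + 1) * bern_per \<alpha> (x - y))"

abbreviation kernel_indices :: "nat \<Rightarrow> nat set \<Rightarrow> (nat \<Rightarrow> nat) set" where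
  "kernel_indices \<alpha> u \<equiv> u \<rightarrow>\<^sub>E {1..\<alpha> + 1}"

abbreviation kernel_prod ::
    "nat \<Rightarrow> nat set \<Rightarrow> (nat \<Rightarrow> nat) \<Rightarrow> (nat \<Rightarrow> real) \<Rightarrow> (nat \<Rightarrow> real) \<Rightarrow> real" where
  "kernel_prod \<alpha> u c x y \<equiv> \<Prod>j\<in>u. rep_kernel \<alpha> (c j) (x j) (y j)"

definition grid_kernel :: "nat \<Rightarrow> nat \<Rightarrow> nat \<Rightarrow> real \<Rightarrow> real" where
  "grid_kernel N \<alpha> c x = (\<Sum>h<N. rep_kernel \<alpha> c x (real h / real N)) / real N"

text \<open>
  A bound for the Walsh coefficient of the kernel \<open>c\<close> at the frequency \<open>k\<close>. The Bernoulli
  polynomials are taken at the grid itself, where frequencies with more nonzero digits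
  than the degree do not occur. The remainder kernel is needed at all translates, where only the decay bound is available.
\<close>

definition kernel_weight :: "nat \<Rightarrow> nat \<Rightarrow> nat \<Rightarrow> nat \<Rightarrow> nat \<Rightarrow> real" where
  "kernel_weight b \<alpha> n c k =
     (if c \<le> \<alpha> then norm (DW b (dig b k) n (bern_perc c) 0)
      else if k = 0 then 1 / 2 ^ \<alpha> / real b ^ (n * \<alpha>)
      else decay b \<alpha> (min (nact b (dig b k) n) \<alpha>) / (2 * sin (pi / real b)) ^ min (nact b (dig b k) n) \<alpha>
             / real b ^ topsum b (dig b k) n \<alpha>)"

lemma rep_kernel_remainder:
  assumes "\<alpha> \<ge> 2"
  shows "rep_kernel \<alpha> (Suc \<alpha>) x y = - bern_per \<alpha> (y - x)"
  using bern_per_reflect[OF assms, of "y - x"] assms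
  by (simp add: rep_kernel_def mult.assoc[symmetric] power_add[symmetric] power_mult_distrib[symmetric])

text \<open>
  By the reflection formula the remainder kernel is, up to sign, a translate of a periodic Bernoulli
  function, and the decay bound is uniform in translates.
\<close>

lemma norm_DW_rep_kernel_le:
  assumes b: "b \<ge> 2" and \<alpha>: "\<alpha> \<ge> 2" and c: "c \<in> {1..\<alpha> + 1}" and k: "k < b ^ n"
  shows "norm (DW b (dig b k) n (\<lambda>y. complex_of_real (rep_kernel \<alpha> c x y)) 0) \<le> kernel_weight b \<alpha> n c k"
proof (cases "c \<le> \<alpha>")
  case True
  have "DW b (dig b k) n (\<lambda>y. complex_of_real (rep_kernel \<alpha> c x y)) 0 = DW b (dig b k) n (bern_perc c) 0"
    using b c True by (intro DW_cong_grid) (auto simp: rep_kernel_def bern_per_eq_bern)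
  then show ?thesis using True by (simp add: kernel_weight_def)
next
  case False
  then have c: "c = Suc \<alpha>" using c by simp
  have "DW b (dig b k) n (\<lambda>y. complex_of_real (rep_kernel \<alpha> c x y)) 0 =
      DW b (dig b k) n (\<lambda>y. (- 1) * bern_perc \<alpha> (y + - x)) 0"
    unfolding c rep_kernel_remainder[OF \<alpha>] by simp
  also have "\<dots> = - DW b (dig b k) n (bern_perc \<alpha>) (- x)"
    unfolding DW_cmult DW_shift[of b "dig b k" n "bern_perc \<alpha>" "- x" 0] by simp
  finally have eq: "norm (DW b (dig b k) n (\<lambda>y. complex_of_real (rep_kernel \<alpha> c x y)) 0) =
      norm (DW b (dig b k) n (bern_perc \<alpha>) (- x))"
    by simp
  show ?thesis
  proof (cases "k = 0")
    case True
    have "norm (DW b (dig b k) n (bern_perc \<alpha>) (- x)) = \<bar>bern_per \<alpha> (real b ^ n * - x)\<bar> / real b ^ (n * \<alpha>)"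
      using b True by (subst DW_trivial_bern_per) (auto simp del: of_real_divide)
    also have "\<dots> \<le> 1 / 2 ^ \<alpha> / real b ^ (n * \<alpha>)"
      using \<alpha> by (intro divide_right_mono abs_bern_per_le) auto
    finally show ?thesis unfolding eq using True by (simp add: kernel_weight_def c)
  next
    case False
    show ?thesis
      unfolding eq using norm_DW_bern_per_le[OF b, of \<alpha> "dig b k" n "- x"] \<alpha> False
      by (simp add: kernel_weight_def c)
  qed
qed

lemma sum_kernel_weight_le:
  assumes b: "b \<ge> 2" and \<alpha>: "\<alpha> \<ge> 2" and k: "k < b ^ n"
  shows "(\<Sum>c=1..\<alpha> + 1. kernel_weight b \<alpha> n c k) \<le> C_const b \<alpha> * lift_weight b \<alpha> n k"
proof -
  have split: "(\<Sum>c=1..\<alpha> + 1. kernel_weight b \<alpha> n c k) =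
      (\<Sum>c=1..\<alpha>. norm (DW b (dig b k) n (bern_perc c) 0)) + kernel_weight b \<alpha> n (Suc \<alpha>) k"
    by (simp add: kernel_weight_def)
  show ?thesis
  proof (cases "k = 0")
    case True
    have "norm (DW b (dig b k) n (bern_perc c) 0) \<le> 1 / 2 ^ c / real b ^ (n * c)" if "c \<ge> 1" for c
    proof -
      have "norm (DW b (dig b k) n (bern_perc c) 0) = \<bar>bern_per c 0\<bar> / real b ^ (n * c)"
        using b True by (subst DW_trivial_bern_per) (auto simp del: of_real_divide)
      also have "\<dots> \<le> 1 / 2 ^ c / real b ^ (n * c)"
        using that by (intro divide_right_mono abs_bern_per_le) auto
      finally show ?thesis .
    qed
    then have "(\<Sum>c=1..\<alpha> + 1. kernel_weight b \<alpha> n c k) \<le>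
        (\<Sum>c=1..\<alpha>. 1 / 2 ^ c / real b ^ (n * c)) + 1 / 2 ^ \<alpha> / real b ^ (n * \<alpha>)"
      unfolding split using True by (intro add_mono sum_mono) (auto simp: kernel_weight_def)
    also have "\<dots> \<le> 1 / real b ^ n"
      using b \<alpha> by (intro sum_trivial_bern_per_le) auto
    also have "\<dots> = 2 * (1 / (2 * real b ^ n))" by simp
    also have "\<dots> \<le> C_const b \<alpha> * lift_weight b \<alpha> n 0"
      using C_const_ge_2[OF b \<alpha>] lift_weight_0[OF b, of \<alpha> n] \<alpha> by (intro mult_mono) auto
    finally show ?thesis using True by simp
  next
    case False
    then show ?thesis
      unfolding split using sum_norm_DW_bern_per_le[OF b \<alpha> nact_dig_ge_1[OF b _ k]] lift_weight_pos[OF b _ k]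
      by (simp add: kernel_weight_def)
  qed
qed

text \<open>
  The multiplication theorem, read as a formula for the average over the grid.
\<close>

lemma grid_kernel_eq:
  assumes "N > 0" and "\<alpha> \<ge> 2" and "c \<le> \<alpha> + 1"
  shows "grid_kernel N \<alpha> c x =
    (if c = 0 then 1 else if c \<le> \<alpha> then bern c 0 / real N ^ c else - bern_per \<alpha> (- real N * x) / real N ^ \<alpha>)"
proof -
  consider "c = 0" | "1 \<le> c" "c \<le> \<alpha>" | "c = Suc \<alpha>" using assms by linarith
  then show ?thesis
  proof cases
    case 1
    then show ?thesis using assms by (simp add: grid_kernel_def rep_kernel_def)
  next
    case 2
    then have "(\<Sum>h<N. rep_kernel \<alpha> c x (real h / real N)) = (\<Sum>h<N. bern c ((0 + real h) / real N))"
      by (simp add: rep_kernel_def)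
    also have "\<dots> = real N / real N ^ c * bern c 0"
      using assms(1) by (rule bern_multiplication)
    finally show ?thesis
      using 2 assms by (simp add: grid_kernel_def)
  next
    case 3
    have "(\<Sum>h<N. rep_kernel \<alpha> c x (real h / real N)) = - (\<Sum>h<N. bern_per \<alpha> (- x + real h / real N))"
      unfolding 3 rep_kernel_remainder[OF assms(2)] sum_negf by simp
    also have "(\<Sum>h<N. bern_per \<alpha> (- x + real h / real N)) = real N / real N ^ \<alpha> * bern_per \<alpha> (real N * - x)"
      using assms(1) by (rule bern_per_multiplication)
    finally show ?thesis
      using 3 assms by (simp add: grid_kernel_def)
  qed
qed

text \<open>
  In the average over the lattice the frequency zero contributes the average over the full grid.
  The error against the latter is bounded by the frequencies in the dual lattice.
\<close>

lemma lattice_minus_grid_le: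
  fixes p :: "'b::prime_card mod_ring poly"
  assumes p: "p \<noteq> 0" and n: "Polynomial.degree p = n" and u: "u \<subseteq> {1..s}" and \<alpha>: "\<alpha> \<ge> 2"
    and c: "\<And>j. j \<in> u \<Longrightarrow> c j \<in> {1..\<alpha> + 1}"
  shows "\<bar>(\<Sum>h<CARD('b) ^ n. kernel_prod \<alpha> u c x (poly_lattice_point s n p Q h)) / real (CARD('b) ^ n)
      - (\<Prod>j\<in>u. grid_kernel (CARD('b) ^ n) \<alpha> (c j) (x j))\<bar>
    \<le> (\<Sum>k\<in>short_dual n p Q u. \<Prod>j\<in>u. kernel_weight CARD('b) \<alpha> n (c j) (k j))"
proof -
  define b where "b = CARD('b)"
  have b: "b \<ge> 2" unfolding b_def by (rule card_prime_card_ge_2)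
  have fin: "finite u" using u finite_subset by blast
  define g where "g j y = complex_of_real (rep_kernel \<alpha> (c j) (x j) y)" for j y
  define K where "K = {k \<in> u \<rightarrow>\<^sub>E {..<b ^ n}. p dvd (\<Sum>j\<in>u. tr_poly n (k j) * Q j)}"
  define z where "z = (\<lambda>j\<in>u. 0::nat)"
  have finK: "finite K"
    unfolding K_def by (rule finite_subset[OF _ finite_PiE[of u "\<lambda>_. {..<b ^ n}"]]) (use fin in auto)
  have tr0: "tr_poly n 0 = (0 :: 'b mod_ring poly)" by (simp add: tr_poly_def)
  have "z \<in> K" using b by (auto simp: K_def z_def tr0)
  moreover have "K - {z} = short_dual n p Q u"
  proof -
    have "k = z \<longleftrightarrow> (\<forall>j\<in>u. k j = 0)" if "k \<in> u \<rightarrow>\<^sub>E {..<b ^ n}" for k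
      using that by (auto simp: z_def PiE_iff extensional_def fun_eq_iff restrict_def)
    then show ?thesis by (auto simp: K_def short_dual_def b_def z_def)
  qed
  ultimately have split: "(\<Sum>k\<in>K. f k) = f z + (\<Sum>k\<in>short_dual n p Q u. f k)" for f :: "_ \<Rightarrow> complex"
    using finK by (metis sum.remove)
  have grid: "DW b (dig b 0) n (g j) 0 = complex_of_real (grid_kernel (b ^ n) \<alpha> (c j) (x j))" for j
  proof -
    have "wgt b (dig b 0) n h = 1" for h by (rule DW_trivial_frequencies) (use b in auto)
    then show ?thesis by (simp add: DW_def grid_kernel_def g_def)
  qed
  have "complex_of_real ((\<Sum>h<b ^ n. kernel_prod \<alpha> u c x (poly_lattice_point s n p Q h)) / real (b ^ n)
      - (\<Prod>j\<in>u. grid_kernel (b ^ n) \<alpha> (c j) (x j))) =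
    (\<Sum>h<b ^ n. \<Prod>j\<in>u. g j (poly_lattice_point s n p Q h j)) / of_nat (b ^ n)
      - (\<Prod>j\<in>u. DW b (dig b 0) n (g j) 0)"
    unfolding grid by (simp add: g_def)
  also have "\<dots> = (\<Sum>k\<in>K. \<Prod>j\<in>u. DW b (dig b (k j)) n (g j) 0) - (\<Prod>j\<in>u. DW b (dig b 0) n (g j) 0)"
    unfolding K_def b_def lattice_average_prod[OF p n u] ..
  also have "\<dots> = (\<Sum>k\<in>short_dual n p Q u. \<Prod>j\<in>u. DW b (dig b (k j)) n (g j) 0)"
    unfolding split by (simp add: z_def)
  finally have "\<bar>(\<Sum>h<b ^ n. kernel_prod \<alpha> u c x (poly_lattice_point s n p Q h)) / real (b ^ n)
      - (\<Prod>j\<in>u. grid_kernel (b ^ n) \<alpha> (c j) (x j))\<bar> =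
      norm (\<Sum>k\<in>short_dual n p Q u. \<Prod>j\<in>u. DW b (dig b (k j)) n (g j) 0)"
    by (simp only: norm_of_real[where 'a = complex, symmetric])
  also have "\<dots> \<le> (\<Sum>k\<in>short_dual n p Q u. \<Prod>j\<in>u. kernel_weight b \<alpha> n (c j) (k j))"
  proof (rule sum_norm_le)
    fix k assume "k \<in> short_dual n p Q u"
    then have k: "k j < b ^ n" if "j \<in> u" for j
      using that by (auto simp: short_dual_def b_def dest!: PiE_mem)
    show "norm (\<Prod>j\<in>u. DW b (dig b (k j)) n (g j) 0) \<le> (\<Prod>j\<in>u. kernel_weight b \<alpha> n (c j) (k j))"
      unfolding prod_norm[symmetric] g_def
      by (intro prod_mono conjI norm_ge_zero norm_DW_rep_kernel_le[OF b \<alpha> c] k)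
  qed
  finally show ?thesis by (simp only: b_def)
qed

lemma kernel_weight_nonneg: "b \<ge> 2 \<Longrightarrow> 0 \<le> kernel_weight b \<alpha> n c k"
  using two_sin_pi_div[of b] by (auto simp: kernel_weight_def intro!: divide_nonneg_nonneg decay_nonneg)

lemma sum_kernel_weights_le:
  fixes p :: "'b::prime_card mod_ring poly"
  assumes u: "u \<subseteq> {1..s}" and \<alpha>: "\<alpha> \<ge> 2"
  shows "(\<Sum>c\<in>kernel_indices \<alpha> u. \<Sum>k\<in>short_dual n p Q u. \<Prod>j\<in>u. kernel_weight CARD('b) \<alpha> n (c j) (k j))
    \<le> C_const CARD('b) \<alpha> ^ card u *
      (\<Sum>k\<in>short_dual n p Q u. \<Prod>j\<in>u. lift_weight CARD('b) \<alpha> n (k j))"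
proof -
  define b where "b = CARD('b)"
  have b: "b \<ge> 2" unfolding b_def by (rule card_prime_card_ge_2)
  have fin: "finite u" using u finite_subset by blast
  have "(\<Sum>c\<in>kernel_indices \<alpha> u. \<Sum>k\<in>short_dual n p Q u. \<Prod>j\<in>u. kernel_weight b \<alpha> n (c j) (k j)) =
      (\<Sum>k\<in>short_dual n p Q u. \<Prod>j\<in>u. \<Sum>c=1..\<alpha> + 1. kernel_weight b \<alpha> n c (k j))"
    by (subst sum.swap, rule sum.cong[OF refl],
        rule prod_sum_PiE[of u "\<lambda>_. {1..\<alpha> + 1}", symmetric]) (use fin in auto)
  also have "\<dots> \<le> (\<Sum>k\<in>short_dual n p Q u. \<Prod>j\<in>u. C_const b \<alpha> * lift_weight b \<alpha> n (k j))"
  proof (intro sum_mono prod_mono conjI)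
    fix k j assume "k \<in> short_dual n p Q u" "j \<in> u"
    then have "k j < b ^ n" by (auto simp: short_dual_def b_def dest!: PiE_mem)
    then show "(\<Sum>c=1..\<alpha> + 1. kernel_weight b \<alpha> n c (k j)) \<le> C_const b \<alpha> * lift_weight b \<alpha> n (k j)"
      by (rule sum_kernel_weight_le[OF b \<alpha>])
  qed (intro sum_nonneg kernel_weight_nonneg b)
  also have "\<dots> = C_const b \<alpha> ^ card u * (\<Sum>k\<in>short_dual n p Q u. \<Prod>j\<in>u. lift_weight b \<alpha> n (k j))"
    by (simp add: prod.distrib sum_distrib_left)
  finally show ?thesis by (simp only: b_def)
qed

section \<open>Extrapolation coefficients\<close>

text \<open>
  As in the Richardson scheme, the generating polynomial of the coefficients of order \<open>\<tau> + 1\<close>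
  arises from that of order \<open>\<tau>\<close> by a linear factor with root \<open>b ^ \<tau>\<close>.
\<close>

lemma extrap_generating_polynomial:
  fixes x :: real
  assumes b: "b \<ge> 2"
  shows "(\<Sum>i\<le>T. extrap_coeff b (Suc T) (Suc i) * x ^ i) = (\<Prod>i=1..T. (real b ^ i - x) / (real b ^ i - 1))"
proof (induction T)
  case 0
  show ?case by (simp add: extrap_coeff_def)
next
  case (Suc T)
  define P where "P i = (\<Prod>j=1..i. - 1 / (real b ^ j - 1))" for i
  define E where "E k = (\<Prod>j=1..k. real b ^ j / (real b ^ j - 1))" for k
  have nz: "real b ^ Suc j - 1 > 0" for j
    using b one_less_power[of "real b" "Suc j"] by simp
  have coeff: "extrap_coeff b (Suc T) (Suc i) = P i * E (T - i)" for T i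
    by (simp add: extrap_coeff_def P_def E_def)
  have P_Suc: "P (Suc i) * (real b ^ Suc i - 1) = - P i" for i
    using nz[of i] by (simp add: P_def)
  have E_Suc: "E (Suc k) * (real b ^ Suc k - 1) = E k * real b ^ Suc k" for k
    using nz[of k] by (simp add: E_def)
  define S where "S = (\<Sum>i\<le>T. P i * E (T - i) * x ^ i)"
  \<comment> \<open>\<open>b ^ (T + 1) - 1 = b ^ i (b ^ (T + 1 - i) - 1) + (b ^ i - 1)\<close> splits off the recursions of \<open>E\<close> and \<open>P\<close>\<close>
  have "(\<Sum>i\<le>Suc T. P i * E (Suc T - i) * x ^ i) * (real b ^ Suc T - 1) =
      (\<Sum>i\<le>Suc T. P i * (E (Suc T - i) * (real b ^ (Suc T - i) - 1)) * real b ^ i * x ^ i) +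
      (\<Sum>i\<le>Suc T. P i * (real b ^ i - 1) * E (Suc T - i) * x ^ i)"
    unfolding sum_distrib_right sum.distrib[symmetric]
  proof (rule sum.cong[OF refl])
    fix i assume "i \<in> {..Suc T}"
    then have pw: "real b ^ Suc T = real b ^ (Suc T - i) * real b ^ i"
      by (simp add: power_add[symmetric])
    show "P i * E (Suc T - i) * x ^ i * (real b ^ Suc T - 1) =
        P i * (E (Suc T - i) * (real b ^ (Suc T - i) - 1)) * real b ^ i * x ^ i +
        P i * (real b ^ i - 1) * E (Suc T - i) * x ^ i"
      unfolding pw by (simp add: algebra_simps)
  qed
  also have "(\<Sum>i\<le>Suc T. P i * (E (Suc T - i) * (real b ^ (Suc T - i) - 1)) * real b ^ i * x ^ i) =
      (\<Sum>i\<le>T. real b ^ Suc T * (P i * E (T - i) * x ^ i))"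
  proof -
    have "P i * (E (Suc T - i) * (real b ^ (Suc T - i) - 1)) * real b ^ i * x ^ i =
        real b ^ Suc T * (P i * E (T - i) * x ^ i)" if "i \<le> T" for i
    proof -
      have pw: "real b ^ Suc (T - i) * real b ^ i = real b ^ Suc T"
        using that by (simp add: power_add[symmetric])
      have "P i * (E (Suc T - i) * (real b ^ (Suc T - i) - 1)) * real b ^ i * x ^ i =
          P i * (E (T - i) * real b ^ Suc (T - i)) * real b ^ i * x ^ i"
        by (simp only: Suc_diff_le[OF that] E_Suc)
      also have "\<dots> = (real b ^ Suc (T - i) * real b ^ i) * (P i * E (T - i) * x ^ i)"
        by (simp only: mult_ac)
      finally show ?thesis by (simp only: pw)
    qed
    then have "(\<Sum>i\<le>T. P i * (E (Suc T - i) * (real b ^ (Suc T - i) - 1)) * real b ^ i * x ^ i) =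
        (\<Sum>i\<le>T. real b ^ Suc T * (P i * E (T - i) * x ^ i))"
      by (intro sum.cong refl) simp
    then show ?thesis by (simp only: sum.atMost_Suc) simp
  qed
  also have "\<dots> = real b ^ Suc T * S"
    by (simp only: S_def sum_distrib_left)
  also have "(\<Sum>i\<le>Suc T. P i * (real b ^ i - 1) * E (Suc T - i) * x ^ i) = - x * S"
  proof -
    have "(\<Sum>i\<le>Suc T. P i * (real b ^ i - 1) * E (Suc T - i) * x ^ i) =
        (\<Sum>i\<le>T. P (Suc i) * (real b ^ Suc i - 1) * E (T - i) * x ^ Suc i)"
      by (subst sum.atMost_Suc_shift) simp
    also have "\<dots> = (\<Sum>i\<le>T. - x * (P i * E (T - i) * x ^ i))"
      unfolding P_Suc by (simp add: mult_ac)
    finally show ?thesis by (simp only: S_def sum_distrib_left)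
  qed
  finally have "(\<Sum>i\<le>Suc T. P i * E (Suc T - i) * x ^ i) * (real b ^ Suc T - 1) = S * (real b ^ Suc T - x)"
    by (simp add: algebra_simps)
  then have "(\<Sum>i\<le>Suc T. P i * E (Suc T - i) * x ^ i) = S * (real b ^ Suc T - x) / (real b ^ Suc T - 1)"
    using nz[of T] by (simp only: eq_divide_eq) simp
  then show ?case using Suc.IH by (simp add: coeff S_def)
qed

lemma sum_extrap_coeff:
  assumes "b \<ge> 2" "\<alpha> \<ge> 1"
  shows "(\<Sum>\<tau>=1..\<alpha>. extrap_coeff b \<alpha> \<tau> * x ^ (\<tau> - 1)) = (\<Prod>i=1..\<alpha>-1. (real b ^ i - x) / (real b ^ i - 1))"
proof -
  obtain T where T: "\<alpha> = Suc T" using assms(2) by (cases \<alpha>) auto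
  have "(\<Sum>\<tau>=1..\<alpha>. extrap_coeff b \<alpha> \<tau> * x ^ (\<tau> - 1)) = (\<Sum>i\<le>T. extrap_coeff b \<alpha> (Suc i) * x ^ i)"
    by (rule sum.reindex_bij_witness[of _ Suc "\<lambda>\<tau>. \<tau> - 1"]) (auto simp: T)
  then show ?thesis using extrap_generating_polynomial[OF assms(1), of T x] by (simp add: T)
qed

lemma sum_extrap_coeff_eq_1:
  assumes "b \<ge> 2" "\<alpha> \<ge> 1"
  shows "(\<Sum>\<tau>=1..\<alpha>. extrap_coeff b \<alpha> \<tau>) = 1"
proof -
  have "real b ^ i - 1 \<noteq> 0" if "i \<ge> 1" for i
  proof -
    have "1 < real b ^ i" using assms(1) that by (intro one_less_power) auto
    then show ?thesis by simp
  qed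
  then have "(\<Prod>i=1..\<alpha>-1. (real b ^ i - 1) / (real b ^ i - 1)) = 1"
    by (intro prod.neutral) auto
  then show ?thesis using sum_extrap_coeff[OF assms, of 1] by simp
qed

lemma sum_extrap_coeff_eq_0:
  assumes b: "b \<ge> 2" and i: "1 \<le> i" "i < \<alpha>" and "\<alpha> \<le> m"
  shows "(\<Sum>\<tau>=1..\<alpha>. extrap_coeff b \<alpha> \<tau> / real b ^ ((m - \<tau> + 1) * i)) = 0"
proof -
  have "(\<Sum>\<tau>=1..\<alpha>. extrap_coeff b \<alpha> \<tau> / real b ^ ((m - \<tau> + 1) * i)) =
      (\<Sum>\<tau>=1..\<alpha>. extrap_coeff b \<alpha> \<tau> * (real b ^ i) ^ (\<tau> - 1)) / real b ^ (m * i)"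
    unfolding sum_divide_distrib
  proof (rule sum.cong[OF refl])
    fix \<tau> assume \<tau>: "\<tau> \<in> {1..\<alpha>}"
    then have "m = (m - \<tau> + 1) + (\<tau> - 1)"
      using assms(4) by auto
    then have "m * i = (m - \<tau> + 1) * i + i * (\<tau> - 1)"
      by (metis distrib_right mult.commute)
    then show "extrap_coeff b \<alpha> \<tau> / real b ^ ((m - \<tau> + 1) * i) =
        extrap_coeff b \<alpha> \<tau> * (real b ^ i) ^ (\<tau> - 1) / real b ^ (m * i)"
      using b by (simp add: power_add power_mult)
  qed
  also have "(\<Sum>\<tau>=1..\<alpha>. extrap_coeff b \<alpha> \<tau> * (real b ^ i) ^ (\<tau> - 1)) = 0"
    using b i by (subst sum_extrap_coeff) (auto intro!: prod_zero bexI[of _ i])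
  finally show ?thesis by simp
qed

lemma D_const_ge:
  shows abs_bern_per_le_D_const: "\<alpha> \<ge> 1 \<Longrightarrow> \<bar>bern_per \<alpha> x\<bar> \<le> D_const \<alpha>"
    and abs_bern_le_D_const: "1 \<le> c \<Longrightarrow> c \<le> \<alpha> \<Longrightarrow> \<bar>bern c 0\<bar> \<le> D_const \<alpha>"
proof -
  have per: "\<bar>bern_per \<alpha> x\<bar> \<le> D_const \<alpha>" if "\<alpha> \<ge> 1" for x
  proof -
    have "bern_per \<alpha> x = bern_per \<alpha> (frac x)"
      by (simp add: bern_per_def)
    also have "\<bar>\<dots>\<bar> \<le> (SUP x\<in>{0..<1}. \<bar>bern_per \<alpha> x\<bar>)"
      using abs_bern_per_le[OF that]
      by (intro cSUP_upper bdd_aboveI2[of _ _ "1 / 2 ^ \<alpha>"]) (auto simp: frac_lt_1)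
    also have "\<dots> \<le> D_const \<alpha>" by (simp add: D_const_def)
    finally show ?thesis .
  qed
  then show "\<alpha> \<ge> 1 \<Longrightarrow> \<bar>bern_per \<alpha> x\<bar> \<le> D_const \<alpha>" .
  show "\<bar>bern c 0\<bar> \<le> D_const \<alpha>" if "1 \<le> c" "c \<le> \<alpha>"
  proof (cases "c = \<alpha>")
    case True
    then show ?thesis using per[of 0] that by (simp add: bern_per_eq_bern)
  next
    case False
    then show ?thesis using that unfolding D_const_def by (intro Max_ge) auto
  qed
qed

text \<open>
  On the full grid the kernels without remainder yield pure powers of \<open>b ^ - n\<close>. The powers below
  \<open>\<alpha>\<close> are removed by the extrapolation.
\<close>

lemma extrapolated_grid_kernels_le:
  assumes b: "b \<ge> 2" and \<alpha>: "\<alpha> \<ge> 2" "\<alpha> \<le> m" and u: "finite u" "u \<noteq> {}"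
    and c: "\<And>j. j \<in> u \<Longrightarrow> c j \<in> {1..\<alpha> + 1}"
  shows "\<bar>\<Sum>\<tau>=1..\<alpha>. extrap_coeff b \<alpha> \<tau> * (\<Prod>j\<in>u. grid_kernel (b ^ (m - \<tau> + 1)) \<alpha> (c j) (x j))\<bar>
    \<le> (\<Sum>\<tau>=1..\<alpha>. \<bar>extrap_coeff b \<alpha> \<tau>\<bar> * (D_const \<alpha> ^ card u / real b ^ (\<alpha> * (m - \<tau> + 1))))"
proof -
  have b0: "b > 0" using b by simp
  define e where "e = (\<Sum>j\<in>u. min (c j) \<alpha>)"
  have D0: "0 \<le> D_const \<alpha>" using abs_bern_per_le_D_const[of \<alpha> 0] \<alpha> by linarith
  have one: "\<bar>grid_kernel (b ^ n) \<alpha> (c j) (x j)\<bar> \<le> D_const \<alpha> / real b ^ (n * min (c j) \<alpha>)" if "j \<in> u" for j n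
    using c[OF that] \<alpha> b0 abs_bern_per_le_D_const[of \<alpha>] abs_bern_le_D_const[of "c j" \<alpha>]
    by (auto simp: grid_kernel_eq power_mult min_def intro!: divide_right_mono)
  have prod: "\<bar>\<Prod>j\<in>u. grid_kernel (b ^ n) \<alpha> (c j) (x j)\<bar> \<le> D_const \<alpha> ^ card u / real b ^ (n * e)" for n
  proof -
    have "\<bar>\<Prod>j\<in>u. grid_kernel (b ^ n) \<alpha> (c j) (x j)\<bar> \<le> (\<Prod>j\<in>u. D_const \<alpha> / real b ^ (n * min (c j) \<alpha>))"
      unfolding abs_prod by (intro prod_mono conjI one) auto
    also have "\<dots> = D_const \<alpha> ^ card u / real b ^ (n * e)"
      by (simp add: prod_dividef power_sum[symmetric] sum_distrib_left[symmetric] e_def)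
    finally show ?thesis .
  qed
  show ?thesis
  proof (cases "e < \<alpha>")
    case True
    have small: "c j < \<alpha>" if "j \<in> u" for j
    proof -
      have "min (c j) \<alpha> \<le> e" unfolding e_def using u(1) that by (intro member_le_sum) auto
      then show ?thesis using True by simp
    qed
    have "1 \<le> e"
    proof -
      obtain j where "j \<in> u" using u by blast
      then have "min (c j) \<alpha> \<le> e" unfolding e_def using u(1) by (intro member_le_sum) auto
      then show ?thesis using c[OF \<open>j \<in> u\<close>] \<alpha> by auto
    qed
    have "(\<Prod>j\<in>u. grid_kernel (b ^ n) \<alpha> (c j) (x j)) = (\<Prod>j\<in>u. bern (c j) 0) / real b ^ (n * e)" for n
    proof -
      have "grid_kernel (b ^ n) \<alpha> (c j) (x j) = bern (c j) 0 / real b ^ (n * min (c j) \<alpha>)" if "j \<in> u" for j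
        using c[OF that] small[OF that] \<alpha> b0 by (simp add: grid_kernel_eq power_mult min_def)
      then have "(\<Prod>j\<in>u. grid_kernel (b ^ n) \<alpha> (c j) (x j)) = (\<Prod>j\<in>u. bern (c j) 0 / real b ^ (n * min (c j) \<alpha>))"
        by (rule prod.cong[OF refl])
      also have "\<dots> = (\<Prod>j\<in>u. bern (c j) 0) / real b ^ (n * e)"
        by (simp add: prod_dividef power_sum[symmetric] sum_distrib_left[symmetric] e_def)
      finally show ?thesis .
    qed
    then have "(\<Sum>\<tau>=1..\<alpha>. extrap_coeff b \<alpha> \<tau> * (\<Prod>j\<in>u. grid_kernel (b ^ (m - \<tau> + 1)) \<alpha> (c j) (x j))) =
        (\<Prod>j\<in>u. bern (c j) 0) * (\<Sum>\<tau>=1..\<alpha>. extrap_coeff b \<alpha> \<tau> / real b ^ ((m - \<tau> + 1) * e))"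
      unfolding \<open>\<And>n. (\<Prod>j\<in>u. grid_kernel (b ^ n) \<alpha> (c j) (x j)) = (\<Prod>j\<in>u. bern (c j) 0) / real b ^ (n * e)\<close>
        sum_distrib_left by (simp add: mult_ac)
    also have "\<dots> = 0"
      using sum_extrap_coeff_eq_0[OF b \<open>1 \<le> e\<close> True \<alpha>(2)] by simp
    finally show ?thesis
      using D0 by (auto intro!: sum_nonneg mult_nonneg_nonneg divide_nonneg_nonneg)
  next
    case False
    have "\<bar>\<Prod>j\<in>u. grid_kernel (b ^ n) \<alpha> (c j) (x j)\<bar> \<le> D_const \<alpha> ^ card u / real b ^ (\<alpha> * n)" for n
    proof (rule order_trans[OF prod])
      have "\<alpha> * n \<le> n * e" using False by (simp add: mult.commute)
      then show "D_const \<alpha> ^ card u / real b ^ (n * e) \<le> D_const \<alpha> ^ card u / real b ^ (\<alpha> * n)"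
        using b D0 by (intro divide_left_mono power_increasing) auto
    qed
    from mult_left_mono[OF this abs_ge_zero] show ?thesis
      by (intro order_trans[OF sum_abs] sum_mono) (simp only: abs_mult)
  qed
qed

section \<open>Bernoulli expansion in one variable\<close>

definition U01 :: "real measure" where
  "U01 = restrict_space lborel {0..<1}"

lemma cube_eq: "cube J = (\<Pi>\<^sub>M j\<in>J. U01)"
  by (simp add: cube_def U01_def)

lemma space_U01 [simp]: "space U01 = {0..<1}"
  by (simp add: U01_def space_restrict_space)

lemma prob_space_U01: "prob_space U01"
proof
  show "emeasure U01 (space U01) = 1"
    by (simp add: U01_def emeasure_restrict_space space_restrict_space)
qed

lemma product_prob_space_U01: "product_prob_space (\<lambda>_::nat. U01)"
  using prob_space_U01
  by (simp add: product_prob_space_def product_prob_space_axioms_def product_sigma_finite_def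
      prob_space_imp_sigma_finite)

lemma prob_space_cube: "prob_space (cube J)"
  unfolding cube_eq by (rule prob_space_PiM) (rule prob_space_U01)

lemma space_cube: "space (cube J) = J \<rightarrow>\<^sub>E {0..<1}"
  by (simp add: cube_eq space_PiM)

lemma measurable_U01I:
  "f \<in> borel_measurable borel \<Longrightarrow> f \<in> borel_measurable U01"
  unfolding U01_def by (rule measurable_restrict_space1) simp

lemma integral_U01:
  fixes f :: "real \<Rightarrow> real"
  shows "(LINT x|U01. f x) = (LINT x:{0..<1}|lborel. f x)"
  by (simp add: U01_def integral_restrict_space set_lebesgue_integral_def)

lemma integrable_U01_iff:
  fixes f :: "real \<Rightarrow> real"
  shows "integrable U01 f \<longleftrightarrow> set_integrable lborel {0..<1} f"
  by (simp add: U01_def integrable_restrict_space set_integrable_def)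

lemma integrable_bounded_U01:
  fixes f :: "real \<Rightarrow> real"
  assumes "f \<in> borel_measurable borel" "\<And>x. \<bar>f x\<bar> \<le> B"
  shows "integrable U01 f"
proof -
  interpret prob_space U01 by (rule prob_space_U01)
  show ?thesis
    by (rule integrable_const_bound[OF AE_I2 measurable_U01I[OF assms(1)], of B]) (simp add: assms(2))
qed

lemma ac_derivD:
  assumes "ac_deriv g h"
  shows "integrable U01 h"
    and "t \<in> {0..<1} \<Longrightarrow> g t = g 0 + (LINT u|U01. indicator {..<t} u * h u)"
proof -
  show "integrable U01 h"
    using assms by (simp add: ac_deriv_def integrable_U01_iff)
  assume t: "t \<in> {0..<1}"
  have "(LINT u|U01. indicator {..<t} u * h u) = (LBINT u:{0..<t}. h u)"
    unfolding integral_U01 set_lebesgue_integral_def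
    using t by (intro Bochner_Integration.integral_cong refl) (auto simp: indicator_def)
  moreover have "g t = g 0 + (LBINT u:{0..<t}. h u)"
    using assms t unfolding ac_deriv_def by blast
  ultimately show "g t = g 0 + (LINT u|U01. indicator {..<t} u * h u)"
    by simp
qed

lemma integrable_mult_bounded:
  fixes h k :: "'a \<Rightarrow> real"
  assumes h: "integrable M h" and k: "k \<in> borel_measurable M" "\<And>x. x \<in> space M \<Longrightarrow> \<bar>k x\<bar> \<le> B"
  shows "integrable M (\<lambda>x. h x * k x)"
proof (rule Bochner_Integration.integrable_bound)
  show "integrable M (\<lambda>x. B * h x)" using h by simp
  show "(\<lambda>x. h x * k x) \<in> borel_measurable M" using h k(1) by (intro borel_measurable_times) auto
  show "AE x in M. norm (h x * k x) \<le> norm (B * h x)"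
  proof (rule AE_I2)
    fix x assume "x \<in> space M"
    then have "\<bar>k x\<bar> \<le> \<bar>B\<bar>" using k(2)[of x] by linarith
    then show "norm (h x * k x) \<le> norm (B * h x)"
      using mult_left_mono[of "\<bar>k x\<bar>" "\<bar>B\<bar>" "\<bar>h x\<bar>"] by (simp add: abs_mult mult.commute)
  qed
qed

lemma integral_tail_U01:
  fixes f :: "real \<Rightarrow> real"
  assumes f: "f \<in> borel_measurable borel" "\<And>x. \<bar>f x\<bar> \<le> B"
    and u: "u \<in> {0..1}" and int: "(f has_integral I) {u..1}"
  shows "(LINT x|U01. indicator {u<..} x * f x) = I"
proof -
  have si: "set_integrable lborel {u<..<1} f"
  proof -
    have "set_integrable lborel {0..<1} f"
      using integrable_bounded_U01[OF f] by (simp add: integrable_U01_iff)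
    then show ?thesis by (rule set_integrable_subset) (use u in auto)
  qed
  have "(LINT x|U01. indicator {u<..} x * f x) = (LBINT x:{u<..<1}. f x)"
    unfolding integral_U01 set_lebesgue_integral_def
    using u by (intro Bochner_Integration.integral_cong refl) (auto simp: indicator_def)
  also have "\<dots> = integral {u<..<1} f"
    by (rule set_borel_integral_eq_integral(2)[OF si])
  also have "\<dots> = I"
    using int by (simp add: has_integral_Icc_iff_Ioo integral_unique)
  finally show ?thesis .
qed

text \<open>
  Integration by parts for an indefinite integral \<open>g\<close> of \<open>h\<close>, by Fubini on the triangle below the
  diagonal.
\<close>

lemma integral_by_parts_U01:
  fixes g h \<phi> \<phi>' :: "real \<Rightarrow> real"
  assumes gh: "ac_deriv g h"
    and \<phi>': "\<phi>' \<in> borel_measurable borel" "\<And>x. \<bar>\<phi>' x\<bar> \<le> B"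
    and \<phi>: "\<And>u. u \<in> {0..1} \<Longrightarrow> (\<phi>' has_integral \<phi> 1 - \<phi> u) {u..1}"
  shows "(LINT x|U01. g x * \<phi>' x) =
    g 0 * (\<phi> 1 - \<phi> 0) + (LINT u|U01. h u * (\<phi> 1 - \<phi> u))"
proof -
  interpret U: prob_space U01 by (rule prob_space_U01)
  interpret P: pair_prob_space U01 U01 ..
  have h: "integrable U01 h" by (rule ac_derivD[OF gh])
  define F where "F p = h (snd p) * (indicator {p. snd p < fst p} p * \<phi>' (fst p))" for p :: "real \<times> real"
  have hsnd: "integrable (U01 \<Otimes>\<^sub>M U01) (\<lambda>p. h (snd p))"
    by (rule P.Fubini_integrable) (use h in auto)
  have F: "integrable (U01 \<Otimes>\<^sub>M U01) F"
    unfolding F_def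
  proof (rule integrable_mult_bounded[OF hsnd, where B = B])
    have id: "(\<lambda>x. x) \<in> borel_measurable U01" by (rule measurable_U01I) simp
    have 1: "fst \<in> borel_measurable (U01 \<Otimes>\<^sub>M U01)"
      using measurable_compose[OF measurable_fst[of U01 U01] id] by simp
    have 2: "snd \<in> borel_measurable (U01 \<Otimes>\<^sub>M U01)"
      using measurable_compose[OF measurable_snd[of U01 U01] id] by simp
    have if_meas: "(\<lambda>p. if snd p < fst p then 1 else 0 :: real) \<in> borel_measurable (U01 \<Otimes>\<^sub>M U01)"
      using borel_measurable_less[OF 2 1] by (intro measurable_If) auto
    have 3: "(\<lambda>p. indicator {p. snd p < fst p} p :: real) \<in> borel_measurable (U01 \<Otimes>\<^sub>M U01)"
    proof -
      have "(\<lambda>p. indicator {p. snd p < fst p} p) = (\<lambda>p::real \<times> real. if snd p < fst p then 1 else 0 :: real)"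
        by (auto simp: indicator_def)
      then show ?thesis using if_meas by simp
    qed
    have 4: "(\<lambda>p. \<phi>' (fst p)) \<in> borel_measurable (U01 \<Otimes>\<^sub>M U01)"
      by (rule measurable_compose[OF measurable_fst measurable_U01I[OF \<phi>'(1)]])
    show "(\<lambda>p. indicator {p. snd p < fst p} p * \<phi>' (fst p)) \<in> borel_measurable (U01 \<Otimes>\<^sub>M U01)"
      by (rule borel_measurable_times[OF 3 4])
    show "\<bar>indicator {p. snd p < fst p} x * \<phi>' (fst x)\<bar> \<le> B" for x
      using \<phi>'(2)[of "fst x"] by (auto simp: indicator_def)
  qed
  have \<phi>'_int: "integrable U01 \<phi>'" by (rule integrable_bounded_U01[OF \<phi>'])
  have "(LINT x|U01. g x * \<phi>' x) = (LINT x|U01. g 0 * \<phi>' x + (LINT u|U01. F (x, u)))"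
  proof (rule Bochner_Integration.integral_cong[OF refl])
    fix x assume "x \<in> space U01"
    then have "g x = g 0 + (LINT u|U01. indicator {..<x} u * h u)"
      by (intro ac_derivD(2)[OF gh]) simp
    moreover have "(LINT u|U01. F (x, u)) = (LINT u|U01. indicator {..<x} u * h u) * \<phi>' x"
      unfolding integral_mult_left_zero[symmetric]
      by (intro Bochner_Integration.integral_cong refl) (simp add: F_def indicator_def)
    ultimately show "g x * \<phi>' x = g 0 * \<phi>' x + (LINT u|U01. F (x, u))"
      by (simp add: algebra_simps)
  qed
  also have "\<dots> = g 0 * (LINT x|U01. \<phi>' x) + (LINT x|U01. LINT u|U01. F (x, u))"
    using P.integrable_fst'[OF F] \<phi>'_int by simp
  also have "(LINT x|U01. LINT u|U01. F (x, u)) = (LINT u|U01. LINT x|U01. F (x, u))"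
    using P.Fubini_integral[of "\<lambda>x u. F (x, u)"] F by simp
  also have "\<dots> = (LINT u|U01. h u * (\<phi> 1 - \<phi> u))"
  proof (rule Bochner_Integration.integral_cong[OF refl])
    fix u assume "u \<in> space U01"
    then have u: "u \<in> {0..1}" by simp
    have "(LINT x|U01. F (x, u)) = h u * (LINT x|U01. indicator {u<..} x * \<phi>' x)"
      unfolding integral_mult_right_zero[symmetric]
      by (intro Bochner_Integration.integral_cong refl) (simp add: F_def indicator_def)
    then show "(LINT x|U01. F (x, u)) = h u * (\<phi> 1 - \<phi> u)"
      by (simp add: integral_tail_U01[OF \<phi>' u \<phi>[OF u]])
  qed
  also have "(LINT x|U01. \<phi>' x) = \<phi> 1 - \<phi> 0"
  proof -
    have "(LINT x|U01. \<phi>' x) = (LINT x:{0..<1}|lborel. \<phi>' x)"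
      by (rule integral_U01)
    also have "\<dots> = integral {0..<1} \<phi>'"
      by (rule set_borel_integral_eq_integral(2)) (use \<phi>'_int in \<open>simp add: integrable_U01_iff\<close>)
    also have "\<dots> = integral {0..1} \<phi>'"
      by (rule integral_subset_negligible) (auto intro: negligible_subset[of "{1}"])
    also have "\<dots> = \<phi> 1 - \<phi> 0"
      using \<phi>[of 0] by (simp add: integral_unique)
    finally show ?thesis .
  qed
  finally show ?thesis .
qed

lemma frac_diff_unit:
  assumes "u \<in> {0..<1}" "y \<in> {0..<1}"
  shows "frac (u - y) = u - y + indicator {..<y} u"
proof (cases "u < y")
  case True
  then have "\<lfloor>u - y\<rfloor> = -1" using assms by (intro floor_unique) auto
  then show ?thesis using True by (simp add: frac_def)
next
  case False
  then have "\<lfloor>u - y\<rfloor> = 0" using assms by (intro floor_unique) auto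
  then show ?thesis using False by (simp add: frac_def)
qed

lemma abs_bern_per_le_1:
  assumes "\<tau> \<ge> 1"
  shows "\<bar>bern_per \<tau> x\<bar> \<le> 1"
proof -
  have "1 / 2 ^ \<tau> \<le> (1::real)" by (simp add: divide_le_eq_1)
  then show ?thesis using abs_bern_per_le[OF assms, of x] by linarith
qed

text \<open>
  The kernel is \<open>u - 1\<close> plus the indicator of \<open>u < y\<close>. The mean of \<open>g\<close> accounts for the first
  part, and \<open>g y - g 0\<close> for the second.
\<close>

lemma bernoulli_expansion_order_1:
  assumes gh: "ac_deriv g h" and y: "y \<in> {0..<1}"
  shows "g y = (LINT x|U01. g x) + (LINT u|U01. h u * (bern 1 y + bern_per 1 (u - y)))"
proof -
  have h: "integrable U01 h" by (rule ac_derivD[OF gh])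
  have "(LINT x|U01. g x * 1) = g 0 * (1 - 0) + (LINT u|U01. h u * (1 - u))"
  proof (rule integral_by_parts_U01[OF gh, where B = 1])
    show "((\<lambda>_. 1) has_integral 1 - u) {u..1::real}" if "u \<in> {0..1}" for u
      using has_integral_const_real[of "1::real" u 1] that by simp
  qed auto
  moreover have "g y = g 0 + (LINT u|U01. h u * indicator {..<y} u)"
    using ac_derivD(2)[OF gh y] by (simp add: mult.commute)
  moreover have "(LINT u|U01. h u * (bern 1 y + bern_per 1 (u - y))) =
      (LINT u|U01. h u * indicator {..<y} u - h u * (1 - u))"
  proof (rule Bochner_Integration.integral_cong[OF refl])
    fix u assume "u \<in> space U01"
    then have u: "u \<in> {0..<1}" by simp
    have "bern 1 y + bern_per 1 (u - y) = indicator {..<y} u - (1 - u)"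
      unfolding bern_per_def frac_diff_unit[OF u y] bern_1 by simp
    then show "h u * (bern 1 y + bern_per 1 (u - y)) = h u * indicator {..<y} u - h u * (1 - u)"
      by (simp only: right_diff_distrib)
  qed
  moreover have "\<dots> = (LINT u|U01. h u * indicator {..<y} u) - (LINT u|U01. h u * (1 - u))"
    by (intro Bochner_Integration.integral_diff integrable_mult_bounded[OF h, where B = 1]
          measurable_U01I) (auto simp: indicator_def)
  ultimately show ?thesis by simp
qed

text \<open>
  The Euler-Maclaurin type expansion of order \<open>\<alpha>\<close>. Each further order is an integration by parts
  in the remainder; the boundary term is the next Bernoulli polynomial.
\<close>

lemma bernoulli_expansion:
  assumes "\<alpha> \<ge> 1" and gs: "\<And>i. i < \<alpha> \<Longrightarrow> ac_deriv (gs i) (gs (Suc i))" and y: "y \<in> {0..<1}"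
  shows "gs 0 y = (LINT x|U01. gs 0 x) + (\<Sum>c=1..\<alpha>. bern c y * (LINT x|U01. gs c x)) +
    (-1) ^ (\<alpha> + 1) * (LINT x|U01. gs \<alpha> x * bern_per \<alpha> (x - y))"
  using assms(1) gs
proof (induction \<alpha> rule: dec_induct)
  case base
  have gh: "ac_deriv (gs 0) (gs 1)" using base by simp
  have h: "integrable U01 (gs 1)" by (rule ac_derivD[OF gh])
  have "integrable U01 (\<lambda>x. gs 1 x * bern_per 1 (x - y))"
    by (rule integrable_mult_bounded[OF h measurable_U01I abs_bern_per_le_1]) auto
  then have "(LINT u|U01. gs 1 u * (bern 1 y + bern_per 1 (u - y))) =
      bern 1 y * (LINT x|U01. gs 1 x) + (LINT x|U01. gs 1 x * bern_per 1 (x - y))"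
    using h by (simp add: distrib_left mult.commute)
  then show ?case
    using bernoulli_expansion_order_1[OF gh y] by simp
next
  case (step \<alpha>)
  have gh: "ac_deriv (gs \<alpha>) (gs (Suc \<alpha>))" using step.prems by simp
  have h: "integrable U01 (gs (Suc \<alpha>))" by (rule ac_derivD[OF gh])
  define \<phi> where "\<phi> x = bern_per (Suc \<alpha>) (x - y)" for x
  have \<phi>1: "\<phi> 1 = \<phi> 0"
    unfolding \<phi>_def using bern_per_plus_1[of "Suc \<alpha>" "- y"] by (simp add: algebra_simps)
  have \<phi>0: "\<phi> 0 = (-1) ^ Suc \<alpha> * bern (Suc \<alpha>) y"
    unfolding \<phi>_def using bern_per_reflect[of "Suc \<alpha>" y] step.hyps y by (simp add: bern_per_eq_bern)
  have hint: "integrable U01 (\<lambda>u. gs (Suc \<alpha>) u * \<phi> u)"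
    unfolding \<phi>_def by (rule integrable_mult_bounded[OF h measurable_U01I abs_bern_per_le_1]) auto
  have "(LINT x|U01. gs \<alpha> x * bern_per \<alpha> (x - y)) =
      gs \<alpha> 0 * (\<phi> 1 - \<phi> 0) + (LINT u|U01. gs (Suc \<alpha>) u * (\<phi> 1 - \<phi> u))"
  proof (rule integral_by_parts_U01[OF gh])
    show "(\<lambda>x. bern_per \<alpha> (x - y)) \<in> borel_measurable borel" by measurable
    show "\<bar>bern_per \<alpha> (x - y)\<bar> \<le> 1 / 2 ^ \<alpha>" for x using step.hyps by (intro abs_bern_per_le) auto
    show "((\<lambda>x. bern_per \<alpha> (x - y)) has_integral \<phi> 1 - \<phi> u) {u..1}" if "u \<in> {0..1}" for u
    proof -
      have "(bern_per \<alpha> has_integral bern_per (Suc \<alpha>) (1 + - y) - bern_per (Suc \<alpha>) (u + - y)) {u + - y..1 + - y}"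
        using that step.hyps by (intro bern_per_has_integral) auto
      then show ?thesis
        by (subst (asm) has_integral_shift_Icc_real[symmetric]) (simp add: o_def \<phi>_def add.commute)
    qed
  qed
  also have "\<dots> = (LINT u|U01. gs (Suc \<alpha>) u * \<phi> 0 - gs (Suc \<alpha>) u * \<phi> u)"
    by (simp add: \<phi>1 right_diff_distrib)
  also have "\<dots> = (LINT u|U01. gs (Suc \<alpha>) u) * \<phi> 0 - (LINT u|U01. gs (Suc \<alpha>) u * \<phi> u)"
    using h hint by simp
  finally have eq: "(LINT x|U01. gs \<alpha> x * bern_per \<alpha> (x - y)) =
      (LINT u|U01. gs (Suc \<alpha>) u) * \<phi> 0 - (LINT u|U01. gs (Suc \<alpha>) u * \<phi> u)" .
  have sq: "(-1) ^ Suc \<alpha> * ((-1) ^ Suc \<alpha> * z) = z" for z :: real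
    by (simp add: mult.assoc[symmetric] power_mult_distrib[symmetric])
  have "(-1) ^ (\<alpha> + 1) * (LINT x|U01. gs \<alpha> x * bern_per \<alpha> (x - y)) =
      (-1) ^ Suc \<alpha> * ((-1) ^ Suc \<alpha> * (bern (Suc \<alpha>) y * (LINT u|U01. gs (Suc \<alpha>) u))) +
      (-1) ^ (Suc \<alpha> + 1) * (LINT u|U01. gs (Suc \<alpha>) u * \<phi> u)"
    unfolding eq \<phi>0 by (simp add: algebra_simps)
  then show ?case
    using step.IH step.prems unfolding sq by (simp add: \<phi>_def)
qed

lemma bernoulli_expansion_rep_kernel:
  assumes "\<alpha> \<ge> 1" and gs: "\<And>i. i < \<alpha> \<Longrightarrow> ac_deriv (gs i) (gs (Suc i))" and y: "y \<in> {0..<1}"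
  shows "gs 0 y = (\<Sum>c\<in>{0..\<alpha> + 1}. LINT x|U01. gs (min c \<alpha>) x * rep_kernel \<alpha> c x y)"
proof -
  define T where "T c = (LINT x|U01. gs (min c \<alpha>) x * rep_kernel \<alpha> c x y)" for c
  have "T 0 = (LINT x|U01. gs 0 x)" by (simp add: T_def rep_kernel_def)
  moreover have "T c = bern c y * (LINT x|U01. gs c x)" if "c \<in> {1..\<alpha>}" for c
    using that by (simp add: T_def rep_kernel_def mult.commute)
  moreover have "T (\<alpha> + 1) = (-1) ^ (\<alpha> + 1) * (LINT x|U01. gs \<alpha> x * bern_per \<alpha> (x - y))"
    unfolding T_def rep_kernel_def integral_mult_right_zero[symmetric]
    by (intro Bochner_Integration.integral_cong refl) simp
  moreover have "(\<Sum>c\<in>{0..\<alpha> + 1}. T c) = T 0 + (\<Sum>c=1..\<alpha>. T c) + T (\<alpha> + 1)"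
    by (simp add: sum.atLeast_Suc_atMost)
  ultimately show ?thesis
    using bernoulli_expansion[where gs = gs and \<alpha> = \<alpha> and y = y, OF assms] by (simp add: T_def[symmetric])
qed

section \<open>Bernoulli expansion in several variables\<close>

text \<open>
  The point that is \<open>x\<close> in the coordinates \<open>J\<close> and \<open>y\<close> in the others. The expansion proceeds
  coordinate by coordinate, so the derivatives are integrated over \<open>J\<close> with the other coordinates
  frozen.
\<close>

definition overwrite :: "nat \<Rightarrow> nat set \<Rightarrow> (nat \<Rightarrow> real) \<Rightarrow> (nat \<Rightarrow> real) \<Rightarrow> nat \<Rightarrow> real" where
  "overwrite s J x y = (\<lambda>i\<in>{1..s}. if i \<in> J then x i else y i)"

lemma overwrite_in_cube:
  assumes "J \<subseteq> {1..s}" "x \<in> space (cube J)" "y \<in> space (cube {1..s})"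
  shows "overwrite s J x y \<in> space (cube {1..s})"
  using assms by (auto simp: overwrite_def space_cube PiE_iff)

lemma measurable_overwrite:
  assumes "J \<subseteq> {1..s}" "y \<in> space (cube {1..s})"
  shows "(\<lambda>x. overwrite s J x y) \<in> measurable (cube J) (cube {1..s})"
  unfolding overwrite_def cube_eq
proof (rule measurable_restrict)
  fix i assume i: "i \<in> {1..s}"
  show "(\<lambda>x. if i \<in> J then x i else y i) \<in> measurable (Pi\<^sub>M J (\<lambda>j. U01)) U01"
  proof (cases "i \<in> J")
    case True
    then show ?thesis using measurable_component_singleton[of i J "\<lambda>j. U01"] by simp
  next
    case False
    then show ?thesis using assms(2) i by (simp add: space_cube PiE_iff)
  qed
qed

lemma overwrite_all: "x \<in> space (cube {1..s}) \<Longrightarrow> overwrite s {1..s} x y = x"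
  by (auto simp: overwrite_def space_cube PiE_iff extensional_def fun_eq_iff)

lemma overwrite_insert:
  assumes "j \<in> {1..s}"
  shows "overwrite s (insert j J) (x(j := t)) y = (overwrite s J x y)(j := t)"
  using assms by (auto simp: overwrite_def fun_eq_iff)

lemma overwrite_insert_same:
  assumes "j \<in> {1..s}" "j \<notin> J"
  shows "overwrite s (insert j J) (x(j := y j)) y = overwrite s J x y"
  using assms by (auto simp: overwrite_def fun_eq_iff)

lemma AE_cube_restrict:
  assumes "finite J" "v \<subseteq> J" "AE z in cube v. P z"
  shows "AE x in cube J. P (restrict x v)"
proof -
  interpret product_prob_space "\<lambda>_::nat. U01" UNIV by (rule product_prob_space_U01)
  have "AE z in distr (cube J) (cube v) (\<lambda>x. restrict x v). P z"
    using assms(3) unfolding cube_eq distr_restrict[OF assms(2,1), symmetric] .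
  then show ?thesis
    by (rule AE_distrD[rotated]) (use assms(2) in \<open>simp add: cube_eq measurable_restrict_subset\<close>)
qed

lemma distr_cube_insert:
  "distr (U01 \<Otimes>\<^sub>M cube J) (cube (insert j J)) (\<lambda>(t, x). x(j := t)) = cube (insert j J)"
  unfolding cube_eq by (rule distr_pair_PiM_eq_PiM) (rule prob_space_U01)+

lemma measurable_cube_insert:
  "(\<lambda>(t, x). x(j := t)) \<in> measurable (U01 \<Otimes>\<^sub>M cube J) (cube (insert j J))"
proof -
  have "(\<lambda>(x, t). x(j := t)) \<in> measurable (cube J \<Otimes>\<^sub>M U01) (cube (insert j J))"
    unfolding cube_eq using measurable_add_dim[of j J "\<lambda>_. U01"] by simp
  from measurable_compose[OF measurable_pair_swap' this] show ?thesis
    by (simp add: case_prod_beta')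
qed

lemma integrable_cube_insert:
  fixes H :: "(nat \<Rightarrow> real) \<Rightarrow> real"
  assumes "integrable (cube (insert j J)) H"
  shows "integrable (U01 \<Otimes>\<^sub>M cube J) (\<lambda>p. H ((snd p)(j := fst p)))"
proof -
  have "integrable (distr (U01 \<Otimes>\<^sub>M cube J) (cube (insert j J)) (\<lambda>(t, x). x(j := t))) H"
    using assms by (simp only: distr_cube_insert)
  from integrable_distr[OF measurable_cube_insert this] show ?thesis
    by (simp add: case_prod_beta')
qed

lemma
  fixes H :: "(nat \<Rightarrow> real) \<Rightarrow> real"
  assumes "finite J" "integrable (cube (insert j J)) H"
  shows integrable_cube_insert_inner: "integrable (cube J) (\<lambda>x. LINT t|U01. H (x(j := t)))"
    and integral_cube_insert: "j \<notin> J \<Longrightarrow> integral\<^sup>L (cube (insert j J)) H = (LINT x|cube J. LINT t|U01. H (x(j := t)))"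
proof -
  interpret U: prob_space U01 by (rule prob_space_U01)
  interpret C: prob_space "cube J" by (rule prob_space_cube)
  interpret P: pair_prob_space U01 "cube J" ..
  show "integrable (cube J) (\<lambda>x. LINT t|U01. H (x(j := t)))"
    using P.integrable_snd[of "\<lambda>t x. H (x(j := t))"] integrable_cube_insert[OF assms(2)]
    by (simp add: case_prod_beta')
  interpret product_prob_space "\<lambda>_::nat. U01" UNIV by (rule product_prob_space_U01)
  show "integral\<^sup>L (cube (insert j J)) H = (LINT x|cube J. LINT t|U01. H (x(j := t)))" if "j \<notin> J"
    using product_integral_insert[OF assms(1) that, of H] assms(2) by (simp add: cube_eq)
qed

lemma abs_rep_kernel_le:
  assumes "\<alpha> \<ge> 1"
  shows "\<bar>rep_kernel \<alpha> c x y\<bar> \<le> 1 + \<bar>bern c y\<bar>"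
proof -
  have "\<bar>bern_per \<alpha> (x - y)\<bar> \<le> 1" by (rule abs_bern_per_le_1[OF assms])
  then show ?thesis by (auto simp: rep_kernel_def abs_mult power_abs)
qed

lemma measurable_rep_kernel: "(\<lambda>x. rep_kernel \<alpha> c x y) \<in> borel_measurable borel"
  unfolding rep_kernel_def by measurable

lemma measurable_prod_rep_kernel:
  assumes "K \<subseteq> J"
  shows "(\<lambda>x. kernel_prod \<alpha> K c x y) \<in> borel_measurable (cube J)"
proof (rule borel_measurable_prod)
  fix j assume j: "j \<in> K"
  have "(\<lambda>x. x j) \<in> measurable (cube J) U01"
    unfolding cube_eq using j assms by (intro measurable_component_singleton) auto
  from measurable_compose[OF this measurable_U01I[OF measurable_rep_kernel]]
  show "(\<lambda>x. rep_kernel \<alpha> (c j) (x j) (y j)) \<in> borel_measurable (cube J)" .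
qed

lemma abs_prod_rep_kernel_le:
  assumes "\<alpha> \<ge> 1"
  shows "\<bar>kernel_prod \<alpha> J c x y\<bar> \<le> (\<Prod>j\<in>J. 1 + \<bar>bern (c j) (y j)\<bar>)"
  unfolding abs_prod by (intro prod_mono conjI abs_rep_kernel_le[OF assms]) auto

text \<open>
  The order of differentiation that belongs to the kernel index \<open>c\<close> on \<open>J\<close>. The remainder \<open>\<alpha> + 1\<close>
  and the last Bernoulli polynomial \<open>\<alpha>\<close> both come with a derivative of order \<open>\<alpha>\<close>.
\<close>

definition order_of :: "nat \<Rightarrow> nat set \<Rightarrow> (nat \<Rightarrow> nat) \<Rightarrow> nat \<Rightarrow> nat" where
  "order_of \<alpha> J c = (\<lambda>i. if i \<in> J then min (c i) \<alpha> else 0)"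

lemma order_of_in_multi_orders: "J \<subseteq> {1..s} \<Longrightarrow> order_of \<alpha> J c \<in> multi_orders s \<alpha>"
  by (auto simp: multi_orders_def order_of_def)

context
  fixes s \<alpha> :: nat and f :: "(nat \<Rightarrow> real) \<Rightarrow> real" and D :: "(nat \<Rightarrow> nat) \<Rightarrow> (nat \<Rightarrow> real) \<Rightarrow> real"
  assumes D: "is_mixed_derivs s \<alpha> f D" and \<alpha>: "\<alpha> \<ge> 1"
begin

lemma slice_measurable:
  assumes "\<beta> \<in> multi_orders s \<alpha>" "J \<subseteq> {1..s}" "y \<in> space (cube {1..s})"
  shows "(\<lambda>x. D \<beta> (overwrite s J x y)) \<in> borel_measurable (cube J)"
proof (rule measurable_compose[OF measurable_overwrite[OF assms(2,3)]])
  show "D \<beta> \<in> borel_measurable (cube {1..s})"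
    using D assms(1) unfolding is_mixed_derivs_def by auto
qed

text \<open>
  The exceptional null set of the defining property lives in the coordinates of full order, all of
  which are in \<open>J\<close>. So the property holds for almost every value of \<open>J\<close> and every frozen value.
\<close>

lemma AE_slice_ac_deriv:
  assumes \<beta>: "\<beta> \<in> multi_orders s \<alpha>" and j: "j \<in> {1..s}" "\<beta> j < \<alpha>"
    and J: "J \<subseteq> {1..s}" "j \<notin> J" and v: "\<And>i. i \<in> {1..s} \<Longrightarrow> \<beta> i = \<alpha> \<Longrightarrow> i \<in> J"
    and y: "y \<in> space (cube {1..s})"
  shows "AE x in cube J. ac_deriv (\<lambda>t. D \<beta> (overwrite s (insert j J) (x(j := t)) y))
    (\<lambda>t. D (\<beta>(j := Suc (\<beta> j))) (overwrite s (insert j J) (x(j := t)) y))"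
proof -
  define w where "w = {i\<in>{1..s}. \<beta> i = \<alpha>}"
  have w: "w \<subseteq> J" using v by (auto simp: w_def)
  have "AE z in cube w. \<forall>x\<in>space (cube {1..s}). restrict x w = z \<longrightarrow>
      ac_deriv (\<lambda>t. D \<beta> (x(j := t))) (\<lambda>t. D (\<beta>(j := Suc (\<beta> j))) (x(j := t)))"
    using D \<beta> j unfolding is_mixed_derivs_def Let_def w_def by blast
  then have "AE x in cube J. \<forall>x'\<in>space (cube {1..s}). restrict x' w = restrict x w \<longrightarrow>
      ac_deriv (\<lambda>t. D \<beta> (x'(j := t))) (\<lambda>t. D (\<beta>(j := Suc (\<beta> j))) (x'(j := t)))"
    by (rule AE_cube_restrict[rotated 2]) (use J w finite_subset in auto)
  then show ?thesis using AE_space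
  proof eventually_elim
    case (elim x)
    have "restrict (overwrite s J x y) w = restrict x w"
      using w J by (auto simp: overwrite_def fun_eq_iff)
    then show ?case
      using elim(1) overwrite_in_cube[OF J(1) elim(2) y] unfolding overwrite_insert[OF j(1)] by blast
  qed
qed

text \<open>
  Integrability over the full cube passes to the slices through every point, as long as the frozen
  coordinates do not carry the full order \<open>\<alpha>\<close>: by the expansion of order one the value at a frozen
  coordinate is an integral over this coordinate.
\<close>

lemma slice_integrable:
  assumes "finite R"
  shows "R \<subseteq> {1..s} \<Longrightarrow> \<beta> \<in> multi_orders s \<alpha> \<Longrightarrow> (\<And>i. i \<in> R \<Longrightarrow> \<beta> i < \<alpha>) \<Longrightarrow>
    y \<in> space (cube {1..s}) \<Longrightarrow>
    integrable (cube ({1..s} - R)) (\<lambda>x. D \<beta> (overwrite s ({1..s} - R) x y))"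
  using assms
proof (induction R arbitrary: \<beta> rule: finite_induct)
  case empty
  have "integrable (cube {1..s}) (D \<beta>)"
    using D empty unfolding is_mixed_derivs_def by blast
  then have "integrable (cube {1..s}) (\<lambda>x. D \<beta> (overwrite s {1..s} x y))"
    by (rule Bochner_Integration.integrable_cong[THEN iffD1, rotated -1]) (simp_all add: overwrite_all del: One_nat_def)
  then show ?case by simp
next
  case (insert j R)
  define A where "A = {1..s} - insert j R"
  have A: "A \<subseteq> {1..s}" "finite A" "j \<notin> A" "j \<in> {1..s}" "{1..s} - R = insert j A"
    using insert.hyps insert.prems by (auto simp: A_def)
  have \<beta>j: "\<beta> j < \<alpha>" using insert.prems by simp
  define \<beta>' where "\<beta>' = \<beta>(j := Suc (\<beta> j))"
  have \<beta>': "\<beta>' \<in> multi_orders s \<alpha>"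
    using insert.prems(2) \<beta>j A(4) by (auto simp: multi_orders_def \<beta>'_def)
  define F where "F x = D \<beta> (overwrite s (insert j A) x y)" for x
  define F' where "F' x = D \<beta>' (overwrite s (insert j A) x y)" for x
  have yj: "y j \<in> {0..<1}" using insert.prems(4) A(4) by (auto simp: space_cube PiE_iff)
  have F: "integrable (cube (insert j A)) F"
    unfolding F_def A(5)[symmetric] by (rule insert.IH) (use insert.prems in auto)
  have "integrable (cube (insert j A)) F'"
    unfolding F'_def A(5)[symmetric]
  proof (rule insert.IH[OF _ \<beta>'])
    show "\<beta>' i < \<alpha>" if "i \<in> R" for i
      using insert.prems(3)[of i] insert.hyps(2) that by (auto simp: \<beta>'_def)
  qed (use insert.prems in auto)
  then have F': "integrable (cube (insert j A)) (\<lambda>x. F' x * (bern 1 (y j) + bern_per 1 (x j - y j)))"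
  proof (rule integrable_mult_bounded)
    have "(\<lambda>x. x j) \<in> measurable (cube (insert j A)) U01"
      unfolding cube_eq by (rule measurable_component_singleton) simp
    then show "(\<lambda>x. bern 1 (y j) + bern_per 1 (x j - y j)) \<in> borel_measurable (cube (insert j A))"
      by (rule measurable_compose) (rule measurable_U01I, measurable)
    show "\<bar>bern 1 (y j) + bern_per 1 (x j - y j)\<bar> \<le> \<bar>bern 1 (y j)\<bar> + 1" for x
      using abs_bern_per_le_1[of 1 "x j - y j"] by linarith
  qed
  have "integrable (cube A) (\<lambda>x. (LINT t|U01. F (x(j := t))) +
      (LINT t|U01. F' (x(j := t)) * (bern 1 (y j) + bern_per 1 (t - y j))))"
    using integrable_cube_insert_inner[OF A(2) F] integrable_cube_insert_inner[OF A(2) F'] by simp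
  moreover have "(\<lambda>x. D \<beta> (overwrite s A x y)) \<in> borel_measurable (cube A)"
    by (rule slice_measurable) (use insert.prems A in auto)
  moreover have "AE x in cube A. (LINT t|U01. F (x(j := t))) +
      (LINT t|U01. F' (x(j := t)) * (bern 1 (y j) + bern_per 1 (t - y j))) = D \<beta> (overwrite s A x y)"
  proof -
    have "AE x in cube A. ac_deriv (\<lambda>t. F (x(j := t))) (\<lambda>t. F' (x(j := t)))"
      unfolding F_def F'_def \<beta>'_def
      by (rule AE_slice_ac_deriv) (use insert.prems A \<beta>j in \<open>auto simp: A_def\<close>)
    then show ?thesis
    proof eventually_elim
      case (elim x)
      show ?case
        using bernoulli_expansion_order_1[OF elim yj] overwrite_insert_same[OF A(4,3)] by (simp add: F_def)
    qed
  qed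
  ultimately show ?case
    unfolding A_def[symmetric] by (rule integrable_cong_AE_imp)
qed

lemma slice_integrable':
  assumes J: "J \<subseteq> {1..s}" and y: "y \<in> space (cube {1..s})"
  shows "integrable (cube J) (\<lambda>x. D (order_of \<alpha> J c) (overwrite s J x y))"
proof -
  have "J = {1..s} - ({1..s} - J)" using J by auto
  moreover have "integrable (cube ({1..s} - ({1..s} - J)))
      (\<lambda>x. D (order_of \<alpha> J c) (overwrite s ({1..s} - ({1..s} - J)) x y))"
    by (rule slice_integrable) (use J y \<alpha> order_of_in_multi_orders[OF J] in \<open>auto simp: order_of_def\<close>)
  ultimately show ?thesis by simp
qed

text \<open>
  The expansion in the coordinates \<open>J\<close>, by applying the expansion in one variable to one
  coordinate after the other. The remaining coordinates stay at the given point.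
\<close>

lemma bernoulli_expansion_coordinates:
  assumes "finite J"
  shows "J \<subseteq> {1..s} \<Longrightarrow> y \<in> space (cube {1..s}) \<Longrightarrow>
    f y = (\<Sum>c\<in>J \<rightarrow>\<^sub>E {0..\<alpha> + 1}. LINT x|cube J. D (order_of \<alpha> J c) (overwrite s J x y) *
      kernel_prod \<alpha> J c x y)"
  using assms
proof (induction J rule: finite_induct)
  case empty
  interpret prob_space "cube {}" by (rule prob_space_cube)
  have "order_of \<alpha> {} c = (\<lambda>_. 0)" for c by (simp add: order_of_def)
  moreover have "overwrite s {} x y = y" for x
    using empty by (auto simp: overwrite_def space_cube PiE_iff extensional_def fun_eq_iff)
  moreover have "D (\<lambda>_. 0) y = f y" using D empty unfolding is_mixed_derivs_def by blast
  ultimately show ?case by (simp add: prob_space)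
next
  case (insert j J)
  have J: "J \<subseteq> {1..s}" "j \<in> {1..s}" "insert j J \<subseteq> {1..s}" using insert.prems by auto
  have y: "y \<in> space (cube {1..s})" by (rule insert.prems)
  have yj: "y j \<in> {0..<1}" using y J(2) by (auto simp: space_cube PiE_iff)
  define H where "H c z = D (order_of \<alpha> (insert j J) c) (overwrite s (insert j J) z y) *
      (kernel_prod \<alpha> (insert j J) c z y)" for c z
  have H_int: "integrable (cube (insert j J)) (H c)" for c
    unfolding H_def
    by (rule integrable_mult_bounded[OF slice_integrable'[OF J(3) y] measurable_prod_rep_kernel
          abs_prod_rep_kernel_le[OF \<alpha>]]) auto
  have step: "(LINT x|cube J. D (order_of \<alpha> J c) (overwrite s J x y) * kernel_prod \<alpha> J c x y) =
      (\<Sum>a\<in>{0..\<alpha> + 1}. integral\<^sup>L (cube (insert j J)) (H (c(j := a))))" for c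
  proof -
    define \<beta> where "\<beta> = order_of \<alpha> J c"
    have \<beta>: "\<beta> \<in> multi_orders s \<alpha>" unfolding \<beta>_def by (rule order_of_in_multi_orders[OF J(1)])
    have \<beta>j: "\<beta> j = 0" using insert.hyps by (simp add: \<beta>_def order_of_def)
    define gs where "gs x i t = D (\<beta>(j := i)) (overwrite s (insert j J) (x(j := t)) y)" for x i t
    have "AE x in cube J. \<forall>i\<in>{..<\<alpha>}. ac_deriv (gs x i) (gs x (Suc i))"
    proof (rule AE_finite_allI)
      fix i assume i: "i \<in> {..<\<alpha>}"
      have "AE x in cube J. ac_deriv (\<lambda>t. D (\<beta>(j := i)) (overwrite s (insert j J) (x(j := t)) y))
          (\<lambda>t. D ((\<beta>(j := i))(j := Suc ((\<beta>(j := i)) j))) (overwrite s (insert j J) (x(j := t)) y))"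
      proof (rule AE_slice_ac_deriv[OF _ J(2) _ J(1) insert.hyps(2) _ y])
        show "\<beta>(j := i) \<in> multi_orders s \<alpha>" using \<beta> i J(2) by (auto simp: multi_orders_def)
        show "i' \<in> J" if "i' \<in> {1..s}" "(\<beta>(j := i)) i' = \<alpha>" for i'
          using that i \<alpha> by (auto simp: \<beta>_def order_of_def split: if_splits)
      qed (use i in auto)
      then show "AE x in cube J. ac_deriv (gs x i) (gs x (Suc i))"
        by (simp add: gs_def[abs_def])
    qed auto
    then have "AE x in cube J. D \<beta> (overwrite s J x y) * kernel_prod \<alpha> J c x y =
        (\<Sum>a\<in>{0..\<alpha> + 1}. LINT t|U01. H (c(j := a)) (x(j := t)))"
    proof eventually_elim
      case (elim x)
      have "gs x 0 (y j) = (\<Sum>a\<in>{0..\<alpha> + 1}. LINT t|U01. gs x (min a \<alpha>) t * rep_kernel \<alpha> a t (y j))"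
        by (rule bernoulli_expansion_rep_kernel[OF \<alpha> _ yj]) (use elim in auto)
      moreover have "gs x 0 (y j) = D \<beta> (overwrite s J x y)"
        using \<beta>j overwrite_insert_same[OF J(2) insert.hyps(2)] by (simp add: gs_def fun_upd_idem)
      moreover have "(LINT t|U01. H (c(j := a)) (x(j := t))) =
          (LINT t|U01. gs x (min a \<alpha>) t * rep_kernel \<alpha> a t (y j)) * kernel_prod \<alpha> J c x y" for a
      proof -
        have "order_of \<alpha> (insert j J) (c(j := a)) = \<beta>(j := min a \<alpha>)"
          using insert.hyps by (auto simp: order_of_def \<beta>_def fun_eq_iff)
        moreover have "(\<Prod>i\<in>J. rep_kernel \<alpha> ((c(j := a)) i) ((x(j := t)) i) (y i)) =
            (kernel_prod \<alpha> J c x y)" for t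
          using insert.hyps by (intro prod.cong) auto
        ultimately show ?thesis
          using insert.hyps by (simp add: H_def gs_def mult.assoc[symmetric])
      qed
      ultimately show ?case by (simp only: sum_distrib_right)
    qed
    then have "(LINT x|cube J. D \<beta> (overwrite s J x y) * kernel_prod \<alpha> J c x y) =
        (LINT x|cube J. (\<Sum>a\<in>{0..\<alpha> + 1}. LINT t|U01. H (c(j := a)) (x(j := t))))"
    proof (rule integral_cong_AE[rotated 2])
      show "(\<lambda>x. D \<beta> (overwrite s J x y) * kernel_prod \<alpha> J c x y) \<in> borel_measurable (cube J)"
        by (intro borel_measurable_times slice_measurable measurable_prod_rep_kernel) (use \<beta> J y in auto)
      show "(\<lambda>x. \<Sum>a\<in>{0..\<alpha> + 1}. LINT t|U01. H (c(j := a)) (x(j := t))) \<in> borel_measurable (cube J)"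
        by (intro borel_measurable_sum borel_measurable_integrable integrable_cube_insert_inner insert.hyps H_int)
    qed
    also have "\<dots> = (\<Sum>a\<in>{0..\<alpha> + 1}. LINT x|cube J. LINT t|U01. H (c(j := a)) (x(j := t)))"
      by (intro Bochner_Integration.integral_sum integrable_cube_insert_inner insert.hyps H_int)
    also have "\<dots> = (\<Sum>a\<in>{0..\<alpha> + 1}. integral\<^sup>L (cube (insert j J)) (H (c(j := a))))"
      by (intro sum.cong refl integral_cube_insert[symmetric] insert.hyps H_int)
    finally show ?thesis by (simp only: \<beta>_def)
  qed
  have "f y = (\<Sum>c\<in>J \<rightarrow>\<^sub>E {0..\<alpha> + 1}. \<Sum>a\<in>{0..\<alpha> + 1}. integral\<^sup>L (cube (insert j J)) (H (c(j := a))))"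
    using insert.IH[OF J(1) y] by (simp only: step)
  also have "\<dots> = (\<Sum>a\<in>{0..\<alpha> + 1}. \<Sum>c\<in>J \<rightarrow>\<^sub>E {0..\<alpha> + 1}. integral\<^sup>L (cube (insert j J)) (H (c(j := a))))"
    by (rule sum.swap)
  also have "\<dots> = (\<Sum>(a, c)\<in>{0..\<alpha> + 1} \<times> (J \<rightarrow>\<^sub>E {0..\<alpha> + 1}). integral\<^sup>L (cube (insert j J)) (H (c(j := a))))"
    by (rule sum.cartesian_product)
  also have "\<dots> = (\<Sum>c\<in>insert j J \<rightarrow>\<^sub>E {0..\<alpha> + 1}. integral\<^sup>L (cube (insert j J)) (H c))"
    unfolding PiE_insert_eq using inj_combinator[OF insert.hyps(2), of "\<lambda>_. {0..\<alpha> + 1}"]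
    by (subst sum.reindex) (simp_all add: case_prod_beta' o_def)
  finally show ?case unfolding H_def[abs_def] .
qed

lemma bernoulli_expansion_cube:
  assumes y: "y \<in> space (cube {1..s})"
  shows "f y = (\<Sum>c\<in>{1..s} \<rightarrow>\<^sub>E {0..\<alpha> + 1}. LINT x|cube {1..s}. D (order_of \<alpha> {1..s} c) x *
      (\<Prod>j\<in>{1..s}. rep_kernel \<alpha> (c j) (x j) (y j)))"
proof -
  have "f y = (\<Sum>c\<in>{1..s} \<rightarrow>\<^sub>E {0..\<alpha> + 1}. LINT x|cube {1..s}. D (order_of \<alpha> {1..s} c) (overwrite s {1..s} x y) *
      (\<Prod>j\<in>{1..s}. rep_kernel \<alpha> (c j) (x j) (y j)))"
    by (rule bernoulli_expansion_coordinates) (use y in auto)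
  also have "\<dots> = (\<Sum>c\<in>{1..s} \<rightarrow>\<^sub>E {0..\<alpha> + 1}. LINT x|cube {1..s}. D (order_of \<alpha> {1..s} c) x *
      (\<Prod>j\<in>{1..s}. rep_kernel \<alpha> (c j) (x j) (y j)))"
    by (intro sum.cong refl Bochner_Integration.integral_cong) (simp add: overwrite_all del: One_nat_def)
  finally show ?thesis .
qed

end

section \<open>Hoelder inequalities\<close>

lemma epow_ennreal: "a \<ge> 0 \<Longrightarrow> epow (ennreal a) p = ennreal (a powr p)"
  by (simp add: epow_def)

lemma epow_top [simp]: "epow Orderings.top p = Orderings.top"
  by (simp add: epow_def)

lemma epow_0 [simp]: "epow 0 p = 0"
  by (simp add: epow_def)

lemma epow_1: "epow x 1 = x"
  by (cases x) (auto simp: epow_def)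

lemma epow_epow: "epow (epow x p) q = epow x (p * q)"
  by (cases x) (auto simp: epow_ennreal powr_powr)

lemma epow_inverse: "p > 0 \<Longrightarrow> epow (epow x p) (1 / p) = x"
  by (simp add: epow_epow epow_1)

lemma epow_mono: "x \<le> y \<Longrightarrow> p \<ge> 0 \<Longrightarrow> epow x p \<le> epow y p"
  by (cases x; cases y) (auto simp: epow_ennreal ennreal_leI powr_mono2 top_unique)

lemma epow_eq_0_iff [simp]: "epow x p = 0 \<longleftrightarrow> x = 0"
  by (cases x) (auto simp: epow_ennreal)

lemma epow_eq_top_iff [simp]: "epow x p = Orderings.top \<longleftrightarrow> x = Orderings.top"
  by (cases x) (auto simp: epow_ennreal)

lemma epow_mult: "epow (x * y) p = epow x p * epow y p"
proof (cases "x = \<infinity> \<or> y = \<infinity>")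
  case True
  then show ?thesis by (cases "x = 0 \<or> y = 0") (auto simp: ennreal_top_mult ennreal_mult_top)
next
  case False
  then obtain a c where "x = ennreal a" "y = ennreal c" "a \<ge> 0" "c \<ge> 0"
    by (cases x; cases y) auto
  then show ?thesis by (simp add: ennreal_mult[symmetric] epow_ennreal powr_mult)
qed

lemma measurable_epow [measurable]: "(\<lambda>x. epow x p) \<in> borel_measurable borel"
  unfolding epow_def by measurable

text \<open>
  The inequality of Young after scaling by \<open>A\<close> and \<open>B\<close>, for extended values. If these are chosen as
  the norms of two functions, then integration yields the inequality of Hoelder.
\<close>

lemma Youngs_inequality_epow:
  assumes p: "1 < p" "1 < p'" "1 / p + 1 / p' = 1" and AB: "0 < A" "0 < B"
  shows "x * y \<le> ennreal (A * B) * (epow x p / ennreal (p * A powr p) + epow y p' / ennreal (p' * B powr p'))"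
proof (cases "x = \<infinity> \<or> y = \<infinity>")
  case True
  have "epow x p / ennreal (p * A powr p) = \<infinity> \<or> epow y p' / ennreal (p' * B powr p') = \<infinity>"
    using True p AB by (auto simp: ennreal_top_divide)
  then have "epow x p / ennreal (p * A powr p) + epow y p' / ennreal (p' * B powr p') = \<infinity>"
    by (auto simp: ennreal_add_eq_top)
  moreover have "ennreal (A * B) * \<infinity> = \<infinity>"
    using AB by (simp add: ennreal_mult_eq_top_iff)
  ultimately show ?thesis by (simp only: infinity_ennreal_def top_greatest)
next
  case False
  then obtain a c where xy: "x = ennreal a" "y = ennreal c" "a \<ge> 0" "c \<ge> 0"
    by (cases x; cases y) auto
  have "(a / A) * (c / B) \<le> (a / A) powr p / p + (c / B) powr p' / p'"
    using p AB xy by (intro Youngs_inequality) auto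
  then have "A * B * ((a / A) * (c / B)) \<le> A * B * ((a / A) powr p / p + (c / B) powr p' / p')"
    using AB by (intro mult_left_mono) auto
  then have "a * c \<le> A * B * (a powr p / (p * A powr p) + c powr p' / (p' * B powr p'))"
    using AB xy by (simp add: powr_divide mult.commute)
  then have "ennreal (a * c) \<le> ennreal (A * B * (a powr p / (p * A powr p) + c powr p' / (p' * B powr p')))"
    by (rule ennreal_leI)
  also have "\<dots> = ennreal (A * B) * (epow x p / ennreal (p * A powr p) + epow y p' / ennreal (p' * B powr p'))"
  proof -
    have 1: "epow x p / ennreal (p * A powr p) = ennreal (a powr p / (p * A powr p))"
      unfolding xy(1) epow_ennreal[OF xy(3)] using AB p by (intro divide_ennreal) auto
    have 2: "epow y p' / ennreal (p' * B powr p') = ennreal (c powr p' / (p' * B powr p'))"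
      unfolding xy(2) epow_ennreal[OF xy(4)] using AB p by (intro divide_ennreal) auto
    have nn: "0 \<le> a powr p / (p * A powr p)" "0 \<le> c powr p' / (p' * B powr p')"
      using AB p by (auto intro!: divide_nonneg_pos)
    have AB': "0 \<le> A * B" using AB by simp
    show ?thesis
      unfolding 1 2 ennreal_plus[OF nn, symmetric] by (rule ennreal_mult[OF AB' add_nonneg_nonneg[OF nn]])
  qed
  finally show ?thesis using xy by (simp add: ennreal_mult)
qed

lemma Hoelder_nn_integral:
  assumes p: "1 < p" "1 < p'" "1 / p + 1 / p' = 1"
    and [measurable]: "f \<in> borel_measurable M" "g \<in> borel_measurable M"
  shows "(\<integral>\<^sup>+x. f x * g x \<partial>M) \<le> epow (\<integral>\<^sup>+x. epow (f x) p \<partial>M) (1 / p) * epow (\<integral>\<^sup>+x. epow (g x) p' \<partial>M) (1 / p')"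
proof -
  define F where "F = (\<integral>\<^sup>+x. epow (f x) p \<partial>M)"
  define G where "G = (\<integral>\<^sup>+x. epow (g x) p' \<partial>M)"
  have [measurable]: "(\<lambda>x. epow (f x) p) \<in> borel_measurable M" "(\<lambda>x. epow (g x) p') \<in> borel_measurable M"
    by measurable
  consider "F = 0" | "G = 0" | "F \<noteq> 0" "G \<noteq> 0" "F = \<infinity> \<or> G = \<infinity>" | "F \<noteq> 0" "G \<noteq> 0" "F \<noteq> \<infinity>" "G \<noteq> \<infinity>"
    by blast
  then show ?thesis
  proof cases
    case 1
    then have "AE x in M. epow (f x) p = 0" unfolding F_def by (subst (asm) nn_integral_0_iff_AE) auto
    then have "(\<integral>\<^sup>+x. f x * g x \<partial>M) = (\<integral>\<^sup>+x. 0 \<partial>M)" by (intro nn_integral_cong_AE) auto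
    then show ?thesis by simp
  next
    case 2
    then have "AE x in M. epow (g x) p' = 0" unfolding G_def by (subst (asm) nn_integral_0_iff_AE) auto
    then have "(\<integral>\<^sup>+x. f x * g x \<partial>M) = (\<integral>\<^sup>+x. 0 \<partial>M)" by (intro nn_integral_cong_AE) auto
    then show ?thesis by simp
  next
    case 3
    then have "epow F (1 / p) * epow G (1 / p') = \<infinity>"
      by (auto simp: ennreal_top_mult ennreal_mult_top)
    then show ?thesis by (simp add: F_def G_def)
  next
    case 4
    then obtain a c where ac: "F = ennreal a" "G = ennreal c" "a > 0" "c > 0"
      by (cases F; cases G) (auto simp: less_le)
    define A where "A = a powr (1 / p)"
    define B where "B = c powr (1 / p')"
    have AB: "A > 0" "B > 0" "A powr p = a" "B powr p' = c"
      using ac p by (auto simp: A_def B_def powr_powr)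
    have "(\<integral>\<^sup>+x. f x * g x \<partial>M) \<le>
        (\<integral>\<^sup>+x. ennreal (A * B) * (epow (f x) p / ennreal (p * A powr p) + epow (g x) p' / ennreal (p' * B powr p')) \<partial>M)"
      by (intro nn_integral_mono Youngs_inequality_epow p AB)
    also have "\<dots> = ennreal (A * B) * (F / ennreal (p * A powr p) + G / ennreal (p' * B powr p'))"
      unfolding F_def G_def by (simp add: nn_integral_cmult nn_integral_add nn_integral_divide)
    also have "F / ennreal (p * A powr p) + G / ennreal (p' * B powr p') = 1"
      using ac p unfolding AB by (simp add: divide_ennreal ennreal_plus[symmetric] del: ennreal_plus)
    finally show ?thesis
      using ac AB by (simp add: F_def[symmetric] G_def[symmetric] epow_ennreal A_def B_def ennreal_mult)
  qed
qed

lemma conjugate_exponents_cases: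
  assumes "1 \<le> q" "1 / q + 1 / q' = (1 :: ennreal)"
  obtains (top) "q = \<infinity>" "q' = 1" | (one) "q = 1" "q' = \<infinity>"
  | (real) p p' where "q = ennreal p" "q' = ennreal p'" "1 < p" "1 < p'" "1 / p + 1 / p' = 1"
proof -
  have inv: "1 / ennreal y = ennreal (1 / y)" if "y > 0" for y
    using divide_ennreal[of 1 y] that by simp
  have q'0: "q' \<noteq> 0" using assms(2) by (auto simp: ennreal_divide_zero)
  show ?thesis
  proof (cases q)
    case top
    then have "1 / q' = 1" using assms(2) by simp
    then have "q' = 1"
      using q'0 inv by (cases q') (auto simp: ennreal_1[symmetric] less_le simp del: ennreal_1)
    then show ?thesis using that(1) top by simp
  next
    case (real x)
    have x: "x \<ge> 1" using assms(1) real by (simp add: ennreal_1[symmetric] del: ennreal_1)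
    show ?thesis
    proof (cases q')
      case top
      then have "ennreal (1 / x) = ennreal 1" using assms(2) inv[of x] real x by simp
      then have "x = 1" using x by (subst (asm) ennreal_inj) auto
      then show ?thesis using that(2) top real by simp
    next
      case (real y)
      then have y: "y > 0" using q'0 by (cases "y = 0") auto
      have "ennreal (1 / x + 1 / y) = ennreal 1"
        using assms(2) inv[of x] inv[OF y] \<open>q = ennreal x\<close> real(2) x y by (simp add: ennreal_plus)
      then have xy: "1 / x + 1 / y = 1" using x y by (subst (asm) ennreal_inj) auto
      have "x \<noteq> 1" using xy y by auto
      then have "x > 1" using x by simp
      moreover have "1 / y < 1" using xy x by (smt (verit) divide_pos_pos)
      then have "y > 1" using y by simp
      ultimately show ?thesis using that(3) \<open>q = ennreal x\<close> real(2) xy by blast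
    qed
  qed
qed

lemma conjugate_exponent_ge_1:
  assumes "1 \<le> q" "1 / q + 1 / q' = (1 :: ennreal)"
  shows "1 \<le> q'"
  using assms by (cases rule: conjugate_exponents_cases)
    (auto simp: ennreal_1[symmetric] ennreal_leI simp del: ennreal_1)

lemma lp_sum_1: "lp_sum 1 A g = (\<Sum>a\<in>A. g a)"
  by (simp add: lp_sum_def epow_1)

lemma lp_sum_top: "lp_sum Orderings.top A g = (SUP a\<in>A. g a)"
  by (simp add: lp_sum_def)

lemma lp_sum_real: "p > 0 \<Longrightarrow> lp_sum (ennreal p) A g = epow (\<Sum>a\<in>A. epow (g a) p) (1 / p)"
  by (simp add: lp_sum_def)

lemma Hoelder_lp_sum:
  assumes A: "finite A" and q: "1 \<le> q" "1 / q + 1 / q' = (1 :: ennreal)"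
  shows "(\<Sum>a\<in>A. f a * g a) \<le> lp_sum q A f * lp_sum q' A g"
  using q
proof (cases rule: conjugate_exponents_cases)
  case top
  have "(\<Sum>a\<in>A. f a * g a) \<le> (\<Sum>a\<in>A. (SUP a\<in>A. f a) * g a)"
    by (intro sum_mono mult_right_mono SUP_upper) auto
  then show ?thesis by (simp add: top lp_sum_top lp_sum_1 sum_distrib_left)
next
  case one
  have "(\<Sum>a\<in>A. f a * g a) \<le> (\<Sum>a\<in>A. f a * (SUP a\<in>A. g a))"
    by (intro sum_mono mult_left_mono SUP_upper) auto
  then show ?thesis by (simp add: one lp_sum_top lp_sum_1 sum_distrib_right)
next
  case (real p p')
  show ?thesis
    using Hoelder_nn_integral[OF real(3-5), of f "count_space A" g] A real
    by (simp add: lp_sum_real nn_integral_count_space_finite)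
qed

lemma lp_sum_mono_set:
  assumes "finite B" "A \<subseteq> B" "1 \<le> q"
  shows "lp_sum q A g \<le> lp_sum q B g"
proof (cases "q = \<infinity>")
  case True
  then show ?thesis using assms by (simp add: lp_sum_top SUP_subset_mono)
next
  case False
  then show ?thesis
    using assms by (auto simp: lp_sum_def intro!: epow_mono sum_mono2)
qed

lemma lp_sum_singleton_le:
  assumes "finite B" "a \<in> B" "1 \<le> q"
  shows "g a \<le> lp_sum q B g"
proof -
  have "g a = lp_sum q {a} g"
  proof (cases q)
    case (real x)
    then have "x > 0" using assms(3) by (cases "x = 0") auto
    then show ?thesis using real by (simp add: lp_sum_real epow_inverse)
  qed (simp add: lp_sum_def)
  also have "\<dots> \<le> lp_sum q B g" using assms by (intro lp_sum_mono_set) auto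
  finally show ?thesis .
qed

lemma lp_sum_const_1_le:
  assumes "finite B" "1 \<le> q"
  shows "lp_sum q B (\<lambda>_. 1) \<le> ennreal (real (card B) powr enn2real (1 / q))"
proof (cases q)
  case (real x)
  then have x: "x > 0" using assms(2) by (cases "x = 0") auto
  then have "enn2real (1 / q) = 1 / x"
    using real divide_ennreal[of 1 x] by simp
  moreover have "epow (1::ennreal) x = 1" using epow_ennreal[of 1 x] by simp
  ultimately show ?thesis
    using real x by (simp add: lp_sum_real epow_ennreal ennreal_of_nat_eq_real_of_nat)
next
  case top
  then show ?thesis
    by (cases "B = {}") (auto simp: lp_sum_def card_gt_0_iff assms(1) bot_ennreal)
qed

text \<open>
  The inner norms of \<open>sobolev_term\<close>, one for each marginal.
\<close>

definition lp_norm :: "ennreal \<Rightarrow> 'a measure \<Rightarrow> ('a \<Rightarrow> ennreal) \<Rightarrow> ennreal" where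
  "lp_norm q M m = (if q = \<infinity> then esssup M m else epow (\<integral>\<^sup>+y. epow (m y) (enn2real q) \<partial>M) (1 / enn2real q))"

lemma nn_integral_le_lp_norm:
  assumes "prob_space M" and q: "1 \<le> q" and [measurable]: "m \<in> borel_measurable M"
  shows "(\<integral>\<^sup>+y. m y \<partial>M) \<le> lp_norm q M m"
proof -
  interpret prob_space M by fact
  show ?thesis
  proof (cases q)
    case top
    have "(\<integral>\<^sup>+y. m y \<partial>M) \<le> (\<integral>\<^sup>+y. esssup M m \<partial>M)"
      by (rule nn_integral_mono_AE) (rule esssup_AE)
    then show ?thesis using top by (simp add: lp_norm_def emeasure_space_1)
  next
    case (real p)
    have p: "p \<ge> 1" using q real by (simp add: ennreal_1[symmetric] del: ennreal_1)
    show ?thesis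
    proof (cases "p = 1")
      case True
      then show ?thesis using real by (simp add: lp_norm_def epow_1)
    next
      case False
      define p' where "p' = p / (p - 1)"
      have p': "1 < p" "1 < p'" "1 / p + 1 / p' = 1"
        using p False by (auto simp: p'_def field_simps)
      have "epow (1::ennreal) t = 1" for t using epow_ennreal[of 1 t] by simp
      then show ?thesis
        using Hoelder_nn_integral[OF p', of m M "\<lambda>_. 1"] real p
        by (simp add: lp_norm_def emeasure_space_1)
    qed
  qed
qed

section \<open>Marginals of the mixed derivatives\<close>

text \<open>
  The coordinates in which the kernel index \<open>c\<close> selects the remainder. Only on these does the kernel
  depend on the integration variable.
\<close>

definition full_order :: "nat \<Rightarrow> nat set \<Rightarrow> (nat \<Rightarrow> nat) \<Rightarrow> nat set" where
  "full_order \<alpha> u c = {j \<in> u. c j = \<alpha> + 1}"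

definition marginal_of ::
    "nat \<Rightarrow> nat \<Rightarrow> ((nat \<Rightarrow> real) \<Rightarrow> real) \<Rightarrow> nat set \<Rightarrow> (nat \<Rightarrow> nat) \<Rightarrow> (nat \<Rightarrow> real) \<Rightarrow> ennreal" where
  "marginal_of s \<alpha> f u c =
     marginal_deriv s \<alpha> f u (full_order \<alpha> u c) (restrict c (u - full_order \<alpha> u c))"

lemma full_order_subset: "full_order \<alpha> u c \<subseteq> u"
  by (auto simp: full_order_def)

lemma deriv_order_eq_order_of:
  assumes "c \<in> kernel_indices \<alpha> u"
  shows "deriv_order \<alpha> u (full_order \<alpha> u c) (restrict c (u - full_order \<alpha> u c)) = order_of \<alpha> u c"
proof
  fix j
  have "c j \<le> \<alpha> + 1" if "j \<in> u" using PiE_mem[OF assms that] by simp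
  then show "deriv_order \<alpha> u (full_order \<alpha> u c) (restrict c (u - full_order \<alpha> u c)) j = order_of \<alpha> u c j"
    by (auto simp: deriv_order_def order_of_def full_order_def le_Suc_eq)
qed

lemma restrict_kernel_index:
  assumes "c \<in> kernel_indices \<alpha> u"
  shows "restrict c (u - full_order \<alpha> u c) \<in> (u - full_order \<alpha> u c) \<rightarrow>\<^sub>E {1..\<alpha>}"
proof -
  have "c j \<in> {1..\<alpha>}" if "j \<in> u - full_order \<alpha> u c" for j
    using that PiE_mem[OF assms, of j] by (auto simp: full_order_def le_Suc_eq)
  then show ?thesis by auto
qed

text \<open>
  The pair \<open>(v, \<tau>)\<close> in the definition of the norm corresponds to the kernel index that is \<open>\<alpha> + 1\<close> on
  \<open>v\<close> and \<open>\<tau>\<close> on \<open>u - v\<close>.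
\<close>

lemma sum_over_kernel_indices_le:
  fixes G :: "nat set \<Rightarrow> (nat \<Rightarrow> nat) \<Rightarrow> ennreal"
  assumes u: "finite u"
  shows "(\<Sum>c\<in>kernel_indices \<alpha> u. G (full_order \<alpha> u c) (restrict c (u - full_order \<alpha> u c))) \<le>
    (\<Sum>v\<in>Pow u. \<Sum>\<tau>\<in>(u - v) \<rightarrow>\<^sub>E {1..\<alpha>}. G v \<tau>)"
proof -
  define P where "P = (SIGMA v:Pow u. (u - v) \<rightarrow>\<^sub>E {1..\<alpha>})"
  define w where "w c = (full_order \<alpha> u c, restrict c (u - full_order \<alpha> u c))" for c
  have "finite P" unfolding P_def using u by (intro finite_SigmaI finite_PiE) auto
  moreover have "w ` kernel_indices \<alpha> u \<subseteq> P"
    using restrict_kernel_index full_order_subset by (fastforce simp: w_def P_def)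
  moreover have "inj_on w (kernel_indices \<alpha> u)"
  proof (rule inj_onI)
    fix c d assume c: "c \<in> kernel_indices \<alpha> u" and d: "d \<in> kernel_indices \<alpha> u" and "w c = w d"
    then have fo: "full_order \<alpha> u c = full_order \<alpha> u d"
      and re: "restrict c (u - full_order \<alpha> u c) = restrict d (u - full_order \<alpha> u c)"
      by (auto simp: w_def)
    show "c = d"
    proof (rule PiE_ext[OF c d])
      fix j assume j: "j \<in> u"
      show "c j = d j"
      proof (cases "j \<in> full_order \<alpha> u c")
        case True
        moreover have "j \<in> full_order \<alpha> u d" using True fo by simp
        ultimately show ?thesis by (simp add: full_order_def)
      next
        case False
        then show ?thesis using fun_cong[OF re, of j] j by simp
      qed
    qed
  qed
  ultimately have "(\<Sum>c\<in>kernel_indices \<alpha> u. case w c of (v, \<tau>) \<Rightarrow> G v \<tau>) \<le> (\<Sum>(v, \<tau>)\<in>P. G v \<tau>)"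
    by (subst sum.reindex[symmetric, unfolded o_def]) (auto intro: sum_mono2)
  also have "\<dots> = (\<Sum>v\<in>Pow u. \<Sum>\<tau>\<in>(u - v) \<rightarrow>\<^sub>E {1..\<alpha>}. G v \<tau>)"
    unfolding P_def using u by (intro sum.Sigma[symmetric] ballI finite_PiE) auto
  finally show ?thesis by (simp add: w_def)
qed

lemma finite_kernel_indices: "finite u \<Longrightarrow> finite (kernel_indices \<alpha> u)"
  by (intro finite_PiE) auto

lemma card_kernel_indices: "finite u \<Longrightarrow> card (kernel_indices \<alpha> u) = (\<alpha> + 1) ^ card u"
  by (simp add: card_PiE)

lemma integrable_merge:
  fixes g :: "(nat \<Rightarrow> real) \<Rightarrow> real"
  assumes v: "v \<subseteq> {1..s}" and g: "integrable (cube {1..s}) g"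
  shows "integrable (cube v \<Otimes>\<^sub>M cube ({1..s} - v)) (\<lambda>p. g (merge v ({1..s} - v) p))"
proof -
  interpret product_prob_space "\<lambda>_::nat. U01" UNIV by (rule product_prob_space_U01)
  have un: "v \<union> ({1..s} - v) = {1..s}" using v by auto
  have fin: "finite v" using v finite_subset by blast
  have "distr (cube v \<Otimes>\<^sub>M cube ({1..s} - v)) (cube {1..s}) (merge v ({1..s} - v)) = cube {1..s}"
    using distr_merge[of v "{1..s} - v"] fin un by (simp add: cube_eq)
  moreover have "merge v ({1..s} - v) \<in> measurable (cube v \<Otimes>\<^sub>M cube ({1..s} - v)) (cube {1..s})"
    using measurable_merge[of v "{1..s} - v" "\<lambda>_. U01"] un by (simp add: cube_eq)
  ultimately show ?thesis using g by (metis integrable_distr)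
qed

lemma measurable_marginal:
  fixes g :: "(nat \<Rightarrow> real) \<Rightarrow> real"
  assumes v: "v \<subseteq> {1..s}" and g: "integrable (cube {1..s}) g"
  shows "(\<lambda>y. LINT z|cube ({1..s} - v). g (merge v ({1..s} - v) (y, z))) \<in> borel_measurable (cube v)"
proof -
  interpret A: prob_space "cube v" by (rule prob_space_cube)
  interpret B: prob_space "cube ({1..s} - v)" by (rule prob_space_cube)
  interpret P: pair_prob_space "cube v" "cube ({1..s} - v)" ..
  show ?thesis
    using P.integrable_fst'[OF integrable_merge[OF v g]] by (rule borel_measurable_integrable)
qed

text \<open>
  A factor that depends only on some coordinates can be integrated against the marginal in these
  coordinates. This is why the norm needs to contain only marginals of the derivatives.
\<close>

lemma integral_mult_marginal_le:
  fixes g K :: "(nat \<Rightarrow> real) \<Rightarrow> real"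
  assumes v: "v \<subseteq> {1..s}" and g: "integrable (cube {1..s}) g"
    and K: "K \<in> borel_measurable (cube {1..s})" "\<And>x. \<bar>K x\<bar> \<le> B"
    and dep: "\<And>x x'. (\<And>j. j \<in> v \<Longrightarrow> x j = x' j) \<Longrightarrow> K x = K x'"
  shows "ennreal \<bar>LINT x|cube {1..s}. g x * K x\<bar> \<le>
    ennreal B * (\<integral>\<^sup>+y. ennreal \<bar>LINT z|cube ({1..s} - v). g (merge v ({1..s} - v) (y, z))\<bar> \<partial>cube v)"
proof -
  interpret product_prob_space "\<lambda>_::nat. U01" UNIV by (rule product_prob_space_U01)
  define G where "G y = (LINT z|cube ({1..s} - v). g (merge v ({1..s} - v) (y, z)))" for y
  have G [measurable]: "G \<in> borel_measurable (cube v)"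
    unfolding G_def by (rule measurable_marginal[OF v g])
  have un: "v \<union> ({1..s} - v) = {1..s}" using v by auto
  have fin: "finite v" using v finite_subset by blast
  have gK: "integrable (cube {1..s}) (\<lambda>x. g x * K x)"
    by (rule integrable_mult_bounded[OF g K(1), of B]) (rule K(2))
  have "(LINT x|cube {1..s}. g x * K x) =
      (LINT y|cube v. LINT z|cube ({1..s} - v). g (merge v ({1..s} - v) (y, z)) * K (merge v ({1..s} - v) (y, z)))"
    using product_integral_fold[of v "{1..s} - v" "\<lambda>x. g x * K x"] fin gK un by (simp add: cube_eq)
  also have "\<dots> = (LINT y|cube v. G y * K y)"
  proof (rule Bochner_Integration.integral_cong[OF refl])
    fix y
    have "K (merge v ({1..s} - v) (y, z)) = K y" for z by (rule dep) (simp add: merge_def)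
    then show "(LINT z|cube ({1..s} - v). g (merge v ({1..s} - v) (y, z)) * K (merge v ({1..s} - v) (y, z))) = G y * K y"
      by (simp add: G_def)
  qed
  finally have eq: "(LINT x|cube {1..s}. g x * K x) = (LINT y|cube v. G y * K y)" .
  have "ennreal \<bar>LINT y|cube v. G y * K y\<bar> \<le> (\<integral>\<^sup>+y. ennreal \<bar>G y * K y\<bar> \<partial>cube v)"
  proof (cases "integrable (cube v) (\<lambda>y. G y * K y)")
    case True
    then show ?thesis using integral_norm_bound_ennreal[OF True] by simp
  qed (simp add: not_integrable_integral_eq)
  also have "\<dots> \<le> (\<integral>\<^sup>+y. ennreal B * ennreal \<bar>G y\<bar> \<partial>cube v)"
  proof (rule nn_integral_mono)
    fix y
    have "0 \<le> B" using K(2)[of y] by linarith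
    moreover have "\<bar>G y * K y\<bar> \<le> B * \<bar>G y\<bar>"
      using mult_left_mono[OF K(2)[of y], of "\<bar>G y\<bar>"] by (simp add: abs_mult mult.commute)
    ultimately show "ennreal \<bar>G y * K y\<bar> \<le> ennreal B * ennreal \<bar>G y\<bar>"
      by (simp add: ennreal_mult[symmetric] ennreal_leI)
  qed
  also have "\<dots> = ennreal B * (\<integral>\<^sup>+y. ennreal \<bar>G y\<bar> \<partial>cube v)"
    by (rule nn_integral_cmult) measurable
  finally show ?thesis unfolding eq G_def .
qed

context
  fixes s \<alpha> :: nat and f :: "(nat \<Rightarrow> real) \<Rightarrow> real" and u :: "nat set" and \<gamma> :: "nat set \<Rightarrow> real" and q q' :: ennreal
  assumes D: "is_mixed_derivs s \<alpha> f (mixed_deriv s \<alpha> f)" and u: "u \<subseteq> {1..s}"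
    and q: "1 \<le> q" "1 / q + 1 / q' = (1 :: ennreal)"
    and \<gamma>: "0 \<le> \<gamma> u" and fin_term: "sobolev_term s \<alpha> \<gamma> q f u \<noteq> Orderings.top"
begin

lemma marginal_of_eq:
  assumes "c \<in> kernel_indices \<alpha> u"
  shows "marginal_of s \<alpha> f u c y = ennreal \<bar>LINT z|cube ({1..s} - full_order \<alpha> u c).
    mixed_deriv s \<alpha> f (order_of \<alpha> u c) (merge (full_order \<alpha> u c) ({1..s} - full_order \<alpha> u c) (y, z))\<bar>"
  by (simp only: marginal_of_def marginal_deriv_def deriv_order_eq_order_of[OF assms])

lemma measurable_marginal_of:
  assumes "c \<in> kernel_indices \<alpha> u"
  shows "marginal_of s \<alpha> f u c \<in> borel_measurable (cube (full_order \<alpha> u c))"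
proof -
  have int: "integrable (cube {1..s}) (mixed_deriv s \<alpha> f (order_of \<alpha> u c))"
    using D order_of_in_multi_orders[OF u] unfolding is_mixed_derivs_def by blast
  have sub: "full_order \<alpha> u c \<subseteq> {1..s}" using full_order_subset u by blast
  note [measurable] = measurable_marginal[OF sub int]
  show ?thesis
    unfolding marginal_of_eq[OF assms, abs_def] by measurable
qed

text \<open>
  Multiplication with the weight undoes the scaling, also if the weight is zero: then the finiteness
  of the term forces all marginals to vanish.
\<close>

lemma lp_sum_marginals_le:
  "lp_sum q (kernel_indices \<alpha> u) (\<lambda>c. lp_norm q (cube (full_order \<alpha> u c)) (marginal_of s \<alpha> f u c))
    \<le> ennreal (\<gamma> u) * sobolev_term s \<alpha> \<gamma> q f u"
proof -
  have fin: "finite u" using u finite_subset by blast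
  define X where "X = lp_sum q (kernel_indices \<alpha> u) (\<lambda>c. lp_norm q (cube (full_order \<alpha> u c)) (marginal_of s \<alpha> f u c))"
  have "inverse (ennreal (\<gamma> u)) * X \<le> sobolev_term s \<alpha> \<gamma> q f u"
  proof (cases q)
    case top
    have "X \<le> (SUP v\<in>Pow u. SUP \<tau>\<in>(u - v) \<rightarrow>\<^sub>E {1..\<alpha>}. esssup (cube v) (marginal_deriv s \<alpha> f u v \<tau>))"
      unfolding X_def top lp_sum_top
    proof (rule SUP_least)
      fix c assume c: "c \<in> kernel_indices \<alpha> u"
      have 1: "full_order \<alpha> u c \<in> Pow u" using full_order_subset by blast
      have 2: "restrict c (u - full_order \<alpha> u c) \<in> (u - full_order \<alpha> u c) \<rightarrow>\<^sub>E {1..\<alpha>}"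
        by (rule restrict_kernel_index[OF c])
      have "lp_norm Orderings.top (cube (full_order \<alpha> u c)) (marginal_of s \<alpha> f u c) =
          esssup (cube (full_order \<alpha> u c)) (marginal_deriv s \<alpha> f u (full_order \<alpha> u c) (restrict c (u - full_order \<alpha> u c)))"
        by (simp add: lp_norm_def marginal_of_def)
      also have "\<dots> \<le> (SUP v\<in>Pow u. SUP \<tau>\<in>(u - v) \<rightarrow>\<^sub>E {1..\<alpha>}. esssup (cube v) (marginal_deriv s \<alpha> f u v \<tau>))"
        by (rule SUP_upper2[OF 1], rule SUP_upper[OF 2])
      finally show "lp_norm Orderings.top (cube (full_order \<alpha> u c)) (marginal_of s \<alpha> f u c) \<le>
          (SUP v\<in>Pow u. SUP \<tau>\<in>(u - v) \<rightarrow>\<^sub>E {1..\<alpha>}. esssup (cube v) (marginal_deriv s \<alpha> f u v \<tau>))" .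
    qed
    then show ?thesis unfolding sobolev_term_def top by (auto intro: mult_left_mono)
  next
    case (real p)
    have p: "p > 0" using q(1) real by (cases "p = 0") auto
    define Y where "Y = (\<Sum>c\<in>kernel_indices \<alpha> u. \<integral>\<^sup>+ y. epow (marginal_of s \<alpha> f u c y) p \<partial>cube (full_order \<alpha> u c))"
    have "X = epow Y (1 / p)"
      using epow_epow[of _ "1 / p" p] p real by (simp add: X_def Y_def lp_sum_real lp_norm_def epow_1)
    moreover have "inverse (ennreal (\<gamma> u)) * epow Y (1 / p) = epow (epow (inverse (ennreal (\<gamma> u))) p * Y) (1 / p)"
      using p by (simp only: epow_mult epow_inverse)
    moreover have "\<dots> \<le> sobolev_term s \<alpha> \<gamma> q f u"
      unfolding sobolev_term_def Y_def marginal_of_def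
      using real p sum_over_kernel_indices_le[OF fin, where \<alpha> = \<alpha> and
          G = "\<lambda>v \<tau>. \<integral>\<^sup>+ y. epow (marginal_deriv s \<alpha> f u v \<tau> y) p \<partial>cube v"]
      by (auto intro!: epow_mono mult_left_mono)
    ultimately show ?thesis by simp
  qed
  then have le: "ennreal (\<gamma> u) * (inverse (ennreal (\<gamma> u)) * X) \<le> ennreal (\<gamma> u) * sobolev_term s \<alpha> \<gamma> q f u"
    by (rule mult_left_mono) simp
  have "X \<le> ennreal (\<gamma> u) * sobolev_term s \<alpha> \<gamma> q f u"
  proof (cases "\<gamma> u = 0")
    case True
    have "inverse (ennreal (\<gamma> u)) * X \<noteq> Orderings.top"
      using \<open>inverse (ennreal (\<gamma> u)) * X \<le> sobolev_term s \<alpha> \<gamma> q f u\<close> fin_term by (auto simp: top_unique)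
    then have "X = 0" using True by (simp add: ennreal_top_mult split: if_splits)
    then show ?thesis by simp
  next
    case False
    then have "ennreal (\<gamma> u) * inverse (ennreal (\<gamma> u)) = 1"
      using \<gamma> by (simp add: inverse_ennreal ennreal_mult[symmetric])
    then show ?thesis using le by (simp add: mult.assoc[symmetric])
  qed
  then show ?thesis by (simp only: X_def)
qed

lemma marginal_integral_le:
  assumes c: "c \<in> kernel_indices \<alpha> u"
  shows "(\<integral>\<^sup>+y. marginal_of s \<alpha> f u c y \<partial>cube (full_order \<alpha> u c)) \<le> ennreal (\<gamma> u) * sobolev_term s \<alpha> \<gamma> q f u"
proof -
  have fin: "finite u" using u finite_subset by blast
  have "(\<integral>\<^sup>+y. marginal_of s \<alpha> f u c y \<partial>cube (full_order \<alpha> u c)) \<le> lp_norm q (cube (full_order \<alpha> u c)) (marginal_of s \<alpha> f u c)"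
    by (intro nn_integral_le_lp_norm prob_space_cube q(1) measurable_marginal_of c)
  also have "\<dots> \<le> lp_sum q (kernel_indices \<alpha> u) (\<lambda>c. lp_norm q (cube (full_order \<alpha> u c)) (marginal_of s \<alpha> f u c))"
    by (rule lp_sum_singleton_le[OF finite_kernel_indices[OF fin] c q(1)])
  also note lp_sum_marginals_le
  finally show ?thesis .
qed

lemma sum_marginal_integrals_le:
  "(\<Sum>c\<in>kernel_indices \<alpha> u. \<integral>\<^sup>+y. marginal_of s \<alpha> f u c y \<partial>cube (full_order \<alpha> u c)) \<le>
    ennreal (real (\<alpha> + 1) powr (real (card u) * enn2real (1 / q'))) * (ennreal (\<gamma> u) * sobolev_term s \<alpha> \<gamma> q f u)"
proof -
  have fin: "finite (kernel_indices \<alpha> u)" using u finite_subset finite_kernel_indices by blast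
  have finu: "finite u" using u finite_subset by blast
  define L where "L c = lp_norm q (cube (full_order \<alpha> u c)) (marginal_of s \<alpha> f u c)" for c
  have "(\<Sum>c\<in>kernel_indices \<alpha> u. \<integral>\<^sup>+y. marginal_of s \<alpha> f u c y \<partial>cube (full_order \<alpha> u c)) \<le>
      (\<Sum>c\<in>kernel_indices \<alpha> u. 1 * L c)"
    unfolding L_def mult_1
    by (intro sum_mono nn_integral_le_lp_norm prob_space_cube q(1) measurable_marginal_of)
  also have "\<dots> = (\<Sum>c\<in>kernel_indices \<alpha> u. L c * 1)" by simp
  also have "\<dots> \<le> lp_sum q (kernel_indices \<alpha> u) L * lp_sum q' (kernel_indices \<alpha> u) (\<lambda>_. 1)"
    by (rule Hoelder_lp_sum[OF fin q])
  also have "\<dots> \<le> (ennreal (\<gamma> u) * sobolev_term s \<alpha> \<gamma> q f u) *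
      ennreal (real (card (kernel_indices \<alpha> u)) powr enn2real (1 / q'))"
    unfolding L_def by (intro mult_mono lp_sum_marginals_le lp_sum_const_1_le fin conjugate_exponent_ge_1[OF q]) auto
  also have "real (card (kernel_indices \<alpha> u)) powr enn2real (1 / q') =
      real (\<alpha> + 1) powr (real (card u) * enn2real (1 / q'))"
  proof -
    have "real (card (kernel_indices \<alpha> u)) = real (\<alpha> + 1) powr real (card u)"
      unfolding card_kernel_indices[OF finu] by (simp only: of_nat_power) (rule powr_realpow[symmetric], simp)
    then show ?thesis by (simp only: powr_powr)
  qed
  finally show ?thesis by (simp only: mult.commute)
qed

end

section \<open>The worst-case error\<close>

lemma poly_lattice_point_in_cube:
  fixes p :: "'b::prime_card mod_ring poly"
  shows "poly_lattice_point s n p Q h \<in> space (cube {1..s})"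
proof -
  have "v_map n L \<in> {0..<1}" for L :: "'b mod_ring fls"
  proof -
    have "point_index CARD('b) (laurent_digit L) n < CARD('b) ^ n"
      by (intro point_index_less laurent_digit)
    then have "real (point_index CARD('b) (laurent_digit L) n) < real (CARD('b) ^ n)"
      by (subst of_nat_less_iff)
    then show ?thesis unfolding v_map_eq_point_index by simp
  qed
  then show ?thesis by (simp add: poly_lattice_point_def space_cube)
qed

text \<open>
  The same expansion, sorted by the set \<open>u\<close> of coordinates in which the kernel is not the mean.
\<close>

lemma bernoulli_expansion_subsets:
  assumes D: "is_mixed_derivs s \<alpha> f D" and \<alpha>: "\<alpha> \<ge> 1" and y: "y \<in> space (cube {1..s})"
  shows "f y = (\<Sum>u\<in>Pow {1..s}. \<Sum>c\<in>kernel_indices \<alpha> u. LINT x|cube {1..s}. D (order_of \<alpha> u c) x *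
      kernel_prod \<alpha> u c x y)"
proof -
  define S where "S = {1..s}"
  define G where "G u c = (LINT x|cube S. D (order_of \<alpha> u c) x * kernel_prod \<alpha> u c x y)" for u c
  define ext where "ext u c = (\<lambda>j\<in>S. if j \<in> u then c j else 0 :: nat)" for u c
  have G: "G S (ext u c) = G u c" if "u \<subseteq> S" for u c
  proof -
    have "order_of \<alpha> S (ext u c) = order_of \<alpha> u c"
      using that by (auto simp: order_of_def ext_def fun_eq_iff)
    moreover have "(\<Prod>j\<in>S. rep_kernel \<alpha> (ext u c j) (x j) (y j)) = (kernel_prod \<alpha> u c x y)" for x
      using that by (intro prod.mono_neutral_cong_right) (auto simp: S_def ext_def rep_kernel_def)
    ultimately show ?thesis by (simp only: G_def)
  qed
  have "(\<Sum>u\<in>Pow S. \<Sum>c\<in>kernel_indices \<alpha> u. G u c) = (\<Sum>(u, c)\<in>(SIGMA u:Pow S. kernel_indices \<alpha> u). G u c)"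
    by (intro sum.Sigma ballI finite_kernel_indices) (auto simp: S_def intro: finite_subset)
  also have "\<dots> = (\<Sum>c\<in>S \<rightarrow>\<^sub>E {0..\<alpha> + 1}. G S c)"
  proof (rule sum.reindex_bij_witness[where
        i = "\<lambda>c. ({j \<in> S. c j \<noteq> 0}, restrict c {j \<in> S. c j \<noteq> 0})" and j = "\<lambda>(u, c). ext u c"])
    fix p assume "p \<in> (SIGMA u:Pow S. kernel_indices \<alpha> u)"
    then obtain u c where p: "p = (u, c)" and u: "u \<subseteq> S" and c: "c \<in> kernel_indices \<alpha> u" by auto
    have supp: "{j \<in> S. ext u c j \<noteq> 0} = u"
    proof -
      have "ext u c j \<noteq> 0 \<longleftrightarrow> j \<in> u" if "j \<in> S" for j
        using that PiE_mem[OF c, of j] by (auto simp: ext_def)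
      then show ?thesis using u by blast
    qed
    have "restrict (ext u c) u = c"
      using u PiE_arb[OF c] by (auto simp: ext_def fun_eq_iff restrict_def)
    then show "(\<lambda>c. ({j \<in> S. c j \<noteq> 0}, restrict c {j \<in> S. c j \<noteq> 0})) ((\<lambda>(u, c). ext u c) p) = p"
      by (simp only: p prod.case supp)
    show "(\<lambda>(u, c). ext u c) p \<in> S \<rightarrow>\<^sub>E {0..\<alpha> + 1}"
      using PiE_mem[OF c] by (auto simp: p ext_def)
    show "G S ((\<lambda>(u, c). ext u c) p) = (case p of (u, c) \<Rightarrow> G u c)"
      using G[OF u] by (simp add: p)
  next
    fix c assume c: "c \<in> S \<rightarrow>\<^sub>E {0..\<alpha> + 1}"
    show "(\<lambda>(u, c). ext u c) ({j \<in> S. c j \<noteq> 0}, restrict c {j \<in> S. c j \<noteq> 0}) = c"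
      using PiE_arb[OF c] by (auto simp: ext_def fun_eq_iff restrict_def)
    have "1 \<le> c j \<and> c j \<le> \<alpha> + 1" if "j \<in> S" "c j \<noteq> 0" for j using PiE_mem[OF c that(1)] that(2) by auto
    then show "({j \<in> S. c j \<noteq> 0}, restrict c {j \<in> S. c j \<noteq> 0}) \<in> (SIGMA u:Pow S. kernel_indices \<alpha> u)"
      by auto
  qed
  also have "\<dots> = f y"
    unfolding G_def S_def by (rule bernoulli_expansion_cube[OF D \<alpha> y, symmetric])
  finally show ?thesis by (simp only: G_def S_def)
qed

text \<open>
  For \<open>u = {}\<close> the kernel is constant and the coefficients add up to one, so this term of the expansion
  cancels against the integral.
\<close>

lemma extrapolated_error_eq:
  fixes a :: "nat \<Rightarrow> real" and N :: "nat \<Rightarrow> nat" and X :: "nat \<Rightarrow> nat \<Rightarrow> nat \<Rightarrow> real"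
  assumes D: "is_mixed_derivs s \<alpha> f D" and \<alpha>: "\<alpha> \<ge> 1"
    and N: "\<And>\<tau>. \<tau> \<in> I \<Longrightarrow> N \<tau> > 0" and X: "\<And>\<tau> h. X \<tau> h \<in> space (cube {1..s})"
    and a: "sum a I = 1"
  shows "(\<Sum>\<tau>\<in>I. a \<tau> * qmc (N \<tau>) (X \<tau>) f) - cube_integral s f =
    (\<Sum>u\<in>Pow {1..s} - {{}}. \<Sum>c\<in>kernel_indices \<alpha> u. LINT x|cube {1..s}. D (order_of \<alpha> u c) x *
      (\<Sum>\<tau>\<in>I. a \<tau> * ((\<Sum>h<N \<tau>. kernel_prod \<alpha> u c x (X \<tau> h)) / real (N \<tau>))))"
proof -
  define G where "G u c y = (LINT x|cube {1..s}. D (order_of \<alpha> u c) x * kernel_prod \<alpha> u c x y)" for u c y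
  define E where "E u c = (LINT x|cube {1..s}. D (order_of \<alpha> u c) x *
      (\<Sum>\<tau>\<in>I. a \<tau> * ((\<Sum>h<N \<tau>. kernel_prod \<alpha> u c x (X \<tau> h)) / real (N \<tau>))))" for u c
  have GE: "(\<Sum>\<tau>\<in>I. a \<tau> * ((\<Sum>h<N \<tau>. G u c (X \<tau> h)) / real (N \<tau>))) = E u c" if u: "u \<subseteq> {1..s}" for u c
  proof -
    have Dint: "integrable (cube {1..s}) (D (order_of \<alpha> u c))"
      using D order_of_in_multi_orders[OF u] unfolding is_mixed_derivs_def by blast
    have int: "integrable (cube {1..s}) (\<lambda>x. D (order_of \<alpha> u c) x * kernel_prod \<alpha> u c x y)" for y
      by (rule integrable_mult_bounded[OF Dint measurable_prod_rep_kernel[OF u] abs_prod_rep_kernel_le[OF \<alpha>]])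
    have "E u c = (LINT x|cube {1..s}. (\<Sum>\<tau>\<in>I. \<Sum>h<N \<tau>. a \<tau> / real (N \<tau>) *
        (D (order_of \<alpha> u c) x * (kernel_prod \<alpha> u c x (X \<tau> h)))))"
      unfolding E_def by (intro Bochner_Integration.integral_cong refl)
        (simp add: sum_distrib_left sum_divide_distrib mult_ac)
    also have "\<dots> = (\<Sum>\<tau>\<in>I. \<Sum>h<N \<tau>. a \<tau> / real (N \<tau>) * G u c (X \<tau> h))"
      using int by (simp add: G_def)
    finally show ?thesis
      by (simp add: sum_distrib_left sum_divide_distrib)
  qed
  have expansion: "f y = (\<Sum>u\<in>Pow {1..s}. \<Sum>c\<in>kernel_indices \<alpha> u. G u c y)" if "y \<in> space (cube {1..s})" for y
    unfolding G_def by (rule bernoulli_expansion_subsets[OF D \<alpha> that])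
  have qmc: "qmc (N \<tau>) (X \<tau>) f = (\<Sum>u\<in>Pow {1..s}. \<Sum>c\<in>kernel_indices \<alpha> u. \<Sum>h<N \<tau>. G u c (X \<tau> h)) / real (N \<tau>)" for \<tau>
  proof -
    have "(\<Sum>h<N \<tau>. f (X \<tau> h)) = (\<Sum>h<N \<tau>. \<Sum>u\<in>Pow {1..s}. \<Sum>c\<in>kernel_indices \<alpha> u. G u c (X \<tau> h))"
      by (intro sum.cong refl expansion X)
    also have "\<dots> = (\<Sum>u\<in>Pow {1..s}. \<Sum>h<N \<tau>. \<Sum>c\<in>kernel_indices \<alpha> u. G u c (X \<tau> h))"
      by (rule sum.swap)
    also have "\<dots> = (\<Sum>u\<in>Pow {1..s}. \<Sum>c\<in>kernel_indices \<alpha> u. \<Sum>h<N \<tau>. G u c (X \<tau> h))"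
      by (intro sum.cong refl sum.swap)
    finally show ?thesis by (simp only: qmc_def)
  qed
  have "(\<Sum>\<tau>\<in>I. a \<tau> * qmc (N \<tau>) (X \<tau>) f) =
      (\<Sum>\<tau>\<in>I. \<Sum>u\<in>Pow {1..s}. \<Sum>c\<in>kernel_indices \<alpha> u. a \<tau> * ((\<Sum>h<N \<tau>. G u c (X \<tau> h)) / real (N \<tau>)))"
    by (simp only: qmc sum_divide_distrib sum_distrib_left)
  also have "\<dots> = (\<Sum>u\<in>Pow {1..s}. \<Sum>c\<in>kernel_indices \<alpha> u. \<Sum>\<tau>\<in>I. a \<tau> * ((\<Sum>h<N \<tau>. G u c (X \<tau> h)) / real (N \<tau>)))"
  proof -
    have "\<dots> = (\<Sum>u\<in>Pow {1..s}. \<Sum>\<tau>\<in>I. \<Sum>c\<in>kernel_indices \<alpha> u. a \<tau> * ((\<Sum>h<N \<tau>. G u c (X \<tau> h)) / real (N \<tau>)))"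
      by (rule sum.swap)
    also have "\<dots> = (\<Sum>u\<in>Pow {1..s}. \<Sum>c\<in>kernel_indices \<alpha> u. \<Sum>\<tau>\<in>I. a \<tau> * ((\<Sum>h<N \<tau>. G u c (X \<tau> h)) / real (N \<tau>)))"
      by (intro sum.cong refl sum.swap)
    finally show ?thesis .
  qed
  also have "\<dots> = (\<Sum>u\<in>Pow {1..s}. \<Sum>c\<in>kernel_indices \<alpha> u. E u c)"
    by (intro sum.cong refl GE) auto
  also have "\<dots> = (\<Sum>c\<in>kernel_indices \<alpha> {}. E {} c) + (\<Sum>u\<in>Pow {1..s} - {{}}. \<Sum>c\<in>kernel_indices \<alpha> u. E u c)"
    by (rule sum.remove) auto
  also have "(\<Sum>c\<in>kernel_indices \<alpha> {}. E {} c) = cube_integral s f"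
  proof -
    have "E {} c = cube_integral s f" for c
    proof -
      have "order_of \<alpha> {} c = (\<lambda>_. 0)" by (simp add: order_of_def)
      moreover have "(\<Sum>\<tau>\<in>I. a \<tau> * ((\<Sum>h<N \<tau>. 1) / real (N \<tau>))) = 1"
      proof -
        have "(\<Sum>\<tau>\<in>I. a \<tau> * ((\<Sum>h<N \<tau>. 1) / real (N \<tau>))) = sum a I"
        proof (rule sum.cong[OF refl])
          fix \<tau> assume "\<tau> \<in> I"
          then have "N \<tau> \<noteq> 0" using N by blast
          then show "a \<tau> * ((\<Sum>h<N \<tau>. 1) / real (N \<tau>)) = a \<tau>" by simp
        qed
        then show ?thesis using a by simp
      qed
      ultimately have "E {} c = (LINT x|cube {1..s}. D (\<lambda>_. 0) x)"
        by (simp add: E_def del: sum_constant)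
      also have "\<dots> = cube_integral s f"
        unfolding cube_integral_def
        using D by (intro Bochner_Integration.integral_cong refl) (auto simp: is_mixed_derivs_def)
      finally show ?thesis .
    qed
    then show ?thesis by simp
  qed
  finally show ?thesis by (simp add: E_def)
qed

theorem theorem1:
  fixes b \<alpha> s m :: nat
    and q r q' r' :: ennreal
    and \<gamma> :: "nat set \<Rightarrow> real"
    and p :: "nat \<Rightarrow> 'b::prime_card mod_ring poly"
    and Q :: "nat \<Rightarrow> nat \<Rightarrow> 'b mod_ring poly"
  assumes "b = CARD('b)"
    and "2 \<le> \<alpha>" and "1 \<le> s"
    and "1 \<le> q" and "1 \<le> r" and "1 / q + 1 / q' = 1" and "1 / r + 1 / r' = 1"
    and "\<And>u. finite u \<Longrightarrow> u \<subseteq> {1..} \<Longrightarrow> 0 \<le> \<gamma> u"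
    and "\<alpha> \<le> m"
    and "\<And>n. n \<in> {m - \<alpha> + 1..m} \<Longrightarrow> Polynomial.degree (p n) = n"
    and "\<And>n j. n \<in> {m - \<alpha> + 1..m} \<Longrightarrow> j \<in> {1..s} \<Longrightarrow> Q n j \<noteq> 0 \<and> Polynomial.degree (Q n j) < n"
  shows "(SUP f\<in>{f \<in> sobolev_space s \<alpha> \<gamma> q r. sobolev_norm s \<alpha> \<gamma> q r f \<le> 1}.
            ennreal \<bar>(\<Sum>\<tau>=1..\<alpha>. extrap_coeff b \<alpha> \<tau> *
                        qmc (b ^ (m - \<tau> + 1))
                            (poly_lattice_point s (m - \<tau> + 1) (p (m - \<tau> + 1)) (Q (m - \<tau> + 1))) f)
                     - cube_integral s f\<bar>)
         \<le> (\<Sum>\<tau>=1..\<alpha>. ennreal \<bar>extrap_coeff b \<alpha> \<tau>\<bar> *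
              (B_bound s \<alpha> \<gamma> r' (m - \<tau> + 1) (p (m - \<tau> + 1)) (Q (m - \<tau> + 1))
               + H_bound s \<alpha> \<gamma> q' r' / ennreal (real b ^ (\<alpha> * (m - \<tau> + 1)))))"
proof (rule SUP_least)
  fix f assume "f \<in> {f \<in> sobolev_space s \<alpha> \<gamma> q r. sobolev_norm s \<alpha> \<gamma> q r f \<le> 1}"
  then have f: "\<exists>D. is_mixed_derivs s \<alpha> f D" "sobolev_norm s \<alpha> \<gamma> q r f \<le> 1"
    by (auto simp: sobolev_space_def)
  define D where "D = mixed_deriv s \<alpha> f"
  have D: "is_mixed_derivs s \<alpha> f D"
    unfolding D_def mixed_deriv_def using f(1) by (rule someI_ex)
  note bdef = \<open>b = CARD('b)\<close>
  have b: "b \<ge> 2" unfolding bdef by (rule card_prime_card_ge_2)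
  have \<alpha>: "\<alpha> \<ge> 2" "\<alpha> \<ge> 1" "\<alpha> \<le> m" using assms by auto
  define a where "a = extrap_coeff b \<alpha>"
  define n where "n \<tau> = m - \<tau> + 1" for \<tau>
  define X where "X \<tau> = poly_lattice_point s (n \<tau>) (p (n \<tau>)) (Q (n \<tau>))" for \<tau>
  define U where "U = Pow {1..s} - {{}}"
  define C where "C u = kernel_indices \<alpha> u" for u :: "nat set"
  have U: "finite U" "u \<in> U \<Longrightarrow> u \<subseteq> {1..s}" "u \<in> U \<Longrightarrow> finite u" "u \<in> U \<Longrightarrow> u \<noteq> {}" for u
    by (auto simp: U_def intro: finite_subset)
  have n: "Polynomial.degree (p (n \<tau>)) = n \<tau>" "p (n \<tau>) \<noteq> 0" if "\<tau> \<in> {1..\<alpha>}" for \<tau>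
  proof -
    show 1: "Polynomial.degree (p (n \<tau>)) = n \<tau>"
      using that \<alpha> by (intro assms(10)) (auto simp: n_def)
    show "p (n \<tau>) \<noteq> 0"
    proof
      assume "p (n \<tau>) = 0"
      then have "n \<tau> = 0" using 1 by (metis degree_0)
      then show False by (simp add: n_def)
    qed
  qed
  have \<gamma>: "0 \<le> \<gamma> u" if "u \<in> U" for u
    by (rule assms(8)[OF U(3)[OF that]]) (use U(2)[OF that] in auto)
  define T where "T u = sobolev_term s \<alpha> \<gamma> q f u" for u
  have lpT: "lp_sum r U T \<le> 1"
  proof -
    have "lp_sum r U T \<le> lp_sum r (Pow {1..s}) T"
      by (rule lp_sum_mono_set) (use assms(5) in \<open>auto simp: U_def\<close>)
    then show ?thesis using f(2) unfolding sobolev_norm_def T_def by (rule order_trans)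
  qed
  have T_fin: "sobolev_term s \<alpha> \<gamma> q f u \<noteq> Orderings.top" if "u \<in> U" for u
  proof -
    have "T u \<le> 1" using lp_sum_singleton_le[OF U(1) that assms(5), of T] lpT by (rule order_trans)
    then show ?thesis by (auto simp: T_def top_unique)
  qed
  note marginal = D[unfolded D_def] U(2) assms(4) assms(6)

  define M where "M u c = (\<integral>\<^sup>+y. marginal_of s \<alpha> f u c y \<partial>cube (full_order \<alpha> u c))" for u c
  define W where "W \<tau> u c = (\<Sum>k\<in>short_dual (n \<tau>) (p (n \<tau>)) (Q (n \<tau>)) u. \<Prod>j\<in>u. kernel_weight b \<alpha> (n \<tau>) (c j) (k j))" for \<tau> u c
  define V where "V \<tau> u = D_const \<alpha> ^ card u / real b ^ (\<alpha> * n \<tau>)" for \<tau> and u :: "nat set"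
  have D0: "0 \<le> D_const \<alpha>" using abs_bern_per_le_D_const[OF \<alpha>(2), of 0] by linarith
  have V0: "0 \<le> V \<tau> u" for \<tau> u using D0 by (simp add: V_def)
  have W0: "0 \<le> W \<tau> u c" for \<tau> u c
    unfolding W_def by (intro sum_nonneg prod_nonneg kernel_weight_nonneg b)

  \<comment> \<open>the kernel is split into the part from the dual lattice and the part from the full grid\<close>
  have single: "ennreal \<bar>LINT x|cube {1..s}. D (order_of \<alpha> u c) x *
      (\<Sum>\<tau>=1..\<alpha>. a \<tau> * ((\<Sum>h<b ^ n \<tau>. kernel_prod \<alpha> u c x (X \<tau> h)) / real (b ^ n \<tau>)))\<bar>
      \<le> ennreal (\<Sum>\<tau>=1..\<alpha>. \<bar>a \<tau>\<bar> * (W \<tau> u c + V \<tau> u)) * M u c"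
    if u: "u \<in> U" and c: "c \<in> C u" for u c
  proof -
    define v where "v = full_order \<alpha> u c"
    have v: "v \<subseteq> {1..s}" unfolding v_def using full_order_subset U(2)[OF u] by (rule order_trans)
    have c': "c j \<in> {1..\<alpha> + 1}" if "j \<in> u" for j using c that by (auto simp: C_def)
    define K where "K x = (\<Sum>\<tau>=1..\<alpha>. a \<tau> * ((\<Sum>h<b ^ n \<tau>. kernel_prod \<alpha> u c x (X \<tau> h)) / real (b ^ n \<tau>)))" for x
    have Dint: "integrable (cube {1..s}) (D (order_of \<alpha> u c))"
      using D order_of_in_multi_orders[OF U(2)[OF u]] unfolding is_mixed_derivs_def by blast
    have "ennreal \<bar>LINT x|cube {1..s}. D (order_of \<alpha> u c) x * K x\<bar> \<le>
      ennreal (\<Sum>\<tau>=1..\<alpha>. \<bar>a \<tau>\<bar> * (W \<tau> u c + V \<tau> u)) *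
      (\<integral>\<^sup>+y. ennreal \<bar>LINT z|cube ({1..s} - v). D (order_of \<alpha> u c) (merge v ({1..s} - v) (y, z))\<bar> \<partial>cube v)"
    proof (rule integral_mult_marginal_le[OF v Dint])
      show "K \<in> borel_measurable (cube {1..s})"
        unfolding K_def
        by (intro borel_measurable_sum borel_measurable_times borel_measurable_divide borel_measurable_const
            measurable_prod_rep_kernel U(2)[OF u])
      show "K x = K x'" if "\<And>j. j \<in> v \<Longrightarrow> x j = x' j" for x x'
      proof -
        have "rep_kernel \<alpha> (c j) (x j) y = rep_kernel \<alpha> (c j) (x' j) y" if "j \<in> u" for j y
          using c'[OF that] \<open>\<And>j. j \<in> v \<Longrightarrow> x j = x' j\<close>[of j] that
          by (cases "c j \<le> \<alpha>") (auto simp: rep_kernel_def v_def full_order_def le_Suc_eq)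
        then show ?thesis unfolding K_def by simp
      qed
      show "\<bar>K x\<bar> \<le> (\<Sum>\<tau>=1..\<alpha>. \<bar>a \<tau>\<bar> * (W \<tau> u c + V \<tau> u))" for x
      proof -
        define g where "g \<tau> = (\<Prod>j\<in>u. grid_kernel (b ^ n \<tau>) \<alpha> (c j) (x j))" for \<tau>
        define A where "A \<tau> = (\<Sum>h<b ^ n \<tau>. kernel_prod \<alpha> u c x (X \<tau> h)) / real (b ^ n \<tau>)" for \<tau>
        have A: "\<bar>A \<tau> - g \<tau>\<bar> \<le> W \<tau> u c" if "\<tau> \<in> {1..\<alpha>}" for \<tau>
          using lattice_minus_grid_le[OF n(2)[OF that] n(1)[OF that] U(2)[OF u] \<alpha>(1) c', where x = x and Q = "Q (n \<tau>)"]
          by (simp only: A_def g_def W_def X_def bdef)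
        have "K x = (\<Sum>\<tau>=1..\<alpha>. a \<tau> * (A \<tau> - g \<tau>)) + (\<Sum>\<tau>=1..\<alpha>. a \<tau> * g \<tau>)"
          by (simp add: K_def A_def sum.distrib[symmetric] right_diff_distrib)
        also have "\<bar>\<dots>\<bar> \<le> \<bar>\<Sum>\<tau>=1..\<alpha>. a \<tau> * (A \<tau> - g \<tau>)\<bar> + \<bar>\<Sum>\<tau>=1..\<alpha>. a \<tau> * g \<tau>\<bar>"
          by (rule abs_triangle_ineq)
        also have "\<dots> \<le> (\<Sum>\<tau>=1..\<alpha>. \<bar>a \<tau>\<bar> * W \<tau> u c) + (\<Sum>\<tau>=1..\<alpha>. \<bar>a \<tau>\<bar> * V \<tau> u)"
        proof (rule add_mono)
          show "\<bar>\<Sum>\<tau>=1..\<alpha>. a \<tau> * (A \<tau> - g \<tau>)\<bar> \<le> (\<Sum>\<tau>=1..\<alpha>. \<bar>a \<tau>\<bar> * W \<tau> u c)"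
            by (rule order_trans[OF sum_abs]) (auto simp: abs_mult intro!: sum_mono mult_left_mono A)
          show "\<bar>\<Sum>\<tau>=1..\<alpha>. a \<tau> * g \<tau>\<bar> \<le> (\<Sum>\<tau>=1..\<alpha>. \<bar>a \<tau>\<bar> * V \<tau> u)"
            unfolding a_def g_def V_def n_def
            by (rule extrapolated_grid_kernels_le[OF b \<alpha>(1,3) U(3,4)[OF u] c'])
        qed
        finally show ?thesis by (simp only: distrib_left sum.distrib)
      qed
    qed
    also have "(\<integral>\<^sup>+y. ennreal \<bar>LINT z|cube ({1..s} - v). D (order_of \<alpha> u c) (merge v ({1..s} - v) (y, z))\<bar> \<partial>cube v) = M u c"
      unfolding M_def v_def D_def
        marginal_of_eq[OF marginal(1) marginal(2)[OF u] marginal(3,4) \<gamma>[OF u] T_fin[OF u] c[unfolded C_def], symmetric] ..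
    finally show ?thesis unfolding K_def .
  qed

  define S where "S \<tau> u = (\<Sum>\<^sub>\<infinity>k\<in>{k \<in> dual_lattice_proj s (n \<tau>) (p (n \<tau>)) (Q (n \<tau>)) u. \<exists>j\<in>u. \<not> b ^ n \<tau> dvd k j}.
      ennreal (1 / real b ^ (\<Sum>j\<in>u. mu b \<alpha> (k j))))" for \<tau> u
  \<comment> \<open>here each marginal is estimated by the whole term of \<open>u\<close>: the constant already covers the sum over the kernels\<close>
  have lattice_part: "(\<Sum>u\<in>U. \<Sum>c\<in>C u. ennreal (W \<tau> u c) * M u c) \<le> B_bound s \<alpha> \<gamma> r' (n \<tau>) (p (n \<tau>)) (Q (n \<tau>))" for \<tau>
  proof -
    have C0: "0 \<le> C_const b \<alpha>" using C_const_ge_2[OF b \<alpha>(1)] by simp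
    have "(\<Sum>c\<in>C u. ennreal (W \<tau> u c) * M u c) \<le> T u * (ennreal (\<gamma> u * C_const b \<alpha> ^ card u) * S \<tau> u)"
      if u: "u \<in> U" for u
    proof -
      have "(\<Sum>c\<in>C u. ennreal (W \<tau> u c) * M u c) \<le> (\<Sum>c\<in>C u. ennreal (W \<tau> u c) * (ennreal (\<gamma> u) * T u))"
        unfolding M_def T_def C_def
        by (intro sum_mono mult_left_mono marginal_integral_le[OF marginal(1) marginal(2)[OF u] marginal(3,4) \<gamma>[OF u] T_fin[OF u]]) auto
      also have "\<dots> = ennreal (\<Sum>c\<in>C u. W \<tau> u c) * (ennreal (\<gamma> u) * T u)"
        by (simp add: sum_distrib_right[symmetric] sum_ennreal W0)
      also have "ennreal (\<Sum>c\<in>C u. W \<tau> u c) \<le>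
          ennreal (C_const b \<alpha> ^ card u * (\<Sum>k\<in>short_dual (n \<tau>) (p (n \<tau>)) (Q (n \<tau>)) u. \<Prod>j\<in>u. lift_weight b \<alpha> (n \<tau>) (k j)))"
        unfolding W_def C_def bdef by (intro ennreal_leI sum_kernel_weights_le[OF U(2)[OF u] \<alpha>(1)])
      also have "\<dots> = ennreal (C_const b \<alpha> ^ card u) *
          ennreal (\<Sum>k\<in>short_dual (n \<tau>) (p (n \<tau>)) (Q (n \<tau>)) u. \<Prod>j\<in>u. lift_weight b \<alpha> (n \<tau>) (k j))"
        using C0 by (intro ennreal_mult zero_le_power sum_nonneg prod_nonneg lift_weight_nonneg)
      also have "\<dots> \<le> ennreal (C_const b \<alpha> ^ card u) * S \<tau> u"
        unfolding S_def bdef by (intro mult_left_mono sum_lift_weights_le[OF U(2)[OF u]]) auto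
      finally show ?thesis
        using \<gamma>[OF u] C0 by (simp add: ennreal_mult mult_ac mult_right_mono)
    qed
    then have "(\<Sum>u\<in>U. \<Sum>c\<in>C u. ennreal (W \<tau> u c) * M u c) \<le>
        (\<Sum>u\<in>U. T u * (ennreal (\<gamma> u * C_const b \<alpha> ^ card u) * S \<tau> u))"
      by (rule sum_mono)
    also have "\<dots> \<le> lp_sum r U T * lp_sum r' U (\<lambda>u. ennreal (\<gamma> u * C_const b \<alpha> ^ card u) * S \<tau> u)"
      by (rule Hoelder_lp_sum[OF U(1) assms(5,7)])
    also have "\<dots> \<le> 1 * lp_sum r' U (\<lambda>u. ennreal (\<gamma> u * C_const b \<alpha> ^ card u) * S \<tau> u)"
      by (rule mult_right_mono[OF lpT]) simp
    finally show ?thesis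
      unfolding B_bound_def S_def bdef U_def by simp
  qed

  \<comment> \<open>here all kernels have the same factor, and the Hoelder inequality over the kernels gives the power of \<open>\<alpha> + 1\<close>\<close>
  have grid_part: "(\<Sum>u\<in>U. \<Sum>c\<in>C u. ennreal (V \<tau> u) * M u c) \<le> H_bound s \<alpha> \<gamma> q' r' / ennreal (real b ^ (\<alpha> * n \<tau>))" for \<tau>
  proof -
    define h where "h u = ennreal (\<gamma> u * real (\<alpha> + 1) powr (real (card u) * enn2real (1 / q')) * D_const \<alpha> ^ card u)" for u
    have "(\<Sum>c\<in>C u. ennreal (V \<tau> u) * M u c) \<le> T u * h u / ennreal (real b ^ (\<alpha> * n \<tau>))" if u: "u \<in> U" for u
    proof -
      have "(\<Sum>c\<in>C u. ennreal (V \<tau> u) * M u c) = ennreal (V \<tau> u) * (\<Sum>c\<in>C u. M u c)"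
        by (simp add: sum_distrib_left)
      also have "\<dots> \<le> ennreal (V \<tau> u) *
          (ennreal (real (\<alpha> + 1) powr (real (card u) * enn2real (1 / q'))) * (ennreal (\<gamma> u) * T u))"
        unfolding M_def T_def C_def
        by (intro mult_left_mono sum_marginal_integrals_le[OF marginal(1) marginal(2)[OF u] marginal(3,4) \<gamma>[OF u] T_fin[OF u]]) auto
      also have "ennreal (V \<tau> u) *
          (ennreal (real (\<alpha> + 1) powr (real (card u) * enn2real (1 / q'))) * (ennreal (\<gamma> u) * T u)) =
          T u * h u / ennreal (real b ^ (\<alpha> * n \<tau>))"
      proof -
        have V: "ennreal (V \<tau> u) = ennreal (D_const \<alpha> ^ card u) / ennreal (real b ^ (\<alpha> * n \<tau>))"
          unfolding V_def using D0 b by (intro divide_ennreal[symmetric]) auto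
        have "h u = ennreal (\<gamma> u) * ennreal (real (\<alpha> + 1) powr (real (card u) * enn2real (1 / q'))) * ennreal (D_const \<alpha> ^ card u)"
          unfolding h_def using \<gamma>[OF u] D0 by (simp only: ennreal_mult powr_ge_zero mult_nonneg_nonneg zero_le_power)
        then show ?thesis unfolding V by (simp only: divide_ennreal_def mult_ac)
      qed
      finally show ?thesis .
    qed
    then have "(\<Sum>u\<in>U. \<Sum>c\<in>C u. ennreal (V \<tau> u) * M u c) \<le> (\<Sum>u\<in>U. T u * h u / ennreal (real b ^ (\<alpha> * n \<tau>)))"
      by (rule sum_mono)
    also have "\<dots> = (\<Sum>u\<in>U. T u * h u) / ennreal (real b ^ (\<alpha> * n \<tau>))"
      by (simp add: divide_ennreal_def sum_distrib_right)
    also have "\<dots> \<le> (1 * H_bound s \<alpha> \<gamma> q' r') / ennreal (real b ^ (\<alpha> * n \<tau>))"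
    proof (rule divide_right_mono_ennreal)
      have "(\<Sum>u\<in>U. T u * h u) \<le> lp_sum r U T * lp_sum r' U h"
        by (rule Hoelder_lp_sum[OF U(1) assms(5,7)])
      also have "\<dots> \<le> 1 * lp_sum r' (Pow {1..s}) h"
        by (intro mult_mono lpT lp_sum_mono_set conjugate_exponent_ge_1[OF assms(5,7)]) (auto simp: U_def)
      finally show "(\<Sum>u\<in>U. T u * h u) \<le> 1 * H_bound s \<alpha> \<gamma> q' r'"
        unfolding H_bound_def h_def .
    qed
    finally show ?thesis by simp
  qed

  have error: "(\<Sum>\<tau>=1..\<alpha>. a \<tau> * qmc (b ^ n \<tau>) (X \<tau>) f) - cube_integral s f =
      (\<Sum>u\<in>U. \<Sum>c\<in>C u. LINT x|cube {1..s}. D (order_of \<alpha> u c) x *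
      (\<Sum>\<tau>=1..\<alpha>. a \<tau> * ((\<Sum>h<b ^ n \<tau>. kernel_prod \<alpha> u c x (X \<tau> h)) / real (b ^ n \<tau>))))"
    (is "_ = (\<Sum>u\<in>U. \<Sum>c\<in>C u. ?e u c)")
    unfolding U_def C_def
    by (rule extrapolated_error_eq[OF D \<alpha>(2)])
       (use b sum_extrap_coeff_eq_1[OF b \<alpha>(2)] in \<open>auto simp: X_def a_def poly_lattice_point_in_cube simp del: One_nat_def\<close>)
  have "ennreal \<bar>(\<Sum>\<tau>=1..\<alpha>. a \<tau> * qmc (b ^ n \<tau>) (X \<tau>) f) - cube_integral s f\<bar> \<le> (\<Sum>u\<in>U. \<Sum>c\<in>C u. ennreal (\<Sum>\<tau>=1..\<alpha>. \<bar>a \<tau>\<bar> * (W \<tau> u c + V \<tau> u)) * M u c)"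
  proof -
    have "\<bar>\<Sum>u\<in>U. \<Sum>c\<in>C u. ?e u c\<bar> \<le> (\<Sum>u\<in>U. \<Sum>c\<in>C u. \<bar>?e u c\<bar>)"
      by (rule order_trans[OF sum_abs sum_mono]) (rule sum_abs)
    then have "ennreal \<bar>\<Sum>u\<in>U. \<Sum>c\<in>C u. ?e u c\<bar> \<le> ennreal (\<Sum>u\<in>U. \<Sum>c\<in>C u. \<bar>?e u c\<bar>)"
      by (rule ennreal_leI)
    also have "\<dots> = (\<Sum>u\<in>U. \<Sum>c\<in>C u. ennreal \<bar>?e u c\<bar>)"
      by (simp only: sum_ennreal[symmetric] sum_nonneg abs_ge_zero)
    also have "\<dots> \<le> (\<Sum>u\<in>U. \<Sum>c\<in>C u. ennreal (\<Sum>\<tau>=1..\<alpha>. \<bar>a \<tau>\<bar> * (W \<tau> u c + V \<tau> u)) * M u c)"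
      by (intro sum_mono single)
    finally show ?thesis unfolding error .
  qed
  also have "\<dots> = (\<Sum>\<tau>=1..\<alpha>. ennreal \<bar>a \<tau>\<bar> * ((\<Sum>u\<in>U. \<Sum>c\<in>C u. ennreal (W \<tau> u c) * M u c) +
      (\<Sum>u\<in>U. \<Sum>c\<in>C u. ennreal (V \<tau> u) * M u c)))"
  proof -
    have "ennreal (\<Sum>\<tau>=1..\<alpha>. \<bar>a \<tau>\<bar> * (W \<tau> u c + V \<tau> u)) * M u c =
        (\<Sum>\<tau>=1..\<alpha>. ennreal \<bar>a \<tau>\<bar> * (ennreal (W \<tau> u c) * M u c + ennreal (V \<tau> u) * M u c))" for u c
    proof -
      have "ennreal (\<Sum>\<tau>=1..\<alpha>. \<bar>a \<tau>\<bar> * (W \<tau> u c + V \<tau> u)) = (\<Sum>\<tau>=1..\<alpha>. ennreal (\<bar>a \<tau>\<bar> * (W \<tau> u c + V \<tau> u)))"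
        by (rule sum_ennreal[symmetric]) (simp add: W0 V0)
      also have "\<dots> = (\<Sum>\<tau>=1..\<alpha>. ennreal \<bar>a \<tau>\<bar> * (ennreal (W \<tau> u c) + ennreal (V \<tau> u)))"
        by (simp add: ennreal_mult W0 V0)
      finally show ?thesis by (simp add: sum_distrib_right distrib_right mult.assoc)
    qed
    then have "(\<Sum>u\<in>U. \<Sum>c\<in>C u. ennreal (\<Sum>\<tau>=1..\<alpha>. \<bar>a \<tau>\<bar> * (W \<tau> u c + V \<tau> u)) * M u c) =
        (\<Sum>u\<in>U. \<Sum>c\<in>C u. \<Sum>\<tau>=1..\<alpha>. ennreal \<bar>a \<tau>\<bar> * (ennreal (W \<tau> u c) * M u c + ennreal (V \<tau> u) * M u c))"
      by (simp only:)
    also have "\<dots> = (\<Sum>u\<in>U. \<Sum>\<tau>=1..\<alpha>. \<Sum>c\<in>C u. ennreal \<bar>a \<tau>\<bar> * (ennreal (W \<tau> u c) * M u c + ennreal (V \<tau> u) * M u c))"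
      by (intro sum.cong refl sum.swap)
    also have "\<dots> = (\<Sum>\<tau>=1..\<alpha>. \<Sum>u\<in>U. \<Sum>c\<in>C u. ennreal \<bar>a \<tau>\<bar> * (ennreal (W \<tau> u c) * M u c + ennreal (V \<tau> u) * M u c))"
      by (rule sum.swap)
    finally show ?thesis by (simp only: sum_distrib_left[symmetric] sum.distrib)
  qed
  also have "\<dots> \<le> (\<Sum>\<tau>=1..\<alpha>. ennreal \<bar>a \<tau>\<bar> * (B_bound s \<alpha> \<gamma> r' (n \<tau>) (p (n \<tau>)) (Q (n \<tau>)) +
      H_bound s \<alpha> \<gamma> q' r' / ennreal (real b ^ (\<alpha> * n \<tau>))))"
    by (intro sum_mono mult_left_mono add_mono lattice_part grid_part) auto
  finally show "ennreal \<bar>(\<Sum>\<tau>=1..\<alpha>. extrap_coeff b \<alpha> \<tau> *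
      qmc (b ^ (m - \<tau> + 1)) (poly_lattice_point s (m - \<tau> + 1) (p (m - \<tau> + 1)) (Q (m - \<tau> + 1))) f) - cube_integral s f\<bar>
    \<le> (\<Sum>\<tau>=1..\<alpha>. ennreal \<bar>extrap_coeff b \<alpha> \<tau>\<bar> *
      (B_bound s \<alpha> \<gamma> r' (m - \<tau> + 1) (p (m - \<tau> + 1)) (Q (m - \<tau> + 1)) +
       H_bound s \<alpha> \<gamma> q' r' / ennreal (real b ^ (\<alpha> * (m - \<tau> + 1)))))"
    by (simp only: a_def n_def X_def)
qed

end
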